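(* Let $(\Theta,\rho)$ be a totally bounded and bounded metric space, let $\Pi$ be a prior distribution on $\overline{\mathcal{G}}(\Theta)$, fix $G_0\in\overline{\mathcal{G}}(\Theta)$, and let $X_1,\dots,X_n$ be an i.i.d. sample from the mixture density $p_{G_0}$. Assume the following. (a) The family of likelihood functions $\{f(\cdot|\theta),\theta\in\Theta\}$ is finitely identifiable and, for some constants $C_1>0$, $\alpha\ge1$, satisfies $h^2\bigl(f(\cdot|\theta),f(\cdot|\theta')\bigr)\le C_1\rho^{2\alpha}(\theta,\theta')$ for all $\theta,\theta'\in\Theta$. (b) There is a sequence of sets $\mathcal{G}_n\subset\overline{\mathcal{G}}(\Theta)$, for which $$M(\mathcal{G}_n,G_1,\varepsilon)=D\Bigl(\frac{\Psi_{\mathcal{G}_n}(\varepsilon)^{1/2}}{2\operatorname{Diam}(\Theta)^{\alpha-1}\sqrt{C_1}},\ \mathcal{G}_n\cap B_W(G_1,\varepsilon/2),\ W_2\Bigr).$$ (c) There is a sequence $\varepsilon_n\to0$ such that $n\varepsilon_n^2$ is bounded away from $0$ or tends to infinity, and a sequence $M_n$, such that $$\log D\bigl(\varepsilon/2,\ \mathcal{G}_n\cap B_W(G_0,2\varepsilon)\setminus B_W(G_0,\varepsilon),\ W_2\bigr)+\sup_{G_1\in\mathcal{G}_n}\log M(\mathcal{G}_n,G_1,\varepsilon)\le n\varepsilon_n^2\quad\forall\,\varepsilon\ge\varepsilon_n,$$ $$\frac{\Pi(\overline{\mathcal{G}}(\Theta)\setminus\mathcal{G}_n)}{\Pi(B_K(\varepsilon_n))}=o\bigl(\exp(-2n\varepsilon_n^2)\bigr),$$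 $$\frac{\Pi\bigl(B_W(G_0,2j\varepsilon_n)\setminus B_W(G_0,j\varepsilon_n)\bigr)}{\Pi(B_K(\varepsilon_n))}\le\exp[n\Psi_{\mathcal{G}_n}(j\varepsilon_n)/16]\quad\forall\,j\ge M_n,$$ $$\exp(2n\varepsilon_n^2)\sum_{j\ge M_n}\exp[-n\Psi_{\mathcal{G}_n}(j\varepsilon_n)/16]\to0 .$$ Then $\Pi\bigl(G: W_2(G_0,G)\ge M_n\varepsilon_n\,\big|\,X_1,\dots,X_n\bigr)\to0$ in $P_{G_0}$-probability.
   Context: $\{f(\cdot|\theta),\theta\in\Theta\}$ is a known family of probability densities on $\mathcal{X}$ with respect to a dominating measure $\mu$. $\mathcal{G}(\Theta)$ is the set of discrete probability measures on $\Theta$ with finite support, and $\overline{\mathcal{G}}(\Theta)$ the set of all discrete probability measures on $\Theta$ (including countably infinite support). For $G=\sum_i p_i\delta_{\theta_i}$, $p_G(x)=\sum_i p_if(x|\theta_i)$, and $P_G$ denotes probability/expectation under the distribution with density $p_G$. $W_2^2(G,G')=\inf_q\sum_{i,j}q_{ij}\rho^2(\theta_i,\theta'_j)$ over couplings $q$ of the weight vectors of $G=\sum_ip_i\delta_{\theta_i}$ and $G'=\sum_jp'_j\delta_{\theta'_j}$. $B_W(G_1,r)=\{G\in\overline{\mathcal{G}}(\Theta):W_2(G_1,G)\le r\}$. $D(\varepsilon,S,W_2)$ is the packing number: the maximum number of points of $S$ mutually separated by at least $\varepsilon$ in $W_2$. $h^2(p,q)=\frac12\int(\sqrt p-\sqrt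 q)^2\,d\mu$ is the squared Hellinger distance. $\operatorname{Diam}(\Theta)$ is the diameter of $\Theta$. The family is finitely identifiable if for any $G\in\mathcal{G}(\Theta)$ and $G'\in\overline{\mathcal{G}}(\Theta)$, $|p_G(x)-p_{G'}(x)|=0$ for almost all $x\in\mathcal{X}$ implies $G=G'$. The posterior is $\Pi(B|X_1,\dots,X_n)=\int_B\prod_{i=1}^np_G(X_i)\,d\Pi(G)\big/\int\prod_{i=1}^np_G(X_i)\,d\Pi(G)$ for measurable $B$. Kullback–Leibler neighborhood: $B_K(\varepsilon)=\bigl\{G\in\overline{\mathcal{G}}(\Theta): -P_{G_0}\bigl(\log\frac{p_G}{p_{G_0}}\bigr)\le\varepsilon^2,\ P_{G_0}\bigl(\log\frac{p_G}{p_{G_0}}\bigr)^2\le\varepsilon^2\bigr\}$. Hellinger information: for $\mathcal{G}\subset\overline{\mathcal{G}}(\Theta)$, $\Psi_{\mathcal{G}}(r)=\inf_{G\in\mathcal{G}:\,W_2(G_0,G)\ge r/2}h^2(p_{G_0},p_G)$; the infimum over the empty set is $+\infty$ (and $\exp(-\infty)=0$). In the conditions above $j$ ranges over integers.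
   Formalization: With closed balls the shells miss the sphere W_2 = M_n ε_n and the claim can fail there; proved for W_2 > M_n ε_n, and for W_2 ≥ M_n ε_n if Π(W_2(G_0,G) = M_n ε_n)/Π(B_K(ε_n)) = o(exp(-2nε_n^2)); M_n is taken to be natural numbers. *)

theory Defs
  imports "HOL-Probability.Probability" "HOL-Library.Extended_Nat" "HOL-Library.Landau_Symbols"
begin

section \<open>Mixing measures and the Wasserstein distance\<close>

text \<open>
  The parameter space is a subset \<open>T\<close> of a metric space, with the distance inherited from \<open>dist\<close>.
  A discrete probability measure on \<open>T\<close> is a \<open>pmf\<close> supported in \<open>T\<close>, since every pmf has countable
  support.
\<close>

definition discrete_measures :: "'t set \<Rightarrow> 't pmf set"
  where "discrete_measures T = {G. set_pmf G \<subseteq> T}"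

definition finite_discrete_measures :: "'t set \<Rightarrow> 't pmf set"
  where "finite_discrete_measures T = {G. set_pmf G \<subseteq> T \<and> finite (set_pmf G)}"

definition couplings :: "'t pmf \<Rightarrow> 't pmf \<Rightarrow> ('t \<times> 't) pmf set"
  where "couplings G G' = {q. map_pmf fst q = G \<and> map_pmf snd q = G'}"

text \<open>
  The expectation below is meaningful only if the squared distance is integrable; this holds for
  measures on a bounded set, the only case in which \<open>W2\<close> is used.
\<close>

definition W2 :: "'t::metric_space pmf \<Rightarrow> 't pmf \<Rightarrow> real"
  where "W2 G G' =
    sqrt (INF q\<in>couplings G G'. measure_pmf.expectation q (\<lambda>(\<theta>, \<theta>'). (dist \<theta> \<theta>')\<^sup>2))"

definition W_ball :: "'t::metric_space set \<Rightarrow> 't pmf \<Rightarrow> real \<Rightarrow> 't pmf set"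
  where "W_ball T G r = {G' \<in> discrete_measures T. W2 G G' \<le> r}"

definition W2_borel :: "'t::metric_space set \<Rightarrow> 't pmf measure"
  where "W2_borel T = sigma (discrete_measures T)
    {U. U \<subseteq> discrete_measures T \<and>
        (\<forall>G\<in>U. \<exists>r>0. \<forall>G'\<in>discrete_measures T. W2 G G' < r \<longrightarrow> G' \<in> U)}"


section \<open>Extended-real auxiliaries\<close>

definition log_enat :: "enat \<Rightarrow> ereal"
  where "log_enat k = (case k of enat m \<Rightarrow> if m = 0 then - \<infinity> else ereal (ln (real m)) | \<infinity> \<Rightarrow> \<infinity>)"

definition exp_ereal :: "ereal \<Rightarrow> ennreal"
  where "exp_ereal x = (case x of ereal r \<Rightarrow> ennreal (exp r) | PInfty \<Rightarrow> \<infinity> | MInfty \<Rightarrow> 0)"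

text \<open>Only applied to nonnegative arguments.\<close>

definition sqrt_ereal :: "ereal \<Rightarrow> ereal"
  where "sqrt_ereal x = (case x of ereal r \<Rightarrow> ereal (sqrt r) | PInfty \<Rightarrow> \<infinity> | MInfty \<Rightarrow> - \<infinity>)"


section \<open>Packing numbers\<close>

text \<open>
  The separation \<open>r\<close> is extended real because it is computed from the Hellinger information, which may
  be infinite; a set that is separated by \<open>\<infinity>\<close> has at most one point.
\<close>

definition packing_number :: "ereal \<Rightarrow> 't::metric_space pmf set \<Rightarrow> enat"
  where "packing_number r S =
    (SUP F\<in>{F. finite F \<and> F \<subseteq> S \<and> pairwise (\<lambda>G G'. r \<le> ereal (W2 G G')) F}. enat (card F))"


section \<open>Mixture densities\<close>

text \<open>\<open>f \<theta> x\<close> is the density at \<open>x\<close>, with respect to \<open>\<mu>\<close>, of the distribution with parameter \<open>\<theta>\<close>.\<close>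

definition density_family ::
    "'x measure \<Rightarrow> 't::metric_space set \<Rightarrow> ('t \<Rightarrow> 'x \<Rightarrow> real) \<Rightarrow> bool"
  where "density_family \<mu> T f \<longleftrightarrow>
    (\<lambda>(\<theta>, x). f \<theta> x) \<in> borel_measurable (restrict_space borel T \<Otimes>\<^sub>M \<mu>) \<and>
    (\<forall>\<theta>\<in>T. (\<forall>x\<in>space \<mu>. 0 \<le> f \<theta> x) \<and> (\<integral>\<^sup>+x. ennreal (f \<theta> x) \<partial>\<mu>) = 1)"

definition mixture_density :: "('t \<Rightarrow> 'x \<Rightarrow> real) \<Rightarrow> 't pmf \<Rightarrow> 'x \<Rightarrow> real"
  where "mixture_density f G x = measure_pmf.expectation G (\<lambda>\<theta>. f \<theta> x)"

definition mixture_measure :: "'x measure \<Rightarrow> ('t \<Rightarrow> 'x \<Rightarrow> real) \<Rightarrow> 't pmf \<Rightarrow> 'x measure"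
  where "mixture_measure \<mu> f G = density \<mu> (\<lambda>x. ennreal (mixture_density f G x))"

definition finitely_identifiable ::
    "'x measure \<Rightarrow> 't set \<Rightarrow> ('t \<Rightarrow> 'x \<Rightarrow> real) \<Rightarrow> bool"
  where "finitely_identifiable \<mu> T f \<longleftrightarrow>
    (\<forall>G\<in>finite_discrete_measures T. \<forall>G'\<in>discrete_measures T.
       (AE x in \<mu>. \<bar>mixture_density f G x - mixture_density f G' x\<bar> = 0) \<longrightarrow> G = G')"

definition hellinger_sq :: "'x measure \<Rightarrow> ('x \<Rightarrow> real) \<Rightarrow> ('x \<Rightarrow> real) \<Rightarrow> real"
  where "hellinger_sq \<mu> p q = 1 / 2 * (\<integral>x. (sqrt (p x) - sqrt (q x))\<^sup>2 \<partial>\<mu>)"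

definition hellinger_information ::
    "'x measure \<Rightarrow> ('t::metric_space \<Rightarrow> 'x \<Rightarrow> real) \<Rightarrow> 't pmf \<Rightarrow> 't pmf set \<Rightarrow> real \<Rightarrow> ereal"
  where "hellinger_information \<mu> f G\<^sub>0 \<G> r =
    (INF G\<in>{G \<in> \<G>. r / 2 \<le> W2 G\<^sub>0 G}.
       ereal (hellinger_sq \<mu> (mixture_density f G\<^sub>0) (mixture_density f G)))"

text \<open>
  If \<open>p\<^bsub>G\<^esub>\<close> vanishes on a set of positive \<open>P\<^bsub>G\<^sub>0\<^esub>\<close>-probability then \<open>log (p\<^bsub>G\<^esub> / p\<^bsub>G\<^sub>0\<^esub>)\<close> is \<open>-\<infinity>\<close> there and
  \<open>G\<close> lies outside every neighbourhood. Since \<open>ln 0 = 0\<close> and Bochner integrals of non-integrable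
  functions are 0, positivity and integrability have to be stated.
\<close>

definition KL_neighbourhood ::
    "'x measure \<Rightarrow> 't set \<Rightarrow> ('t \<Rightarrow> 'x \<Rightarrow> real) \<Rightarrow> 't pmf \<Rightarrow> real \<Rightarrow> 't pmf set"
  where "KL_neighbourhood \<mu> T f G\<^sub>0 \<epsilon> =
    {G \<in> discrete_measures T.
       let P\<^sub>0 = mixture_measure \<mu> f G\<^sub>0;
           L = (\<lambda>x. ln (mixture_density f G x / mixture_density f G\<^sub>0 x))
       in (AE x in P\<^sub>0. 0 < mixture_density f G x) \<and>
          integrable P\<^sub>0 L \<and> integrable P\<^sub>0 (\<lambda>x. (L x)\<^sup>2) \<and>
          - (\<integral>x. L x \<partial>P\<^sub>0) \<le> \<epsilon>\<^sup>2 \<and> (\<integral>x. (L x)\<^sup>2 \<partial>P\<^sub>0) \<le> \<epsilon>\<^sup>2}"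

text \<open>
  The number of Wasserstein balls needed locally in the construction of tests. In the degenerate case
  \<open>diameter T = 0\<close>, \<open>\<alpha> = 1\<close> the power below is \<open>0 powr 0 = 0\<close> rather than 1; this is immaterial, as
  then the Hellinger information at every \<open>\<epsilon> > 0\<close> is infinite and so is the separation.
\<close>

definition local_packing ::
    "'x measure \<Rightarrow> 't::metric_space set \<Rightarrow> ('t \<Rightarrow> 'x \<Rightarrow> real) \<Rightarrow> 't pmf \<Rightarrow> real \<Rightarrow> real \<Rightarrow>
     't pmf set \<Rightarrow> 't pmf \<Rightarrow> real \<Rightarrow> enat"
  where "local_packing \<mu> T f G\<^sub>0 C\<^sub>1 \<alpha> \<G> G\<^sub>1 \<epsilon> =
    packing_number
      (sqrt_ereal (hellinger_information \<mu> f G\<^sub>0 \<G> \<epsilon>)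
         / ereal (2 * diameter T powr (\<alpha> - 1) * sqrt C\<^sub>1))
      (\<G> \<inter> W_ball T G\<^sub>1 (\<epsilon> / 2))"


section \<open>Posterior distribution\<close>

text \<open>The sample is \<open>x 1, \<dots>, x n\<close>.\<close>

definition posterior ::
    "'t pmf measure \<Rightarrow> ('t \<Rightarrow> 'x \<Rightarrow> real) \<Rightarrow> nat \<Rightarrow> (nat \<Rightarrow> 'x) \<Rightarrow> 't pmf set \<Rightarrow> ennreal"
  where "posterior prior f n x B =
    (\<integral>\<^sup>+G\<in>B. (\<Prod>i\<in>{1..n}. ennreal (mixture_density f G (x i))) \<partial>prior) /
    (\<integral>\<^sup>+G. (\<Prod>i\<in>{1..n}. ennreal (mixture_density f G (x i))) \<partial>prior)"

definition vanishes_in_probability :: "'w measure \<Rightarrow> (nat \<Rightarrow> 'w \<Rightarrow> ennreal) \<Rightarrow> bool"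
  where "vanishes_in_probability \<Omega> Y \<longleftrightarrow>
    (\<forall>\<delta>>0. (\<lambda>n. measure \<Omega> {\<omega> \<in> space \<Omega>. ennreal \<delta> < Y n \<omega>}) \<longlonglongrightarrow> 0)"

end

theory Submission
  imports Defs
begin

text \<open>
  Posterior mass is bounded through square roots of likelihood averages instead of tests. For a set
  \<open>A\<close> of mixing measures write \<open>L\<^sub>n(A)\<close> for the prior integral over \<open>A\<close> of the likelihood ratio of \<open>G\<close> to
  \<open>G\<^sub>0\<close>. If the densities of \<open>A\<close> lie in a Hellinger ball around \<open>p\<^bsub>G\<^sub>2\<^esub>\<close> whose radius is half the distance
  of \<open>p\<^bsub>G\<^sub>2\<^esub>\<close> from \<open>p\<^bsub>G\<^sub>0\<^esub>\<close>, then so does every predictive density, by convexity, and integrating out one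
  observation at a time gives \<open>E (L\<^sub>n(A))\<^sup>\<onehalf> \<le> \<Pi>(A)\<^sup>\<onehalf> exp (- n h\<^sup>2(p\<^bsub>G\<^sub>0\<^esub>, p\<^bsub>G\<^sub>2\<^esub>) / 4)\<close>. Each Wasserstein
  shell is covered by such pieces, their number being controlled by the entropy condition because the
  Hellinger distance of mixtures is Lipschitz in \<open>W\<^sub>2\<close>. On an event of probability near 1 the evidence
  \<open>L\<^sub>n\<close> of the whole space is bounded below by Jensen's and Chebyshev's inequalities, and the posterior
  mass of a piece, being at most 1, is at most the square root of its bound.
\<close>

text \<open>The constants serve one budget, in which \<epsilon> is the rate, n the sample size and
  \<Psi> the Hellinger information of a shell. A shell needs at most exp(n \<epsilon>^2) pieces. The
  square root of the evidence bound costs another exp(n \<epsilon>^2) up to a constant, and that of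
  the shell mass ratio costs exp(n \<Psi> / 32), while the affinity gains exp(- n \<Psi> / 4). The
  total is at most a constant times exp(2 n \<epsilon>^2) exp(- n \<Psi> / 16), a term of the
  summability condition. Outside the sieve nothing separates the densities from that of
  \<open>G\<^sub>0\<close>; that part is bounded by its plain expectation and pays the full evidence
  cost exp(2 n \<epsilon>^2), which is where its little-o rate comes from. Two obstacles shape the
  rest. The dominating measure \<mu> is arbitrary, so integrals over \<mu> are exchanged either with
  countable sums or after restriction to a \<sigma>-finite part. Balls are closed, so the shells of
  index at least \<open>M n\<close> leave out the sphere of radius
  \<open>M n * \<epsilon> n\<close>, which needs a separate argument.\<close>

section \<open>Square-integrable functions: Cauchy-Schwarz, Minkowski and convexity\<close>

lemma
  fixes f g :: "'a \<Rightarrow> real"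
  assumes [measurable]: "f \<in> borel_measurable M" "g \<in> borel_measurable M"
    and f: "integrable M (\<lambda>x. (f x)\<^sup>2)" and g: "integrable M (\<lambda>x. (g x)\<^sup>2)"
  shows integrable_mult_square: "integrable M (\<lambda>x. f x * g x)"
    and Cauchy_Schwarz_integral:
      "(\<integral>x. f x * g x \<partial>M) \<le> sqrt (\<integral>x. (f x)\<^sup>2 \<partial>M) * sqrt (\<integral>x. (g x)\<^sup>2 \<partial>M)"
proof -
  have bound: "\<bar>f x * g x\<bar> \<le> (f x)\<^sup>2 + (g x)\<^sup>2" for x
  proof -
    have "2 * \<bar>f x * g x\<bar> \<le> (f x)\<^sup>2 + (g x)\<^sup>2"
      using sum_squares_bound[of "\<bar>f x\<bar>" "\<bar>g x\<bar>"] by (simp add: abs_mult mult.assoc)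
    then show ?thesis by linarith
  qed
  show int: "integrable M (\<lambda>x. f x * g x)"
    by (rule Bochner_Integration.integrable_bound[OF Bochner_Integration.integrable_add[OF f g]])
      (use bound in \<open>auto intro!: AE_I2 simp: abs_of_nonneg\<close>)
  have *: "(\<integral>\<^sup>+x. ennreal \<bar>f x\<bar> * ennreal \<bar>g x\<bar> \<partial>M)\<^sup>2
      \<le> (\<integral>\<^sup>+x. ennreal \<bar>f x\<bar> ^ 2 \<partial>M) * (\<integral>\<^sup>+x. ennreal \<bar>g x\<bar> ^ 2 \<partial>M)"
    by (rule Cauchy_Schwarz_nn_integral) auto
  have "(\<integral>\<^sup>+x. ennreal \<bar>f x\<bar> * ennreal \<bar>g x\<bar> \<partial>M) = ennreal (\<integral>x. \<bar>f x * g x\<bar> \<partial>M)"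
    by (subst nn_integral_eq_integral[symmetric])
      (use integrable_abs[OF int] in \<open>auto simp: ennreal_mult abs_mult\<close>)
  moreover have "(\<integral>\<^sup>+x. ennreal \<bar>f x\<bar> ^ 2 \<partial>M) = ennreal (\<integral>x. (f x)\<^sup>2 \<partial>M)"
    by (subst nn_integral_eq_integral[symmetric]) (use f in \<open>auto simp: ennreal_power\<close>)
  moreover have "(\<integral>\<^sup>+x. ennreal \<bar>g x\<bar> ^ 2 \<partial>M) = ennreal (\<integral>x. (g x)\<^sup>2 \<partial>M)"
    by (subst nn_integral_eq_integral[symmetric]) (use g in \<open>auto simp: ennreal_power\<close>)
  ultimately have "(\<integral>x. \<bar>f x * g x\<bar> \<partial>M)\<^sup>2 \<le> (\<integral>x. (f x)\<^sup>2 \<partial>M) * (\<integral>x. (g x)\<^sup>2 \<partial>M)"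
    using * by (simp add: ennreal_power ennreal_mult[symmetric])
  then have "(\<integral>x. \<bar>f x * g x\<bar> \<partial>M) \<le> sqrt ((\<integral>x. (f x)\<^sup>2 \<partial>M) * (\<integral>x. (g x)\<^sup>2 \<partial>M))"
    by (rule real_le_rsqrt)
  moreover have "(\<integral>x. f x * g x \<partial>M) \<le> (\<integral>x. \<bar>f x * g x\<bar> \<partial>M)"
    by (rule integral_mono) (use int in auto)
  ultimately show "(\<integral>x. f x * g x \<partial>M) \<le> sqrt (\<integral>x. (f x)\<^sup>2 \<partial>M) * sqrt (\<integral>x. (g x)\<^sup>2 \<partial>M)"
    by (simp add: real_sqrt_mult)
qed

lemma Minkowski_integral_square:
  fixes f g :: "'a \<Rightarrow> real"
  assumes [measurable]: "f \<in> borel_measurable M" "g \<in> borel_measurable M"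
    and f: "integrable M (\<lambda>x. (f x)\<^sup>2)" and g: "integrable M (\<lambda>x. (g x)\<^sup>2)"
  shows "(\<integral>x. (f x + g x)\<^sup>2 \<partial>M) \<le> (sqrt (\<integral>x. (f x)\<^sup>2 \<partial>M) + sqrt (\<integral>x. (g x)\<^sup>2 \<partial>M))\<^sup>2"
proof -
  note fg = integrable_mult_square[OF assms] Cauchy_Schwarz_integral[OF assms]
  have "(\<integral>x. (f x + g x)\<^sup>2 \<partial>M) = (\<integral>x. (f x)\<^sup>2 + (g x)\<^sup>2 + 2 * (f x * g x) \<partial>M)"
    by (simp add: power2_sum mult.assoc)
  also have "\<dots> = (\<integral>x. (f x)\<^sup>2 \<partial>M) + (\<integral>x. (g x)\<^sup>2 \<partial>M) + 2 * (\<integral>x. f x * g x \<partial>M)"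
    using f g fg(1) by simp
  finally show ?thesis
    using fg(2) by (simp add: power2_sum)
qed

text \<open>The map (a, b) \<mapsto> (sqrt a - sqrt b)^2 is convex and homogeneous of degree one, so
  Jensen's inequality holds for it under any measure; expanding the squares reduces it to
  Cauchy-Schwarz. It serves twice: with \<open>M\<close> a coupling, for mixtures, and with
  \<open>M\<close> a prior, for predictive densities.\<close>

lemma
  fixes a b :: "'a \<Rightarrow> real"
  assumes a: "integrable M a" and b: "integrable M b"
    and nonneg: "\<And>x. x \<in> space M \<Longrightarrow> 0 \<le> a x" "\<And>x. x \<in> space M \<Longrightarrow> 0 \<le> b x"
  shows integrable_sqrt_diff: "integrable M (\<lambda>x. (sqrt (a x) - sqrt (b x))\<^sup>2)"
    and sqrt_diff_integral_le:
      "(sqrt (\<integral>x. a x \<partial>M) - sqrt (\<integral>x. b x \<partial>M))\<^sup>2 \<le> (\<integral>x. (sqrt (a x) - sqrt (b x))\<^sup>2 \<partial>M)"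
proof -
  have [measurable]: "a \<in> borel_measurable M" "b \<in> borel_measurable M"
    using a b by auto
  have sq: "integrable M (\<lambda>x. (sqrt (a x))\<^sup>2)" "integrable M (\<lambda>x. (sqrt (b x))\<^sup>2)"
    "(\<integral>x. (sqrt (a x))\<^sup>2 \<partial>M) = (\<integral>x. a x \<partial>M)" "(\<integral>x. (sqrt (b x))\<^sup>2 \<partial>M) = (\<integral>x. b x \<partial>M)"
    using a b nonneg by (auto cong: Bochner_Integration.integrable_cong Bochner_Integration.integral_cong)
  have int: "integrable M (\<lambda>x. sqrt (a x) * sqrt (b x))"
    by (rule integrable_mult_square) (use sq in auto)
  have CS: "(\<integral>x. sqrt (a x) * sqrt (b x) \<partial>M) \<le> sqrt (\<integral>x. a x \<partial>M) * sqrt (\<integral>x. b x \<partial>M)"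
    using Cauchy_Schwarz_integral[of "\<lambda>x. sqrt (a x)" M "\<lambda>x. sqrt (b x)"] sq by simp
  have eq: "(sqrt (a x) - sqrt (b x))\<^sup>2 = a x + b x - 2 * (sqrt (a x) * sqrt (b x))" if "x \<in> space M" for x
    using nonneg[OF that] by (simp add: power2_diff)
  have "integrable M (\<lambda>x. a x + b x - 2 * (sqrt (a x) * sqrt (b x)))"
    using int a b by simp
  then show "integrable M (\<lambda>x. (sqrt (a x) - sqrt (b x))\<^sup>2)"
    using eq by (subst Bochner_Integration.integrable_cong[OF refl]) auto
  have "0 \<le> (\<integral>x. a x \<partial>M)" "0 \<le> (\<integral>x. b x \<partial>M)"
    using nonneg by (auto intro!: integral_nonneg_AE AE_I2)
  then have "(sqrt (\<integral>x. a x \<partial>M) - sqrt (\<integral>x. b x \<partial>M))\<^sup>2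
      = (\<integral>x. a x \<partial>M) + (\<integral>x. b x \<partial>M) - 2 * (sqrt (\<integral>x. a x \<partial>M) * sqrt (\<integral>x. b x \<partial>M))"
    by (simp add: power2_diff)
  also have "\<dots> \<le> (\<integral>x. a x \<partial>M) + (\<integral>x. b x \<partial>M) - 2 * (\<integral>x. sqrt (a x) * sqrt (b x) \<partial>M)"
    using CS by simp
  also have "\<dots> = (\<integral>x. a x + b x - 2 * (sqrt (a x) * sqrt (b x)) \<partial>M)"
    using int a b by simp
  also have "\<dots> = (\<integral>x. (sqrt (a x) - sqrt (b x))\<^sup>2 \<partial>M)"
    using eq by (intro Bochner_Integration.integral_cong) auto
  finally show "(sqrt (\<integral>x. a x \<partial>M) - sqrt (\<integral>x. b x \<partial>M))\<^sup>2
      \<le> (\<integral>x. (sqrt (a x) - sqrt (b x))\<^sup>2 \<partial>M)" .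
qed

section \<open>The Wasserstein distance\<close>

abbreviation coupling_cost :: "('t::metric_space \<times> 't) pmf \<Rightarrow> real"
  where "coupling_cost q \<equiv> measure_pmf.expectation q (\<lambda>(\<theta>, \<theta>'). (dist \<theta> \<theta>')\<^sup>2)"

lemma coupling_cost_nonneg: "0 \<le> coupling_cost q"
  by (rule Bochner_Integration.integral_nonneg) auto

lemma couplings_nonempty: "couplings G G' \<noteq> {}"
  by (auto simp: couplings_def map_fst_pair_pmf map_snd_pair_pmf intro!: exI[of _ "pair_pmf G G'"])

lemma bdd_below_coupling_cost: "bdd_below (coupling_cost ` A)"
  by (rule bdd_belowI[of _ 0]) (auto simp: coupling_cost_nonneg)

lemma W2_nonneg: "0 \<le> W2 G G'"
  unfolding W2_def by (auto intro!: real_sqrt_ge_zero cINF_greatest couplings_nonempty coupling_cost_nonneg)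

lemma W2_square: "(W2 G G')\<^sup>2 = (INF q\<in>couplings G G'. coupling_cost q)"
proof -
  have "0 \<le> (INF q\<in>couplings G G'. coupling_cost q)"
    by (intro cINF_greatest couplings_nonempty coupling_cost_nonneg)
  then show ?thesis by (simp add: W2_def)
qed

lemma W2_le_coupling: "q \<in> couplings G G' \<Longrightarrow> W2 G G' \<le> sqrt (coupling_cost q)"
  unfolding W2_def by (intro real_sqrt_le_mono cINF_lower bdd_below_coupling_cost)

text \<open>Near-optimal couplings suffice throughout, so attainment of the infimum is never an
  issue.\<close>

lemma W2_less_coupling:
  assumes "W2 G G' < r"
  obtains q where "q \<in> couplings G G'" "coupling_cost q < r\<^sup>2"
proof -
  have "(INF q\<in>couplings G G'. coupling_cost q) < r\<^sup>2"
    unfolding W2_square[symmetric] using assms W2_nonneg by (rule power_strict_mono) simp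
  then show ?thesis
    using that by (auto simp: cINF_less_iff[OF couplings_nonempty bdd_below_coupling_cost])
qed

lemma W2_commute: "W2 G G' = W2 G' G"
proof -
  have *: "W2 A B \<le> W2 B A" for A B :: "'a pmf"
  proof (rule ccontr)
    assume "\<not> W2 A B \<le> W2 B A"
    then obtain q where q: "q \<in> couplings B A" "coupling_cost q < (W2 A B)\<^sup>2"
      using W2_less_coupling[of B A "W2 A B"] by auto
    define q' where "q' = map_pmf prod.swap q"
    have "q' \<in> couplings A B"
      using q(1) by (auto simp: couplings_def q'_def map_pmf_comp)
    moreover have "coupling_cost q' = coupling_cost q"
      by (simp add: q'_def case_prod_beta' dist_commute)
    ultimately show False
      using q(2) W2_le_coupling[of q' A B] W2_nonneg[of A B] coupling_cost_nonneg[of q]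
      by (metis linorder_not_less real_less_lsqrt)
  qed
  show ?thesis using *[of G G'] *[of G' G] by simp
qed

lemma W2_self: "W2 G G = 0"
proof -
  have "map_pmf (\<lambda>x. (x, x)) G \<in> couplings G G"
    by (simp add: couplings_def map_pmf_comp)
  from W2_le_coupling[OF this] show ?thesis
    using W2_nonneg[of G G] by simp
qed

lemma set_pmf_coupling:
  assumes "q \<in> couplings G G'" "G \<in> discrete_measures T" "G' \<in> discrete_measures T"
  shows "set_pmf q \<subseteq> T \<times> T"
proof -
  have "set_pmf (map_pmf fst q) \<subseteq> T" "set_pmf (map_pmf snd q) \<subseteq> T"
    using assms by (auto simp: couplings_def discrete_measures_def simp del: set_map_pmf)
  then show ?thesis by force
qed

text \<open>A Bochner integral of a non-integrable function is 0, so boundedness of \<open>T\<close>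
  is what makes \<open>coupling_cost\<close> the true transport cost.\<close>

lemma integrable_pmf_dist_square:
  fixes T :: "'t::metric_space set"
  assumes "bounded T" "\<And>z. z \<in> set_pmf r \<Longrightarrow> u z \<in> T \<and> v z \<in> T"
  shows "integrable (measure_pmf r) (\<lambda>z. (dist (u z) (v z))\<^sup>2)"
proof (rule measure_pmf.integrable_const_bound[where B = "(diameter T)\<^sup>2"])
  show "AE z in measure_pmf r. norm ((dist (u z) (v z))\<^sup>2) \<le> (diameter T)\<^sup>2"
    using assms by (auto simp: AE_measure_pmf_iff intro!: power_mono diameter_bounded_bound)
qed auto

text \<open>The gluing construction: draw (x, y) from \<open>q\<close>, then z from
  \<open>q'\<close> conditioned on its first coordinate being y, so that x and z are conditionally
  independent given y. Averaging the conditional laws over \<open>B\<close> restores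
  \<open>q'\<close>.\<close>

lemma glue_couplings:
  assumes "q \<in> couplings A B" "q' \<in> couplings B C"
  obtains r where "map_pmf (\<lambda>(a, b, c). (a, b)) r = q" "map_pmf (\<lambda>(a, b, c). (b, c)) r = q'"
proof -
  define r where "r = bind_pmf q (\<lambda>xy. map_pmf (\<lambda>yz. (fst xy, snd xy, snd yz)) (cond_pmf q' {yz. fst yz = snd xy}))"
  have B: "map_pmf snd q = B" "map_pmf fst q' = B"
    using assms by (auto simp: couplings_def)
  have ne: "set_pmf q' \<inter> {yz. fst yz = y} \<noteq> {}" if "y \<in> set_pmf B" for y
    using that by (force simp: B(2)[symmetric])
  have ne': "set_pmf q' \<inter> {yz. fst yz = snd xy} \<noteq> {}" if "xy \<in> set_pmf q" for xy
    by (rule ne) (use that B(1) in auto)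
  have "map_pmf (\<lambda>(a, b, c). (a, b)) r = bind_pmf q (\<lambda>xy. map_pmf (\<lambda>yz. xy) (cond_pmf q' {yz. fst yz = snd xy}))"
    by (simp add: r_def map_bind_pmf map_pmf_comp)
  then have 1: "map_pmf (\<lambda>(a, b, c). (a, b)) r = q"
    by (simp add: bind_return_pmf')
  have "map_pmf (\<lambda>(a, b, c). (b, c)) r
      = bind_pmf q (\<lambda>xy. map_pmf (\<lambda>yz. (snd xy, snd yz)) (cond_pmf q' {yz. fst yz = snd xy}))"
    by (simp add: r_def map_bind_pmf map_pmf_comp)
  also have "\<dots> = bind_pmf q (\<lambda>xy. map_pmf (\<lambda>yz. yz) (cond_pmf q' {yz. fst yz = snd xy}))"
    by (intro bind_pmf_cong refl map_pmf_cong) (auto simp: set_cond_pmf[OF ne'])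
  also have "\<dots> = bind_pmf B (\<lambda>y. cond_pmf q' {yz. fst yz = y})"
    by (simp add: B(1)[symmetric] bind_map_pmf)
  also have "\<dots> = q'"
    unfolding B(2)[symmetric] bind_map_pmf
    by (subst bind_cond_pmf_cancel) (auto simp: eq_commute)
  finally show thesis using 1 that by blast
qed

text \<open>Glue two nearly optimal couplings and apply Minkowski's inequality to the pointwise
  triangle inequality; each coupling contributes \<open>e / 2\<close> of slack.\<close>

lemma W2_triangle:
  fixes T :: "'t::metric_space set"
  assumes T: "bounded T" and "A \<in> discrete_measures T" "B \<in> discrete_measures T" "C \<in> discrete_measures T"
  shows "W2 A C \<le> W2 A B + W2 B C"
proof (rule field_le_epsilon)
  fix e :: real assume e: "e > 0"
  obtain q where q: "q \<in> couplings A B" "coupling_cost q < (W2 A B + e / 2)\<^sup>2"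
    using W2_less_coupling[of A B "W2 A B + e/2"] e by auto
  obtain q' where q': "q' \<in> couplings B C" "coupling_cost q' < (W2 B C + e / 2)\<^sup>2"
    using W2_less_coupling[of B C "W2 B C + e/2"] e by auto
  obtain r where r: "map_pmf (\<lambda>(a, b, c). (a, b)) r = q" "map_pmf (\<lambda>(a, b, c). (b, c)) r = q'"
    using glue_couplings[OF q(1) q'(1)] .
  let ?a = "fst :: 't \<times> 't \<times> 't \<Rightarrow> 't" and ?b = "\<lambda>z. fst (snd z) :: 't" and ?c = "\<lambda>z. snd (snd z) :: 't"
  have supp: "?a z \<in> T \<and> ?b z \<in> T \<and> ?c z \<in> T" if "z \<in> set_pmf r" for z
    using that set_pmf_coupling[OF q(1) assms(2,3)] set_pmf_coupling[OF q'(1) assms(3,4)]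
    unfolding r[symmetric] by (cases z) (auto simp: image_subset_iff)
  have int: "integrable (measure_pmf r) (\<lambda>z. (dist (?a z) (?b z))\<^sup>2)"
       "integrable (measure_pmf r) (\<lambda>z. (dist (?b z) (?c z))\<^sup>2)"
       "integrable (measure_pmf r) (\<lambda>z. (dist (?a z) (?c z))\<^sup>2)"
    by (rule integrable_pmf_dist_square[OF T]; use supp in blast)+
  have qe: "coupling_cost q = (\<integral>z. (dist (?a z) (?b z))\<^sup>2 \<partial>measure_pmf r)"
    "coupling_cost q' = (\<integral>z. (dist (?b z) (?c z))\<^sup>2 \<partial>measure_pmf r)"
    unfolding r[symmetric] by (auto simp: case_prod_beta)
  define s where "s = map_pmf (\<lambda>z. (?a z, ?c z)) r"
  have "s \<in> couplings A C"
    using q(1) q'(1) unfolding r[symmetric]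
    by (auto simp: couplings_def s_def map_pmf_comp case_prod_beta)
  then have "W2 A C \<le> sqrt (coupling_cost s)"
    by (rule W2_le_coupling)
  also have "coupling_cost s = (\<integral>z. (dist (?a z) (?c z))\<^sup>2 \<partial>measure_pmf r)"
    by (simp add: s_def)
  also have "\<dots> \<le> (\<integral>z. (dist (?a z) (?b z) + dist (?b z) (?c z))\<^sup>2 \<partial>measure_pmf r)"
  proof (rule integral_mono[OF int(3)])
    show "integrable (measure_pmf r) (\<lambda>z. (dist (?a z) (?b z) + dist (?b z) (?c z))\<^sup>2)"
      unfolding power2_sum mult.assoc
      by (intro Bochner_Integration.integrable_add int integrable_mult_right integrable_mult_square) auto
  qed (auto intro!: power_mono dist_triangle)
  also have "\<dots> \<le> (sqrt (coupling_cost q) + sqrt (coupling_cost q'))\<^sup>2"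
    unfolding qe by (rule Minkowski_integral_square) (use int in auto)
  also have "sqrt \<dots> = sqrt (coupling_cost q) + sqrt (coupling_cost q')"
    using coupling_cost_nonneg[of q] coupling_cost_nonneg[of q'] by simp
  also have "sqrt (coupling_cost q) \<le> W2 A B + e / 2"
    using q(2) e W2_nonneg[of A B] by (intro real_le_lsqrt) auto
  also have "sqrt (coupling_cost q') \<le> W2 B C + e / 2"
    using q'(2) e W2_nonneg[of B C] by (intro real_le_lsqrt) auto
  finally show "W2 A C \<le> W2 A B + W2 B C + e" by simp
qed

section \<open>The Borel structure on mixing measures\<close>

lemma space_W2_borel: "space (W2_borel T) = discrete_measures T"
  unfolding W2_borel_def by (rule space_measure_of) auto

lemma W2_open_sets:
  assumes "U \<subseteq> discrete_measures T"
    "\<And>G. G \<in> U \<Longrightarrow> \<exists>r>0. \<forall>G'\<in>discrete_measures T. W2 G G' < r \<longrightarrow> G' \<in> U"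
  shows "U \<in> sets (W2_borel T)"
  unfolding W2_borel_def by (subst sets_measure_of) (use assms in auto)

text \<open>By the triangle inequality the strict sublevel sets are open, and open sets generate
  \<open>W2_borel T\<close>.\<close>

lemma borel_measurable_W2:
  assumes T: "bounded T" and G0: "G0 \<in> discrete_measures T"
  shows "W2 G0 \<in> borel_measurable (W2_borel T)"
  unfolding borel_measurable_iff_less space_W2_borel
proof
  fix a
  show "{w \<in> discrete_measures T. W2 G0 w < a} \<in> sets (W2_borel T)"
  proof (rule W2_open_sets)
    fix G assume G: "G \<in> {w \<in> discrete_measures T. W2 G0 w < a}"
    show "\<exists>r>0. \<forall>G'\<in>discrete_measures T. W2 G G' < r \<longrightarrow> G' \<in> {w \<in> discrete_measures T. W2 G0 w < a}"
    proof (intro exI[of _ "a - W2 G0 G"] conjI ballI impI)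
      fix G' assume "G' \<in> discrete_measures T" "W2 G G' < a - W2 G0 G"
      then show "G' \<in> {w \<in> discrete_measures T. W2 G0 w < a}"
        using W2_triangle[OF T G0, of G G'] G by auto
    qed (use G in auto)
  qed auto
qed

lemma W_ball_in_sets:
  assumes "bounded T" "G0 \<in> discrete_measures T"
  shows "W_ball T G0 r \<in> sets (W2_borel T)"
proof -
  note [measurable] = borel_measurable_W2[OF assms]
  have "{G \<in> space (W2_borel T). W2 G0 G \<le> r} \<in> sets (W2_borel T)"
    by measurable
  then show ?thesis by (simp add: W_ball_def space_W2_borel)
qed

lemma coupling_measure:
  assumes "q \<in> couplings G G'"
  shows "measure G A = measure q {z. fst z \<in> A}" "measure G' A = measure q {z. snd z \<in> A}"
  using assms by (auto simp: couplings_def vimage_def)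

text \<open>By Markov's inequality, mass at depth \<open>\<eta>\<close> inside \<open>U\<close> can leave \<open>U\<close> only at transport cost \<open>\<eta>\<^sup>2\<close>.\<close>

lemma measure_open_lower_semicontinuous:
  fixes T :: "'t::metric_space set"
  assumes T: "bounded T" and G: "G \<in> discrete_measures T" and U: "open U" and a: "a < measure G U"
  shows "\<exists>r>0. \<forall>G'\<in>discrete_measures T. W2 G G' < r \<longrightarrow> a < measure (measure_pmf G') U"
proof -
  \<comment> \<open>Points of \<open>U\<close> at depth at least 1/(n + 1). They exhaust
    \<open>U\<close> because \<open>U\<close> is open, so one depth already carries more than mass
    \<open>a\<close>.\<close>
  define V where "V n = {x. ball x (inverse (real (Suc n))) \<subseteq> U}" for n
  have "(\<Union>n. V n) = U"
  proof
    show "U \<subseteq> (\<Union>n. V n)"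
    proof
      fix x assume "x \<in> U"
      then obtain e where "e > 0" "ball x e \<subseteq> U"
        using U open_contains_ball by blast
      moreover from \<open>e > 0\<close> obtain n where "inverse (real (Suc n)) < e"
        using reals_Archimedean by blast
      ultimately have "x \<in> V n"
        using subset_ball[of "inverse (real (Suc n))" e x] by (auto simp: V_def)
      then show "x \<in> (\<Union>n. V n)" by blast
    qed
  qed (auto simp: V_def)
  moreover have "incseq V"
  proof (rule incseq_SucI, rule subsetI)
    fix n x assume "x \<in> V n"
    moreover have "ball x (inverse (real (Suc (Suc n)))) \<subseteq> ball x (inverse (real (Suc n)))"
      by (rule subset_ball) (simp add: field_simps)
    ultimately show "x \<in> V (Suc n)" by (auto simp: V_def)
  qed
  ultimately have "(\<lambda>n. measure G (V n)) \<longlonglongrightarrow> measure G U"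
    using measure_pmf.finite_Lim_measure_incseq[of V G] by simp
  then have "eventually (\<lambda>n. a < measure G (V n)) sequentially"
    using a by (rule order_tendstoD)
  then obtain n where n: "a < measure G (V n)"
    by (auto simp: eventually_sequentially)
  \<comment> \<open>\<open>\<eta>\<close> is the depth and \<open>s\<close> the spare mass. The
    radius \<open>\<eta> * sqrt s\<close> makes Markov's bound on the mass moved by at least
    \<open>\<eta>\<close> smaller than \<open>s\<close>.\<close>
  define \<eta> s where "\<eta> = inverse (real (Suc n))" and "s = measure G (V n) - a"
  have \<eta>: "\<eta> > 0" and s: "s > 0"
    using n by (auto simp: \<eta>_def s_def)
  show ?thesis
  proof (intro exI[of _ "\<eta> * sqrt s"] conjI ballI impI)
    show "0 < \<eta> * sqrt s" using \<eta> s by simp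
    fix G' assume G': "G' \<in> discrete_measures T" and "W2 G G' < \<eta> * sqrt s"
    then obtain q where q: "q \<in> couplings G G'" "coupling_cost q < (\<eta> * sqrt s)\<^sup>2"
      using W2_less_coupling by blast
    have int: "integrable (measure_pmf q) (\<lambda>z. (dist (fst z) (snd z))\<^sup>2)"
      by (rule integrable_pmf_dist_square[OF T]) (use set_pmf_coupling[OF q(1) G G'] in auto)
    have "measure q {z \<in> space (measure_pmf q). \<eta>\<^sup>2 \<le> (dist (fst z) (snd z))\<^sup>2}
        \<le> (\<integral>z. (dist (fst z) (snd z))\<^sup>2 \<partial>q) / \<eta>\<^sup>2"
      by (rule integral_Markov_inequality_measure[where A = "{}"]) (use int \<eta> in auto)
    also have "\<dots> < s"
      using q(2) \<eta> s by (simp add: case_prod_beta' field_simps)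
    finally have far: "measure q {z. \<eta>\<^sup>2 \<le> (dist (fst z) (snd z))\<^sup>2} < s"
      by simp
    have "{z. fst z \<in> V n} \<subseteq> {z. snd z \<in> U} \<union> {z. \<eta>\<^sup>2 \<le> (dist (fst z) (snd z))\<^sup>2}"
    proof
      fix z :: "'t \<times> 't" assume z: "z \<in> {z. fst z \<in> V n}"
      show "z \<in> {z. snd z \<in> U} \<union> {z. \<eta>\<^sup>2 \<le> (dist (fst z) (snd z))\<^sup>2}"
      proof (cases "dist (fst z) (snd z) < \<eta>")
        case True
        then show ?thesis using z by (auto simp: V_def \<eta>_def)
      next
        case False
        then show ?thesis using \<eta> by (auto intro!: power_mono)
      qed
    qed
    then have "measure q {z. fst z \<in> V n}
        \<le> measure q ({z. snd z \<in> U} \<union> {z. \<eta>\<^sup>2 \<le> (dist (fst z) (snd z))\<^sup>2})"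
      by (intro measure_pmf.finite_measure_mono) auto
    also have "\<dots> \<le> measure q {z. snd z \<in> U} + measure q {z. \<eta>\<^sup>2 \<le> (dist (fst z) (snd z))\<^sup>2}"
      by (rule measure_Un_le) auto
    finally show "a < measure (measure_pmf G') U"
      using far coupling_measure[OF q(1)] by (simp add: s_def)
  qed
qed

lemma borel_measurable_measure_open:
  fixes T :: "'t::metric_space set"
  assumes T: "bounded T" and U: "open U"
  shows "(\<lambda>G. measure (measure_pmf G) U) \<in> borel_measurable (W2_borel T)"
  unfolding borel_measurable_iff_greater space_W2_borel
proof
  fix a
  show "{G \<in> discrete_measures T. a < measure (measure_pmf G) U} \<in> sets (W2_borel T)"
  proof (rule W2_open_sets)
    fix G assume "G \<in> {G \<in> discrete_measures T. a < measure (measure_pmf G) U}"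
    then show "\<exists>r>0. \<forall>G'\<in>discrete_measures T. W2 G G' < r \<longrightarrow>
        G' \<in> {G \<in> discrete_measures T. a < measure (measure_pmf G) U}"
      using measure_open_lower_semicontinuous[OF T _ U, of G a] by auto
  qed auto
qed

text \<open>The support is countable, so the integral over \<open>p\<close> is a countable sum; this
  gives Tonelli's theorem for an arbitrary measure \<open>M\<close>, \<sigma>-finite or not.\<close>

lemma nn_integral_pmf_swap:
  fixes p :: "'i pmf" and h :: "'i \<Rightarrow> 'a \<Rightarrow> ennreal"
  assumes [measurable]: "\<And>i. i \<in> set_pmf p \<Longrightarrow> h i \<in> borel_measurable M"
  shows "(\<integral>\<^sup>+x. (\<integral>\<^sup>+i. h i x \<partial>measure_pmf p) \<partial>M) = (\<integral>\<^sup>+i. (\<integral>\<^sup>+x. h i x \<partial>M) \<partial>measure_pmf p)"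
proof -
  have *: "(\<integral>\<^sup>+i. k i \<partial>measure_pmf p) = (\<integral>\<^sup>+i. ennreal (pmf p i) * k i \<partial>count_space (set_pmf p))"
    for k :: "'i \<Rightarrow> ennreal"
    unfolding nn_integral_measure_pmf
    by (rule nn_integral_count_space_eq) (auto simp: set_pmf_iff)
  have "(\<integral>\<^sup>+x. (\<integral>\<^sup>+i. h i x \<partial>measure_pmf p) \<partial>M)
      = (\<integral>\<^sup>+i. (\<integral>\<^sup>+x. ennreal (pmf p i) * h i x \<partial>M) \<partial>count_space (set_pmf p))"
    unfolding * by (rule nn_integral_count_space_nn_integral) auto
  also have "\<dots> = (\<integral>\<^sup>+i. (\<integral>\<^sup>+x. h i x \<partial>M) \<partial>measure_pmf p)"
    unfolding * by (intro nn_integral_cong nn_integral_cmult) auto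
  finally show ?thesis .
qed

section \<open>Mixture densities\<close>

locale mixture_family =
  fixes T :: "'t::metric_space set" and \<mu> :: "'x measure" and f :: "'t \<Rightarrow> 'x \<Rightarrow> real"
  assumes bounded_T: "bounded T" and family: "density_family \<mu> T f"
begin

abbreviation p :: "'t pmf \<Rightarrow> 'x \<Rightarrow> real"
  where "p \<equiv> mixture_density f"

text \<open>Where the mixture series diverges, this version is infinite whereas the Bochner integral
  behind \<open>p\<close> falls back to 0. The two agree outside a \<mu>-null set, since
  \<open>pf G\<close> has integral 1.\<close>

abbreviation pf :: "'t pmf \<Rightarrow> 'x \<Rightarrow> ennreal"
  where "pf G x \<equiv> \<integral>\<^sup>+\<theta>. ennreal (f \<theta> x) \<partial>measure_pmf G"

lemma component_measurable_joint: "(\<lambda>(\<theta>, x). f \<theta> x) \<in> borel_measurable (restrict_space borel T \<Otimes>\<^sub>M \<mu>)"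
  and component_nonneg: "\<theta> \<in> T \<Longrightarrow> x \<in> space \<mu> \<Longrightarrow> 0 \<le> f \<theta> x"
  and component_integral: "\<theta> \<in> T \<Longrightarrow> (\<integral>\<^sup>+x. ennreal (f \<theta> x) \<partial>\<mu>) = 1"
  using family by (auto simp: density_family_def)

lemma component_measurable: "\<theta> \<in> T \<Longrightarrow> f \<theta> \<in> borel_measurable \<mu>"
  using measurable_compose[OF measurable_Pair1' component_measurable_joint, of \<theta>]
  by (simp add: space_restrict_space)

lemma set_pmf_in_T: "G \<in> discrete_measures T \<Longrightarrow> \<theta> \<in> set_pmf G \<Longrightarrow> \<theta> \<in> T"
  by (auto simp: discrete_measures_def)

lemma mixture_density_eq:
  assumes "G \<in> discrete_measures T" "x \<in> space \<mu>"
  shows "p G x = enn2real (pf G x)"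
  unfolding mixture_density_def
  by (rule integral_eq_nn_integral) (use assms in \<open>auto simp: AE_measure_pmf_iff set_pmf_in_T component_nonneg\<close>)

lemma mixture_density_nonneg: "G \<in> discrete_measures T \<Longrightarrow> x \<in> space \<mu> \<Longrightarrow> 0 \<le> p G x"
  by (simp add: mixture_density_eq)

lemma mixture_density_le: "G \<in> discrete_measures T \<Longrightarrow> x \<in> space \<mu> \<Longrightarrow> ennreal (p G x) \<le> pf G x"
  by (simp add: mixture_density_eq ennreal_enn2real_if)

text \<open>A pmf lives on the discrete \<sigma>-algebra of the whole type, whereas joint
  measurability of \<open>f\<close> refers to the Borel sets of \<open>T\<close>. The push-forward
  changes the space; the arbitrary value outside \<open>T\<close> concerns a null set only.\<close>

definition kernel :: "'t pmf \<Rightarrow> 't measure"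
  where "kernel G = distr (measure_pmf G) (restrict_space borel T)
    (\<lambda>\<theta>. if \<theta> \<in> T then \<theta> else (SOME t. t \<in> T))"

lemma discrete_measures_ne: "G \<in> discrete_measures T \<Longrightarrow> \<exists>t. t \<in> T"
  using set_pmf_not_empty[of G] by (auto simp: discrete_measures_def)

lemma retraction_measurable:
  assumes "G \<in> discrete_measures T"
  shows "(\<lambda>\<theta>. if \<theta> \<in> T then \<theta> else (SOME t. t \<in> T)) \<in> measurable (measure_pmf G) (restrict_space borel T)"
  using someI_ex[OF discrete_measures_ne[OF assms]]
  by (auto simp: measurable_def space_restrict_space)

lemma kernel_nn_integral:
  assumes G: "G \<in> discrete_measures T" and h: "h \<in> borel_measurable (restrict_space borel T)"
  shows "(\<integral>\<^sup>+\<theta>. h \<theta> \<partial>kernel G) = (\<integral>\<^sup>+\<theta>. h \<theta> \<partial>measure_pmf G)"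
  unfolding kernel_def
  by (subst nn_integral_distr[OF retraction_measurable[OF G]], simp add: h, rule nn_integral_cong_AE) (auto simp: AE_measure_pmf_iff set_pmf_in_T[OF G])

lemma kernel_open:
  assumes G: "G \<in> discrete_measures T" and U: "open U"
  shows "emeasure (kernel G) (T \<inter> U) = ennreal (measure (measure_pmf G) U)"
proof -
  have TU: "T \<inter> U \<in> sets (restrict_space borel T)"
    using U by (auto simp: sets_restrict_space)
  have "emeasure (kernel G) (T \<inter> U) = (\<integral>\<^sup>+\<theta>. indicator (T \<inter> U) \<theta> \<partial>kernel G)"
    using TU by (simp add: kernel_def)
  also have "\<dots> = (\<integral>\<^sup>+\<theta>. indicator (T \<inter> U) \<theta> \<partial>measure_pmf G)"
    by (rule kernel_nn_integral[OF G]) (use TU in simp)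
  also have "\<dots> = (\<integral>\<^sup>+\<theta>. indicator U \<theta> \<partial>measure_pmf G)"
    by (rule nn_integral_cong_AE) (auto simp: AE_measure_pmf_iff set_pmf_in_T[OF G] indicator_def)
  finally show ?thesis by (simp add: measure_pmf.emeasure_eq_measure)
qed

text \<open>Traces of open sets form an intersection-stable generator, and on them the mass is lower
  semicontinuous in the Wasserstein distance. This makes \<open>G\<close> itself a measurable
  parameter of the mixture.\<close>

lemma kernel_measurable_subprob: "kernel \<in> measurable (W2_borel T) (subprob_algebra (restrict_space borel T))"
proof (rule measurable_subprob_algebra_generated[where \<Omega> = T and G = "{T \<inter> U | U. open U}"])
  have "sets (restrict_space borel T) = {id -` A \<inter> T | A. A \<in> sigma_sets UNIV {S :: 't set. open S}}"
    by (auto simp: sets_restrict_space borel_def)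
  also have "\<dots> = sigma_sets T {id -` A \<inter> T | A. A \<in> {S. open S}}"
    by (rule sigma_sets_vimage_commute) auto
  also have "{id -` A \<inter> T | A. A \<in> {S. open S}} = {T \<inter> U | U. open U}"
    by auto
  finally show "sets (restrict_space borel T) = sigma_sets T {T \<inter> U | U. open U}" .
  show "Int_stable {T \<inter> U | U. open U}"
  proof (rule Int_stableI)
    fix A B assume "A \<in> {T \<inter> U | U. open U}" "B \<in> {T \<inter> U | U. open U}"
    then obtain U V where "open U" "open V" "A = T \<inter> U" "B = T \<inter> V" by blast
    then show "A \<inter> B \<in> {T \<inter> U | U. open U}"
      by (intro CollectI exI[of _ "U \<inter> V"]) auto
  qed
  show "{T \<inter> U | U. open U} \<subseteq> Pow T" by auto
  have meas: "(\<lambda>G. emeasure (kernel G) (T \<inter> U)) \<in> borel_measurable (W2_borel T)" if "open U" for U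
  proof -
    have [measurable]: "(\<lambda>G. measure (measure_pmf G) U) \<in> borel_measurable (W2_borel T)"
      by (rule borel_measurable_measure_open[OF bounded_T that])
    have "(\<lambda>G. ennreal (measure (measure_pmf G) U)) \<in> borel_measurable (W2_borel T)"
      by measurable
    then show ?thesis
      by (subst measurable_cong[where g = "\<lambda>G. ennreal (measure (measure_pmf G) U)"])
        (auto simp: space_W2_borel kernel_open that)
  qed
  show "(\<lambda>a. emeasure (kernel a) A) \<in> borel_measurable (W2_borel T)"
    if "A \<in> {T \<inter> U | U. open U}" for A
    using that meas by auto
  show "(\<lambda>a. emeasure (kernel a) T) \<in> borel_measurable (W2_borel T)"
    using meas[of UNIV] by simp
  fix G assume "G \<in> space (W2_borel T)"
  then show "subprob_space (kernel G)" "sets (kernel G) = sets (restrict_space borel T)"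
    unfolding kernel_def space_W2_borel
    by (auto intro!: prob_space_imp_subprob_space prob_space.prob_space_distr retraction_measurable
        measure_pmf.prob_space_axioms)
qed

text \<open>The mixture is the integral of a jointly measurable function against the measurable
  kernel \<open>kernel G\<close>. Joint measurability in \<open>(G, x)\<close> is what later permits
  exchanging prior and sample integrals.\<close>

lemma pf_measurable_joint:
  "(\<lambda>(G, x). pf G x) \<in> borel_measurable (W2_borel T \<Otimes>\<^sub>M \<mu>)"
proof -
  note [measurable] = component_measurable_joint kernel_measurable_subprob
  have "(\<lambda>z. \<integral>\<^sup>+\<theta>. ennreal (f \<theta> (snd z)) \<partial>kernel (fst z)) \<in> borel_measurable (W2_borel T \<Otimes>\<^sub>M \<mu>)"
  proof (rule nn_integral_measurable_subprob_algebra2[where N = "restrict_space borel T"])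
    have "(\<lambda>w. (case (snd w, snd (fst w)) of (\<theta>, x) \<Rightarrow> f \<theta> x))
        \<in> borel_measurable ((W2_borel T \<Otimes>\<^sub>M \<mu>) \<Otimes>\<^sub>M restrict_space borel T)"
      by (rule measurable_compose[OF _ component_measurable_joint]) measurable
    then show "(\<lambda>(z, \<theta>). ennreal (f \<theta> (snd z))) \<in> borel_measurable ((W2_borel T \<Otimes>\<^sub>M \<mu>) \<Otimes>\<^sub>M restrict_space borel T)"
      by (auto simp: case_prod_beta' intro!: measurable_compose[OF _ measurable_ennreal])
  qed measurable
  moreover have "(\<integral>\<^sup>+\<theta>. ennreal (f \<theta> (snd z)) \<partial>kernel (fst z)) = (case z of (G, x) \<Rightarrow> pf G x)"
    if "z \<in> space (W2_borel T \<Otimes>\<^sub>M \<mu>)" for z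
  proof -
    obtain G x where z: "z = (G, x)" "G \<in> discrete_measures T" "x \<in> space \<mu>"
      using \<open>z \<in> _\<close> by (auto simp: space_pair_measure space_W2_borel)
    have "(\<lambda>\<theta>. case (\<theta>, x) of (\<theta>, x) \<Rightarrow> f \<theta> x) \<in> borel_measurable (restrict_space borel T)"
      by (rule measurable_compose[OF measurable_Pair2'[OF z(3)] component_measurable_joint])
    then have "(\<lambda>\<theta>. ennreal (f \<theta> x)) \<in> borel_measurable (restrict_space borel T)"
      by simp
    from kernel_nn_integral[OF z(2) this] show ?thesis
      by (simp add: z(1))
  qed
  ultimately show ?thesis
    by (subst measurable_cong[where g = "\<lambda>z. \<integral>\<^sup>+\<theta>. ennreal (f \<theta> (snd z)) \<partial>kernel (fst z)"]) auto
qed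

lemma mixture_density_measurable_joint:
  "(\<lambda>(G, x). p G x) \<in> borel_measurable (W2_borel T \<Otimes>\<^sub>M \<mu>)"
proof -
  note [measurable] = pf_measurable_joint
  have "(\<lambda>z. enn2real (case z of (G, x) \<Rightarrow> pf G x)) \<in> borel_measurable (W2_borel T \<Otimes>\<^sub>M \<mu>)"
    by measurable
  then show ?thesis
    by (subst measurable_cong[where g = "\<lambda>z. enn2real (case z of (G, x) \<Rightarrow> pf G x)"])
      (auto simp: space_pair_measure space_W2_borel mixture_density_eq)
qed

lemma pf_measurable: "G \<in> discrete_measures T \<Longrightarrow> pf G \<in> borel_measurable \<mu>"
  using measurable_compose[OF measurable_Pair1' pf_measurable_joint, of G]
  by (simp add: space_W2_borel)

lemma mixture_density_measurable: "G \<in> discrete_measures T \<Longrightarrow> p G \<in> borel_measurable \<mu>"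
  using measurable_compose[OF measurable_Pair1' mixture_density_measurable_joint, of G]
  by (simp add: space_W2_borel)

lemma pf_integral:
  assumes G: "G \<in> discrete_measures T"
  shows "(\<integral>\<^sup>+x. pf G x \<partial>\<mu>) = 1"
proof -
  have "(\<integral>\<^sup>+x. pf G x \<partial>\<mu>) = (\<integral>\<^sup>+\<theta>. (\<integral>\<^sup>+x. ennreal (f \<theta> x) \<partial>\<mu>) \<partial>measure_pmf G)"
    by (rule nn_integral_pmf_swap) (use component_measurable set_pmf_in_T[OF G] in auto)
  also have "\<dots> = (\<integral>\<^sup>+\<theta>. 1 \<partial>measure_pmf G)"
    by (rule nn_integral_cong_AE) (auto simp: AE_measure_pmf_iff component_integral set_pmf_in_T[OF G])
  finally show ?thesis by (simp add: measure_pmf.emeasure_space_1)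
qed

lemma pf_finite:
  assumes G: "G \<in> discrete_measures T"
  shows "AE x in \<mu>. pf G x < \<infinity>"
  using nn_integral_PInf_AE[OF pf_measurable[OF G]] pf_integral[OF G] by (auto simp: less_top)

lemma mixture_density_integral_le:
  assumes G: "G \<in> discrete_measures T"
  shows "(\<integral>\<^sup>+x. ennreal (p G x) \<partial>\<mu>) \<le> 1"
  unfolding pf_integral[OF G, symmetric]
  by (rule nn_integral_mono) (rule mixture_density_le[OF G])

lemma mixture_density_integrable:
  assumes G: "G \<in> discrete_measures T"
  shows "integrable \<mu> (p G)"
proof (rule integrableI_nonneg)
  show "(\<integral>\<^sup>+x. ennreal (p G x) \<partial>\<mu>) < \<infinity>"
    using mixture_density_integral_le[OF G] by (simp add: order.strict_trans1 less_top)
qed (auto simp: mixture_density_nonneg mixture_density_measurable G intro!: AE_I2)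

section \<open>Hellinger distance between mixtures\<close>

abbreviation H :: "'t pmf \<Rightarrow> 't pmf \<Rightarrow> real"
  where "H G G' \<equiv> hellinger_sq \<mu> (p G) (p G')"

lemma sqrt_diff_square_le: "0 \<le> a \<Longrightarrow> 0 \<le> b \<Longrightarrow> (sqrt a - sqrt b)\<^sup>2 \<le> a + b"
  by (simp add: power2_diff)

lemma nn_integral_hellinger:
  assumes a: "integrable \<mu> a" and b: "integrable \<mu> b"
    and nonneg: "\<And>x. x \<in> space \<mu> \<Longrightarrow> 0 \<le> a x" "\<And>x. x \<in> space \<mu> \<Longrightarrow> 0 \<le> b x"
  shows "(\<integral>\<^sup>+x. ennreal ((sqrt (a x) - sqrt (b x))\<^sup>2) \<partial>\<mu>) = ennreal (2 * hellinger_sq \<mu> a b)"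
proof -
  have [measurable]: "a \<in> borel_measurable \<mu>" "b \<in> borel_measurable \<mu>"
    using a b by auto
  have "integrable \<mu> (\<lambda>x. (sqrt (a x) - sqrt (b x))\<^sup>2)"
    by (rule Bochner_Integration.integrable_bound[OF Bochner_Integration.integrable_add[OF a b]])
      (use nonneg sqrt_diff_square_le in \<open>auto intro!: AE_I2\<close>)
  then show ?thesis
    by (subst nn_integral_eq_integral) (auto simp: hellinger_sq_def)
qed

lemma nn_integral_H:
  assumes "G \<in> discrete_measures T" "G' \<in> discrete_measures T"
  shows "(\<integral>\<^sup>+x. ennreal ((sqrt (p G x) - sqrt (p G' x))\<^sup>2) \<partial>\<mu>) = ennreal (2 * H G G')"
  by (rule nn_integral_hellinger) (use assms mixture_density_integrable mixture_density_nonneg in auto)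

lemma component_integrable: "\<theta> \<in> T \<Longrightarrow> integrable \<mu> (f \<theta>)"
  by (rule integrableI_nonneg) (auto simp: component_measurable component_nonneg component_integral intro!: AE_I2)

lemma hellinger_sq_nonneg: "0 \<le> hellinger_sq \<mu> a b"
  unfolding hellinger_sq_def by (simp add: Bochner_Integration.integral_nonneg)

text \<open>By joint convexity of the squared Hellinger distance.\<close>

lemma hellinger_mixture_le_coupling:
  assumes G: "G \<in> discrete_measures T" and G': "G' \<in> discrete_measures T"
    and q: "q \<in> couplings G G'"
  shows "ennreal (2 * H G G')
    \<le> (\<integral>\<^sup>+z. ennreal (2 * hellinger_sq \<mu> (f (fst z)) (f (snd z))) \<partial>measure_pmf q)"
proof -
  have supp: "fst z \<in> T \<and> snd z \<in> T" if "z \<in> set_pmf q" for z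
    using set_pmf_coupling[OF q G G'] that by auto
  have G_eq: "G = map_pmf fst q" "G' = map_pmf snd q"
    using q by (auto simp: couplings_def)
  have pointwise: "ennreal ((sqrt (p G x) - sqrt (p G' x))\<^sup>2)
      \<le> (\<integral>\<^sup>+z. ennreal ((sqrt (f (fst z) x) - sqrt (f (snd z) x))\<^sup>2) \<partial>measure_pmf q)"
    if x: "x \<in> space \<mu>" and fin: "pf G x < \<infinity>" "pf G' x < \<infinity>" for x
  proof -
    \<comment> \<open>\<open>f \<theta>\<close> is nonnegative only for \<open>\<theta>\<close> in
      \<open>T\<close>; absolute values make the convexity inequality applicable off the support of
      \<open>q\<close> and change nothing on it.\<close>
    define a b where "a z = \<bar>f (fst z) x\<bar>" and "b z = \<bar>f (snd z) x\<bar>" for z :: "'t \<times> 't"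
    have ab: "AE z in measure_pmf q. a z = f (fst z) x \<and> b z = f (snd z) x"
      using component_nonneg[OF _ x] supp by (auto simp: AE_measure_pmf_iff a_def b_def)
    have "(\<integral>\<^sup>+z. ennreal (a z) \<partial>measure_pmf q) = pf G x"
      unfolding G_eq by (simp, rule nn_integral_cong_AE) (use ab in auto)
    moreover have "(\<integral>\<^sup>+z. ennreal (b z) \<partial>measure_pmf q) = pf G' x"
      unfolding G_eq by (simp, rule nn_integral_cong_AE) (use ab in auto)
    ultimately have int: "integrable (measure_pmf q) a" "integrable (measure_pmf q) b"
      using fin by (auto intro!: integrableI_nonneg simp: a_def b_def)
    have p: "p G x = (\<integral>z. a z \<partial>measure_pmf q)"
      unfolding mixture_density_def G_eq by (simp, rule integral_cong_AE) (use ab in auto)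
    have p': "p G' x = (\<integral>z. b z \<partial>measure_pmf q)"
      unfolding mixture_density_def G_eq by (simp, rule integral_cong_AE) (use ab in auto)
    have "ennreal ((sqrt (p G x) - sqrt (p G' x))\<^sup>2)
        \<le> ennreal (\<integral>z. (sqrt (a z) - sqrt (b z))\<^sup>2 \<partial>measure_pmf q)"
      unfolding p p' by (intro ennreal_leI sqrt_diff_integral_le int) (auto simp: a_def b_def)
    also have "\<dots> = (\<integral>\<^sup>+z. ennreal ((sqrt (a z) - sqrt (b z))\<^sup>2) \<partial>measure_pmf q)"
      by (rule nn_integral_eq_integral[symmetric], rule integrable_sqrt_diff[OF int])
        (auto simp: a_def b_def)
    also have "\<dots> = (\<integral>\<^sup>+z. ennreal ((sqrt (f (fst z) x) - sqrt (f (snd z) x))\<^sup>2) \<partial>measure_pmf q)"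
      by (rule nn_integral_cong_AE) (use ab in auto)
    finally show ?thesis .
  qed
  have "ennreal (2 * H G G') = (\<integral>\<^sup>+x. ennreal ((sqrt (p G x) - sqrt (p G' x))\<^sup>2) \<partial>\<mu>)"
    by (rule nn_integral_H[OF G G', symmetric])
  also have "\<dots> \<le> (\<integral>\<^sup>+x. (\<integral>\<^sup>+z. ennreal ((sqrt (f (fst z) x) - sqrt (f (snd z) x))\<^sup>2) \<partial>measure_pmf q) \<partial>\<mu>)"
    by (rule nn_integral_mono_AE) (use pf_finite[OF G] pf_finite[OF G'] pointwise in auto)
  also have "\<dots> = (\<integral>\<^sup>+z. (\<integral>\<^sup>+x. ennreal ((sqrt (f (fst z) x) - sqrt (f (snd z) x))\<^sup>2) \<partial>\<mu>) \<partial>measure_pmf q)"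
  proof (rule nn_integral_pmf_swap)
    fix z assume "z \<in> set_pmf q"
    then have [measurable]: "f (fst z) \<in> borel_measurable \<mu>" "f (snd z) \<in> borel_measurable \<mu>"
      using supp component_measurable by auto
    show "(\<lambda>x. ennreal ((sqrt (f (fst z) x) - sqrt (f (snd z) x))\<^sup>2)) \<in> borel_measurable \<mu>"
      by measurable
  qed
  also have "\<dots> = (\<integral>\<^sup>+z. ennreal (2 * hellinger_sq \<mu> (f (fst z)) (f (snd z))) \<partial>measure_pmf q)"
    by (rule nn_integral_cong_AE)
      (auto simp: AE_measure_pmf_iff dest!: supp intro!: nn_integral_hellinger component_nonneg component_integrable)
  finally show ?thesis .
qed

text \<open>Since \<alpha> is at least 1, the surplus power of the distance, of order 2(\<alpha> -
  1), is bounded by the same power of the diameter. A quadratic transport cost remains, and the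
  infimum over couplings yields the squared Wasserstein distance.\<close>

lemma hellinger_mixture_le_W2:
  assumes G: "G \<in> discrete_measures T" and G': "G' \<in> discrete_measures T"
    and D: "diameter T > 0" and C: "C > 0" and \<alpha>: "\<alpha> \<ge> 1"
    and hellinger: "\<And>\<theta> \<theta>'. \<theta> \<in> T \<Longrightarrow> \<theta>' \<in> T \<Longrightarrow>
      hellinger_sq \<mu> (f \<theta>) (f \<theta>') \<le> C * dist \<theta> \<theta>' powr (2 * \<alpha>)"
  shows "H G G' \<le> C * (diameter T powr (\<alpha> - 1))\<^sup>2 * (W2 G G')\<^sup>2"
proof -
  define K where "K = C * (diameter T powr (\<alpha> - 1))\<^sup>2"
  have K: "K > 0" using C D by (simp add: K_def)
  have kernels: "hellinger_sq \<mu> (f \<theta>) (f \<theta>') \<le> K * (dist \<theta> \<theta>')\<^sup>2" if "\<theta> \<in> T" "\<theta>' \<in> T" for \<theta> \<theta>'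
  proof (cases "dist \<theta> \<theta>' = 0")
    case True
    then show ?thesis using hellinger[OF that] by simp
  next
    case False
    then have d: "dist \<theta> \<theta>' > 0" by simp
    have "dist \<theta> \<theta>' powr (2 * \<alpha>) = dist \<theta> \<theta>' powr (2 * (\<alpha> - 1)) * dist \<theta> \<theta>' powr 2"
      by (subst powr_add[symmetric]) (simp add: algebra_simps)
    also have "dist \<theta> \<theta>' powr 2 = (dist \<theta> \<theta>')\<^sup>2"
      using d by (simp add: powr_numeral)
    also have "dist \<theta> \<theta>' powr (2 * (\<alpha> - 1)) \<le> diameter T powr (2 * (\<alpha> - 1))"
      using \<alpha> d diameter_bounded_bound[OF bounded_T that] by (intro powr_mono2) auto
    also have "diameter T powr (2 * (\<alpha> - 1)) = (diameter T powr (\<alpha> - 1))\<^sup>2"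
      by (simp add: power2_eq_square powr_add[symmetric] algebra_simps)
    finally have "dist \<theta> \<theta>' powr (2 * \<alpha>) \<le> (diameter T powr (\<alpha> - 1))\<^sup>2 * (dist \<theta> \<theta>')\<^sup>2"
      by (simp add: mult_right_mono)
    then have "C * dist \<theta> \<theta>' powr (2 * \<alpha>) \<le> C * ((diameter T powr (\<alpha> - 1))\<^sup>2 * (dist \<theta> \<theta>')\<^sup>2)"
      using C by (intro mult_left_mono) auto
    then show ?thesis
      using hellinger[OF that] by (simp add: K_def mult.assoc)
  qed
  have "H G G' / K \<le> coupling_cost q" if q: "q \<in> couplings G G'" for q
  proof -
    have supp: "fst z \<in> T \<and> snd z \<in> T" if "z \<in> set_pmf q" for z
      using set_pmf_coupling[OF q G G'] that by auto
    have int: "integrable (measure_pmf q) (\<lambda>z. (dist (fst z) (snd z))\<^sup>2)"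
      by (rule integrable_pmf_dist_square[OF bounded_T]) (use supp in auto)
    have "ennreal (2 * H G G')
        \<le> (\<integral>\<^sup>+z. ennreal (2 * hellinger_sq \<mu> (f (fst z)) (f (snd z))) \<partial>measure_pmf q)"
      by (rule hellinger_mixture_le_coupling[OF G G' q])
    also have "\<dots> \<le> (\<integral>\<^sup>+z. ennreal (2 * K * (dist (fst z) (snd z))\<^sup>2) \<partial>measure_pmf q)"
      by (rule nn_integral_mono_AE)
        (use kernels supp in \<open>auto simp: AE_measure_pmf_iff mult.assoc intro!: ennreal_leI\<close>)
    also have "\<dots> = ennreal (\<integral>z. 2 * K * (dist (fst z) (snd z))\<^sup>2 \<partial>measure_pmf q)"
      by (rule nn_integral_eq_integral) (use int K in auto)
    also have "\<dots> = ennreal (2 * K * coupling_cost q)"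
      by (simp add: case_prod_beta')
    finally have "2 * H G G' \<le> 2 * K * coupling_cost q"
      using K coupling_cost_nonneg[of q] by (subst (asm) ennreal_le_iff) auto
    then show ?thesis using K by (simp add: field_simps)
  qed
  then have "H G G' / K \<le> (W2 G G')\<^sup>2"
    unfolding W2_square by (intro cINF_greatest couplings_nonempty)
  then show ?thesis using K by (simp add: field_simps K_def)
qed

end

section \<open>Square roots of likelihood averages\<close>

text \<open>Likelihood averages may be infinite, so the square root is extended to
  \<open>ennreal\<close>. With \<open>esqrt \<top> = \<top>\<close> it stays monotone and
  multiplicative, including for products of 0 and infinity.\<close>

definition esqrt :: "ennreal \<Rightarrow> ennreal"
  where "esqrt x = (if x = \<infinity> then \<infinity> else ennreal (sqrt (enn2real x)))"

lemma esqrt_measurable [measurable]: "esqrt \<in> borel_measurable borel"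
  unfolding esqrt_def by measurable

lemma esqrt_ennreal: "0 \<le> x \<Longrightarrow> esqrt (ennreal x) = ennreal (sqrt x)"
  by (simp add: esqrt_def)

lemma esqrt_0 [simp]: "esqrt 0 = 0"
  by (simp add: esqrt_def)

lemma esqrt_top [simp]: "esqrt \<top> = \<top>"
  by (simp add: esqrt_def)

lemma esqrt_mult: "esqrt (x * y) = esqrt x * esqrt y"
  by (cases x; cases y)
    (auto simp: esqrt_ennreal ennreal_mult[symmetric] real_sqrt_mult ennreal_top_mult ennreal_mult_top
      split: if_splits)

lemma esqrt_mono: "x \<le> y \<Longrightarrow> esqrt x \<le> esqrt y"
  by (cases x; cases y) (auto simp: esqrt_ennreal top_unique)

lemma esqrt_self_le: "x \<le> 1 \<Longrightarrow> x \<le> esqrt x"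
proof (cases x)
  case (real r)
  assume "x \<le> 1"
  then have "r \<le> sqrt r"
    using real by (intro real_le_rsqrt) (auto simp: power2_eq_square mult_left_le)
  then show ?thesis using real by (simp add: esqrt_ennreal)
qed auto

text \<open>Markov's inequality gives each set where \<open>g\<close> is at least 1/(n + 1) finite
  measure, and these sets exhaust the positivity set of \<open>g\<close>; its complement is null for
  the restricted measure.\<close>

lemma sigma_finite_density_positive:
  assumes [measurable]: "g \<in> borel_measurable M" and fin: "(\<integral>\<^sup>+x. g x \<partial>M) < \<infinity>"
  shows "sigma_finite_measure (density M (indicator {x \<in> space M. 0 < g x}))" (is "sigma_finite_measure ?N")
proof
  let ?S = "{x \<in> space M. 0 < g x}"
  define A where "A n = {x \<in> space M. 1 \<le> of_nat (Suc n) * g x}" for n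
  have [measurable]: "A n \<in> sets M" for n unfolding A_def by measurable
  have "emeasure M (A n) < \<infinity>" for n
  proof -
    have "emeasure M (A n) \<le> of_nat (Suc n) * (\<integral>\<^sup>+x. g x * indicator (space M) x \<partial>M)"
      unfolding A_def by (rule nn_integral_Markov_inequality) auto
    also have "\<dots> = of_nat (Suc n) * (\<integral>\<^sup>+x. g x \<partial>M)"
      by (intro arg_cong2[where f = "(*)"] refl nn_integral_cong) auto
    also have "\<dots> < \<infinity>"
      using fin by (simp add: ennreal_mult_less_top of_nat_less_top)
    finally show ?thesis .
  qed
  then have A_fin: "emeasure ?N (A n) \<noteq> \<infinity>" for n
    using emeasure_mono[of "?S \<inter> A n" "A n" M]
    by (subst emeasure_density) (auto simp: nn_integral_indicator[symmetric] indicator_inter_arith[symmetric] top_unique less_top[symmetric]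
      simp del: nn_integral_indicator dest!: le_less_trans)
  have zero: "emeasure ?N (space M - ?S) = 0"
    by (subst emeasure_density) (auto simp: nn_integral_0_iff_AE indicator_def)
  have cover: "space M \<subseteq> (\<Union>n. A n) \<union> (space M - ?S)"
  proof
    fix x assume x: "x \<in> space M"
    show "x \<in> (\<Union>n. A n) \<union> (space M - ?S)"
    proof (cases "g x")
      case top
      then have "x \<in> A 0" using x by (simp add: A_def)
      then show ?thesis by blast
    next
      case (real r)
      show ?thesis
      proof (cases "r = 0")
        case False
        with real obtain n where n: "inverse (real (Suc n)) < r"
          using reals_Archimedean[of r] by auto
        then have "1 \<le> real (Suc n) * r" by (simp add: field_simps)
        then have "1 \<le> of_nat (Suc n) * ennreal r"
          unfolding ennreal_of_nat_eq_real_of_nat by (subst ennreal_mult[symmetric]) (use real in auto)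
        then have "x \<in> A n" using x real by (simp add: A_def)
        then show ?thesis by blast
      qed (use x real in auto)
    qed
  qed
  show "\<exists>B. countable B \<and> B \<subseteq> sets ?N \<and> \<Union>B = space ?N \<and> (\<forall>a\<in>B. emeasure ?N a \<noteq> \<infinity>)"
  proof (intro exI[of _ "insert (space M - ?S) (range A)"] conjI)
    have "A n \<subseteq> space M" for n by (auto simp: A_def)
    then show "\<Union>(insert (space M - ?S) (range A)) = space ?N"
      using cover by auto
  qed (use A_fin zero in auto)
qed

section \<open>Affinity of predictive densities and its product form\<close>

locale mixture_bayes = mixture_family T \<mu> f + prior: prob_space prior
  for T :: "'t::metric_space set" and \<mu> :: "'x measure" and f and prior :: "'t pmf measure" +
  fixes G\<^sub>0 :: "'t pmf"
  assumes sets_prior: "sets prior = sets (W2_borel T)" and G0: "G\<^sub>0 \<in> discrete_measures T"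
begin

abbreviation P\<^sub>0 :: "'x measure"
  where "P\<^sub>0 \<equiv> mixture_measure \<mu> f G\<^sub>0"

text \<open>Takes the junk value 0 on the \<open>P\<^sub>0\<close>-null set where \<open>p\<^bsub>G\<^sub>0\<^esub>\<close> vanishes.\<close>

definition r :: "'t pmf \<Rightarrow> 'x \<Rightarrow> ennreal"
  where "r G x = ennreal (p G x / p G\<^sub>0 x)"

lemma space_prior: "space prior = discrete_measures T"
  using sets_eq_imp_space_eq[OF sets_prior] by (simp add: space_W2_borel)

lemma sets_P0 [measurable_cong]: "sets P\<^sub>0 = sets \<mu>"
  by (simp add: mixture_measure_def)

lemma space_P0: "space P\<^sub>0 = space \<mu>"
  by (simp add: mixture_measure_def)

lemma p0_measurable [measurable]: "p G\<^sub>0 \<in> borel_measurable \<mu>"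
  by (rule mixture_density_measurable[OF G0])

lemma density_measurable_pair:
  assumes "sets N = sets (W2_borel T)"
  shows "(\<lambda>(G, x). p G x) \<in> borel_measurable (N \<Otimes>\<^sub>M \<mu>)"
  using mixture_density_measurable_joint
  by (simp cong: measurable_cong_sets add: sets_pair_measure_cong[OF assms refl])

lemma r_measurable_pair:
  assumes "sets N = sets (W2_borel T)"
  shows "(\<lambda>(G, x). r G x) \<in> borel_measurable (N \<Otimes>\<^sub>M \<mu>)"
proof -
  note [measurable] = density_measurable_pair[OF assms]
  have "(\<lambda>z. ennreal ((case z of (G, x) \<Rightarrow> p G x) / p G\<^sub>0 (snd z))) \<in> borel_measurable (N \<Otimes>\<^sub>M \<mu>)"
    by measurable
  then show ?thesis by (simp add: r_def case_prod_beta')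
qed

lemma r_measurable: "G \<in> discrete_measures T \<Longrightarrow> r G \<in> borel_measurable \<mu>"
  unfolding r_def using mixture_density_measurable[of G] by measurable

lemma nn_integral_P0:
  "h \<in> borel_measurable \<mu> \<Longrightarrow> (\<integral>\<^sup>+x. h x \<partial>P\<^sub>0) = (\<integral>\<^sup>+x. ennreal (p G\<^sub>0 x) * h x \<partial>\<mu>)"
  unfolding mixture_measure_def by (rule nn_integral_density) auto

text \<open>Total mass exactly 1 makes \<open>P\<^sub>0\<close> a probability measure; the fallback
  value 0 of \<open>p G\<^sub>0\<close> occurs only on a null set.\<close>

lemma p0_integral: "(\<integral>\<^sup>+x. ennreal (p G\<^sub>0 x) \<partial>\<mu>) = 1"
proof -
  have "(\<integral>\<^sup>+x. ennreal (p G\<^sub>0 x) \<partial>\<mu>) = (\<integral>\<^sup>+x. pf G\<^sub>0 x \<partial>\<mu>)"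
  proof (rule nn_integral_cong_AE)
    show "AE x in \<mu>. ennreal (p G\<^sub>0 x) = pf G\<^sub>0 x"
      using pf_finite[OF G0] AE_space
      by eventually_elim (simp add: mixture_density_eq[OF G0])
  qed
  then show ?thesis by (simp add: pf_integral[OF G0])
qed

sublocale P0: prob_space P\<^sub>0
  by standard (simp add: mixture_measure_def emeasure_density p0_integral cong: nn_integral_cong)

lemma p0_positive: "AE x in P\<^sub>0. 0 < p G\<^sub>0 x"
  unfolding mixture_measure_def by (subst AE_density) (auto simp: ennreal_neg)

text \<open>Only an inequality: mass of \<open>p G\<close> sitting where \<open>p G\<^sub>0\<close>
  vanishes is lost.\<close>

lemma r_integral_le:
  assumes G: "G \<in> discrete_measures T"
  shows "(\<integral>\<^sup>+x. r G x \<partial>P\<^sub>0) \<le> 1"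
proof -
  have "(\<integral>\<^sup>+x. r G x \<partial>P\<^sub>0) = (\<integral>\<^sup>+x. ennreal (p G\<^sub>0 x) * r G x \<partial>\<mu>)"
    by (rule nn_integral_P0[OF r_measurable[OF G]])
  also have "\<dots> \<le> (\<integral>\<^sup>+x. ennreal (p G x) \<partial>\<mu>)"
    by (rule nn_integral_mono)
      (use mixture_density_nonneg[OF G0] mixture_density_nonneg[OF G] in
        \<open>auto simp: r_def ennreal_mult'[symmetric] intro!: ennreal_leI\<close>)
  also have "\<dots> \<le> 1" by (rule mixture_density_integral_le[OF G])
  finally show ?thesis .
qed

text \<open>
  The predictive density of a prior \<open>\<nu>\<close> carried by a Hellinger ball stays in that ball, by convexity;
  hence it is bounded away from \<open>p\<^bsub>G\<^sub>0\<^esub>\<close>. The pointwise form of this argument below uses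
  \<open>(a - c)\<^sup>2 / 2 \<le> (a - b)\<^sup>2 + (b - c)\<^sup>2\<close>. Restricting \<open>\<mu>\<close> to the set where one of the two reference
  densities is positive makes it \<open>\<sigma>\<close>-finite, as needed for Tonelli's theorem.
\<close>

lemma predictive_affinity:
  assumes \<nu>: "prob_space \<nu>" and sets_\<nu>: "sets \<nu> = sets (W2_borel T)" and G2: "G\<^sub>2 \<in> discrete_measures T"
    and near: "AE G in \<nu>. H G G\<^sub>2 \<le> H G\<^sub>0 G\<^sub>2 / 4"
  shows "(\<integral>\<^sup>+x. esqrt (\<integral>\<^sup>+G. r G x \<partial>\<nu>) \<partial>P\<^sub>0) \<le> ennreal (1 - H G\<^sub>0 G\<^sub>2 / 4)"
proof -
  interpret \<nu>: prob_space \<nu> by fact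
  have space_\<nu>: "space \<nu> = discrete_measures T"
    using sets_eq_imp_space_eq[OF sets_\<nu>] by (simp add: space_W2_borel)
  note [measurable] = density_measurable_pair[OF sets_\<nu>] r_measurable_pair[OF sets_\<nu>]
    mixture_density_measurable[OF G2]
  define S where "S = {x \<in> space \<mu>. 0 < ennreal (p G\<^sub>0 x) + ennreal (p G\<^sub>2 x)}"
  have [measurable]: "S \<in> sets \<mu>" unfolding S_def by measurable
  define \<mu>S where "\<mu>S = density \<mu> (indicator S)"
  have sets_\<mu>S [measurable_cong]: "sets \<mu>S = sets \<mu>" and space_\<mu>S: "space \<mu>S = space \<mu>"
    by (auto simp: \<mu>S_def)
  have "(\<integral>\<^sup>+x. ennreal (p G\<^sub>0 x) + ennreal (p G\<^sub>2 x) \<partial>\<mu>) < \<infinity>"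
    using mixture_density_integral_le[OF G0] mixture_density_integral_le[OF G2]
    by (subst nn_integral_add) (auto simp: less_top[symmetric] top_unique)
  then interpret \<mu>S: sigma_finite_measure \<mu>S
    unfolding \<mu>S_def S_def by (intro sigma_finite_density_positive) measurable
  interpret pair: pair_sigma_finite \<mu>S \<nu> ..
  have int_S: "(\<integral>\<^sup>+x. h x \<partial>\<mu>S) \<le> (\<integral>\<^sup>+x. h x \<partial>\<mu>)" if [measurable]: "h \<in> borel_measurable \<mu>" for h
    unfolding \<mu>S_def by (subst nn_integral_density) (auto intro!: nn_integral_mono simp: indicator_def)
  have int_S_eq: "(\<integral>\<^sup>+x. h x \<partial>\<mu>S) = (\<integral>\<^sup>+x. h x \<partial>\<mu>)"
    if [measurable]: "h \<in> borel_measurable \<mu>" and "\<And>x. x \<in> space \<mu> \<Longrightarrow> x \<notin> S \<Longrightarrow> h x = 0" for h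
    unfolding \<mu>S_def by (subst nn_integral_density) (auto intro!: nn_integral_cong simp: indicator_def that(2))
  have nonneg: "0 \<le> p G\<^sub>0 x" "0 \<le> p G\<^sub>2 x" "G \<in> space \<nu> \<Longrightarrow> 0 \<le> p G x" if "x \<in> space \<mu>" for x G
    using that mixture_density_nonneg G0 G2 space_\<nu> by auto
  have off_S: "p G\<^sub>0 x = 0" "p G\<^sub>2 x = 0" if "x \<in> space \<mu>" "x \<notin> S" for x
    using that nonneg[of x] by (auto simp: S_def ennreal_eq_0_iff)
  define pb where "pb x = (\<integral>\<^sup>+G. ennreal (p G x) \<partial>\<nu>)" for x
  define D where "D x = (\<integral>\<^sup>+G. ennreal ((sqrt (p G x) - sqrt (p G\<^sub>2 x))\<^sup>2) \<partial>\<nu>)" for x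
  have meas_pairs [measurable]:
    "(\<lambda>(x, G). p G x) \<in> borel_measurable (\<mu> \<Otimes>\<^sub>M \<nu>)" "(\<lambda>(x, G). r G x) \<in> borel_measurable (\<mu> \<Otimes>\<^sub>M \<nu>)"
    using measurable_pair_swap[OF density_measurable_pair[OF sets_\<nu>]]
      measurable_pair_swap[OF r_measurable_pair[OF sets_\<nu>]] by simp_all
  have [measurable]: "pb \<in> borel_measurable \<mu>"
    unfolding pb_def by measurable
  have D_pair: "(\<lambda>(x, G). ennreal ((sqrt (p G x) - sqrt (p G\<^sub>2 x))\<^sup>2)) \<in> borel_measurable (\<mu> \<Otimes>\<^sub>M \<nu>)"
  proof -
    have "(\<lambda>z. ennreal ((sqrt (case z of (x, G) \<Rightarrow> p G x) - sqrt (p G\<^sub>2 (fst z)))\<^sup>2)) \<in> borel_measurable (\<mu> \<Otimes>\<^sub>M \<nu>)"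
      by measurable
    then show ?thesis by (simp add: case_prod_beta')
  qed
  have [measurable]: "D \<in> borel_measurable \<mu>"
    unfolding D_def using D_pair by measurable
  \<comment> \<open>All terms are kept on the side where they are positive, because
    \<open>ennreal\<close> has no useful subtraction. If the predictive density \<open>pb x\<close>
    is infinite, so is the right-hand side.\<close>
  have pointwise: "2 * (esqrt (pb x) * ennreal (sqrt (p G\<^sub>0 x))) + ennreal ((sqrt (p G\<^sub>0 x) - sqrt (p G\<^sub>2 x))\<^sup>2 / 2)
      \<le> pb x + ennreal (p G\<^sub>0 x) + D x" if x: "x \<in> space \<mu>" for x
  proof (cases "pb x = \<infinity>")
    case False
    have [measurable]: "(\<lambda>G. p G x) \<in> borel_measurable \<nu>"
      using measurable_compose[OF measurable_Pair2'[OF x] density_measurable_pair[OF sets_\<nu>]] by simp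
    have int: "integrable \<nu> (\<lambda>G. p G x)"
      using False nonneg(3)[OF x] by (intro integrableI_nonneg) (auto simp: pb_def less_top intro!: AE_I2)
    define b where "b = (\<integral>G. p G x \<partial>\<nu>)"
    have b: "pb x = ennreal b" "0 \<le> b"
      using nonneg(3)[OF x] int
      by (auto simp: pb_def b_def nn_integral_eq_integral intro!: integral_nonneg_AE AE_I2)
    \<comment> \<open>The constant \<open>p G\<^sub>2 x\<close> is rewritten as its own
      \<nu>-average, so that convexity compares two averages.\<close>
    have "(sqrt b - sqrt (p G\<^sub>2 x))\<^sup>2 = (sqrt b - sqrt (\<integral>G. p G\<^sub>2 x \<partial>\<nu>))\<^sup>2"
      by (simp add: \<nu>.prob_space)
    also have "\<dots> \<le> (\<integral>G. (sqrt (p G x) - sqrt (p G\<^sub>2 x))\<^sup>2 \<partial>\<nu>)"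
      unfolding b_def by (rule sqrt_diff_integral_le[OF int]) (use nonneg x in auto)
    finally have "ennreal ((sqrt b - sqrt (p G\<^sub>2 x))\<^sup>2) \<le> ennreal (\<integral>G. (sqrt (p G x) - sqrt (p G\<^sub>2 x))\<^sup>2 \<partial>\<nu>)"
      by (rule ennreal_leI)
    also have "\<dots> = D x"
      unfolding D_def
      by (rule nn_integral_eq_integral[symmetric], rule integrable_sqrt_diff[OF int]) (use nonneg x in auto)
    finally have D: "ennreal ((sqrt b - sqrt (p G\<^sub>2 x))\<^sup>2) \<le> D x" .
    define u v where "u = sqrt (p G\<^sub>0 x) - sqrt b" and "v = sqrt b - sqrt (p G\<^sub>2 x)"
    have "0 \<le> (u - v)\<^sup>2" by simp
    then have "(u + v)\<^sup>2 / 2 \<le> u\<^sup>2 + v\<^sup>2"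
      by (simp add: power2_sum power2_diff)
    then have "(sqrt (p G\<^sub>0 x) - sqrt (p G\<^sub>2 x))\<^sup>2 / 2 \<le> (sqrt (p G\<^sub>0 x) - sqrt b)\<^sup>2 + (sqrt b - sqrt (p G\<^sub>2 x))\<^sup>2"
      by (simp add: u_def v_def)
    also have "(sqrt (p G\<^sub>0 x) - sqrt b)\<^sup>2 = p G\<^sub>0 x + b - 2 * (sqrt b * sqrt (p G\<^sub>0 x))"
      using b nonneg(1)[OF x] by (simp add: power2_diff)
    finally have "2 * (sqrt b * sqrt (p G\<^sub>0 x)) + (sqrt (p G\<^sub>0 x) - sqrt (p G\<^sub>2 x))\<^sup>2 / 2
        \<le> b + p G\<^sub>0 x + (sqrt b - sqrt (p G\<^sub>2 x))\<^sup>2"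
      by simp
    then have "ennreal (2 * (sqrt b * sqrt (p G\<^sub>0 x)) + (sqrt (p G\<^sub>0 x) - sqrt (p G\<^sub>2 x))\<^sup>2 / 2)
        \<le> ennreal (b + p G\<^sub>0 x + (sqrt b - sqrt (p G\<^sub>2 x))\<^sup>2)"
      by (rule ennreal_leI)
    also have "\<dots> = ennreal b + ennreal (p G\<^sub>0 x) + ennreal ((sqrt b - sqrt (p G\<^sub>2 x))\<^sup>2)"
      using b nonneg(1)[OF x] by simp
    also have "\<dots> \<le> ennreal b + ennreal (p G\<^sub>0 x) + D x"
      using D by (rule add_left_mono)
    also have "ennreal (2 * (sqrt b * sqrt (p G\<^sub>0 x)) + (sqrt (p G\<^sub>0 x) - sqrt (p G\<^sub>2 x))\<^sup>2 / 2)
        = 2 * (esqrt (pb x) * ennreal (sqrt (p G\<^sub>0 x))) + ennreal ((sqrt (p G\<^sub>0 x) - sqrt (p G\<^sub>2 x))\<^sup>2 / 2)"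
      using b nonneg(1)[OF x] by (simp add: esqrt_ennreal ennreal_mult)
    finally show ?thesis by (simp add: b)
  qed simp
  define A where "A = (\<integral>\<^sup>+x. esqrt (pb x) * ennreal (sqrt (p G\<^sub>0 x)) \<partial>\<mu>S)"
  have "2 * A + ennreal (H G\<^sub>0 G\<^sub>2)
      = (\<integral>\<^sup>+x. 2 * (esqrt (pb x) * ennreal (sqrt (p G\<^sub>0 x))) + ennreal ((sqrt (p G\<^sub>0 x) - sqrt (p G\<^sub>2 x))\<^sup>2 / 2) \<partial>\<mu>S)"
  proof -
    have "(\<integral>\<^sup>+x. ennreal ((sqrt (p G\<^sub>0 x) - sqrt (p G\<^sub>2 x))\<^sup>2 / 2) \<partial>\<mu>S)
        = (\<integral>\<^sup>+x. ennreal ((sqrt (p G\<^sub>0 x) - sqrt (p G\<^sub>2 x))\<^sup>2 / 2) \<partial>\<mu>)"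
      by (rule int_S_eq) (auto simp: off_S)
    also have "\<dots> = (\<integral>\<^sup>+x. ennreal (1/2) * ennreal ((sqrt (p G\<^sub>0 x) - sqrt (p G\<^sub>2 x))\<^sup>2) \<partial>\<mu>)"
      by (rule nn_integral_cong, subst ennreal_mult[symmetric]) auto
    also have "\<dots> = ennreal (1/2) * ennreal (2 * H G\<^sub>0 G\<^sub>2)"
      by (subst nn_integral_cmult) (auto simp: nn_integral_H G0 G2)
    also have "\<dots> = ennreal (H G\<^sub>0 G\<^sub>2)"
      by (subst ennreal_mult[symmetric]) (auto simp: hellinger_sq_nonneg)
    finally show ?thesis
      by (subst nn_integral_add) (auto simp: A_def nn_integral_cmult)
  qed
  also have "\<dots> \<le> (\<integral>\<^sup>+x. pb x + ennreal (p G\<^sub>0 x) + D x \<partial>\<mu>S)"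
    by (rule nn_integral_mono) (use pointwise space_\<mu>S in auto)
  also have "\<dots> = (\<integral>\<^sup>+x. pb x \<partial>\<mu>S) + (\<integral>\<^sup>+x. ennreal (p G\<^sub>0 x) \<partial>\<mu>S) + (\<integral>\<^sup>+x. D x \<partial>\<mu>S)"
    by (subst nn_integral_add; (subst nn_integral_add)?) auto
  \<comment> \<open>The first two integrals are masses of subdensities. The third is at most twice
    the squared Hellinger radius, and that radius is a quarter of
    \<open>H G\<^sub>0 G\<^sub>2\<close>. Solving for \<open>A\<close> then leaves
    \<open>1 - H G\<^sub>0 G\<^sub>2 / 4\<close>.\<close>
  also have "\<dots> \<le> 1 + 1 + ennreal (H G\<^sub>0 G\<^sub>2 / 2)"
  proof (intro add_mono)
    have "(\<integral>\<^sup>+x. pb x \<partial>\<mu>S) = (\<integral>\<^sup>+G. (\<integral>\<^sup>+x. ennreal (p G x) \<partial>\<mu>S) \<partial>\<nu>)"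
      unfolding pb_def by (rule pair.Fubini'[symmetric]) measurable
    also have "\<dots> \<le> (\<integral>\<^sup>+G. 1 \<partial>\<nu>)"
      using mixture_density_measurable mixture_density_integral_le
      by (intro nn_integral_mono order.trans[OF int_S]) (auto simp: space_\<nu>)
    finally show "(\<integral>\<^sup>+x. pb x \<partial>\<mu>S) \<le> 1" by (simp add: \<nu>.emeasure_space_1)
    show "(\<integral>\<^sup>+x. ennreal (p G\<^sub>0 x) \<partial>\<mu>S) \<le> 1"
      by (rule order.trans[OF int_S mixture_density_integral_le[OF G0]]) measurable
    have "(\<integral>\<^sup>+x. D x \<partial>\<mu>S) = (\<integral>\<^sup>+G. (\<integral>\<^sup>+x. ennreal ((sqrt (p G x) - sqrt (p G\<^sub>2 x))\<^sup>2) \<partial>\<mu>S) \<partial>\<nu>)"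
      unfolding D_def by (rule pair.Fubini'[symmetric]) (use D_pair in measurable)
    also have "\<dots> \<le> (\<integral>\<^sup>+G. ennreal (2 * H G G\<^sub>2) \<partial>\<nu>)"
    proof (rule nn_integral_mono)
      fix G assume "G \<in> space \<nu>"
      then have G: "G \<in> discrete_measures T" by (simp add: space_\<nu>)
      note [measurable] = mixture_density_measurable[OF G]
      show "(\<integral>\<^sup>+x. ennreal ((sqrt (p G x) - sqrt (p G\<^sub>2 x))\<^sup>2) \<partial>\<mu>S) \<le> ennreal (2 * H G G\<^sub>2)"
        unfolding nn_integral_H[OF G G2, symmetric] by (rule int_S) measurable
    qed
    also have "\<dots> \<le> (\<integral>\<^sup>+G. ennreal (H G\<^sub>0 G\<^sub>2 / 2) \<partial>\<nu>)"
      by (rule nn_integral_mono_AE) (use near in eventually_elim, auto intro!: ennreal_leI)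
    finally show "(\<integral>\<^sup>+x. D x \<partial>\<mu>S) \<le> ennreal (H G\<^sub>0 G\<^sub>2 / 2)"
      by (simp add: \<nu>.emeasure_space_1)
  qed
  finally have key: "2 * A + ennreal (H G\<^sub>0 G\<^sub>2) \<le> 2 + ennreal (H G\<^sub>0 G\<^sub>2 / 2)"
    by simp
  have "A \<le> ennreal (1 - H G\<^sub>0 G\<^sub>2 / 4)"
  proof (cases A)
    case (real a)
    have "ennreal (2 * a + H G\<^sub>0 G\<^sub>2) \<le> ennreal (2 + H G\<^sub>0 G\<^sub>2 / 2)"
      using key real hellinger_sq_nonneg by (simp add: ennreal_mult)
    then have "a \<le> 1 - H G\<^sub>0 G\<^sub>2 / 4"
      using hellinger_sq_nonneg[of "p G\<^sub>0" "p G\<^sub>2"] by (subst (asm) ennreal_le_iff) auto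
    then show ?thesis using real by (auto intro: ennreal_leI)
  next
    case top
    then show ?thesis using key by (simp add: ennreal_mult_top ennreal_top_mult top_unique)
  qed
  moreover have "(\<integral>\<^sup>+x. esqrt (\<integral>\<^sup>+G. r G x \<partial>\<nu>) \<partial>P\<^sub>0) = A"
  proof -
    have "(\<integral>\<^sup>+x. esqrt (\<integral>\<^sup>+G. r G x \<partial>\<nu>) \<partial>P\<^sub>0) = (\<integral>\<^sup>+x. ennreal (p G\<^sub>0 x) * esqrt (\<integral>\<^sup>+G. r G x \<partial>\<nu>) \<partial>\<mu>)"
      by (rule nn_integral_P0) measurable
    also have "\<dots> = (\<integral>\<^sup>+x. esqrt (pb x) * ennreal (sqrt (p G\<^sub>0 x)) \<partial>\<mu>)"
    proof (rule nn_integral_cong)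
      fix x assume x: "x \<in> space \<mu>"
      \<comment> \<open>The identity p0 sqrt(pb / p0) = sqrt(pb p0) turns the expectation into a
        Hellinger affinity; both sides vanish where \<open>p G\<^sub>0\<close> does.\<close>
      show "ennreal (p G\<^sub>0 x) * esqrt (\<integral>\<^sup>+G. r G x \<partial>\<nu>) = esqrt (pb x) * ennreal (sqrt (p G\<^sub>0 x))"
      proof (cases "p G\<^sub>0 x = 0")
        case False
        then have p0: "p G\<^sub>0 x > 0" using nonneg(1)[OF x] by simp
        have [measurable]: "(\<lambda>G. p G x) \<in> borel_measurable \<nu>"
          using measurable_compose[OF measurable_Pair2'[OF x] density_measurable_pair[OF sets_\<nu>]] by simp
        have "(\<integral>\<^sup>+G. r G x \<partial>\<nu>) = (\<integral>\<^sup>+G. ennreal (1 / p G\<^sub>0 x) * ennreal (p G x) \<partial>\<nu>)"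
          by (rule nn_integral_cong) (use p0 nonneg(3)[OF x] in \<open>auto simp: r_def ennreal_mult[symmetric]\<close>)
        also have "\<dots> = ennreal (1 / p G\<^sub>0 x) * pb x"
          unfolding pb_def by (rule nn_integral_cmult) measurable
        finally have "ennreal (p G\<^sub>0 x) * esqrt (\<integral>\<^sup>+G. r G x \<partial>\<nu>)
            = (ennreal (p G\<^sub>0 x) * ennreal (sqrt (1 / p G\<^sub>0 x))) * esqrt (pb x)"
          using p0 by (simp add: esqrt_mult esqrt_ennreal mult.assoc)
        also have "ennreal (p G\<^sub>0 x) * ennreal (sqrt (1 / p G\<^sub>0 x)) = ennreal (sqrt (p G\<^sub>0 x))"
          using p0 by (simp add: ennreal_mult[symmetric] real_sqrt_divide real_div_sqrt)
        finally show ?thesis by (simp add: mult.commute)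
      qed simp
    qed
    also have "\<dots> = A"
      unfolding A_def by (rule int_S_eq[symmetric]) (auto simp: off_S)
    finally show ?thesis .
  qed
  ultimately show ?thesis by simp
qed

abbreviation Pn :: "nat set \<Rightarrow> (nat \<Rightarrow> 'x) measure"
  where "Pn I \<equiv> Pi\<^sub>M I (\<lambda>_. P\<^sub>0)"

abbreviation lik :: "nat set \<Rightarrow> 't pmf \<Rightarrow> (nat \<Rightarrow> 'x) \<Rightarrow> ennreal"
  where "lik I G x \<equiv> \<Prod>i\<in>I. r G (x i)"

sublocale Pn: product_prob_space "\<lambda>_::nat. P\<^sub>0" I for I
  by standard

lemma density_pair [measurable]: "(\<lambda>(G, x). p G x) \<in> borel_measurable (prior \<Otimes>\<^sub>M P\<^sub>0)"
  using density_measurable_pair[OF sets_prior] by measurable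

lemma r_pair [measurable]: "(\<lambda>(G, x). r G x) \<in> borel_measurable (prior \<Otimes>\<^sub>M P\<^sub>0)"
  using r_measurable_pair[OF sets_prior] by measurable

lemma r_pair' [measurable]: "(\<lambda>(x, G). r G x) \<in> borel_measurable (P\<^sub>0 \<Otimes>\<^sub>M prior)"
  using measurable_pair_swap[OF r_pair] by simp

lemma lik_pair [measurable]:
  "(\<lambda>(x, G). lik I G x) \<in> borel_measurable (Pn I \<Otimes>\<^sub>M prior)"
proof -
  have "(\<lambda>z. r (snd z) (fst z i)) \<in> borel_measurable (Pn I \<Otimes>\<^sub>M prior)" if [measurable]: "i \<in> I" for i
  proof -
    have "(\<lambda>z. case (snd z, fst z i) of (G, x) \<Rightarrow> r G x) \<in> borel_measurable (Pn I \<Otimes>\<^sub>M prior)"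
      by (rule measurable_compose[OF _ r_pair]) measurable
    then show ?thesis by simp
  qed
  then show ?thesis
    by (simp add: case_prod_beta' borel_measurable_prod)
qed

lemma lik_pair' [measurable]:
  "(\<lambda>(G, x). lik I G x) \<in> borel_measurable (prior \<Otimes>\<^sub>M Pn I)"
  using measurable_pair_swap[OF lik_pair] by simp

lemma lik_measurable_prior: "x \<in> space (Pn I) \<Longrightarrow> (\<lambda>G. lik I G x) \<in> borel_measurable prior"
  using measurable_compose[OF measurable_Pair2' lik_pair'] by simp

lemma r_measurable_prior: "x \<in> space P\<^sub>0 \<Longrightarrow> (\<lambda>G. r G x) \<in> borel_measurable prior"
  using measurable_compose[OF measurable_Pair2' r_pair] by simp

text \<open>Normalising \<open>w\<close> by its total mass \<open>m\<close> gives a prior carried by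
  the Hellinger ball, and both sides scale with \<open>esqrt m\<close>. The bound 1 - t \<le> exp(-
  t) gives the exponential form that multiplies over observations.\<close>

lemma one_step_affinity:
  assumes [measurable]: "w \<in> borel_measurable prior" and G2: "G\<^sub>2 \<in> discrete_measures T"
    and near: "AE G in prior. 0 < w G \<longrightarrow> H G G\<^sub>2 \<le> H G\<^sub>0 G\<^sub>2 / 4"
  shows "(\<integral>\<^sup>+x. esqrt (\<integral>\<^sup>+G. w G * r G x \<partial>prior) \<partial>P\<^sub>0)
    \<le> ennreal (exp (- H G\<^sub>0 G\<^sub>2 / 4)) * esqrt (\<integral>\<^sup>+G. w G \<partial>prior)"
proof -
  define m where "m = (\<integral>\<^sup>+G. w G \<partial>prior)"
  consider "m = \<top>" | "m = 0" | "0 < m" "m < \<top>"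
    by (metis less_top not_gr_zero)
  then show ?thesis
  proof cases
    case 1
    then show ?thesis by (simp add: m_def[symmetric] ennreal_mult_top)
  next
    case 2
    then have "AE G in prior. w G = 0"
      by (simp add: m_def nn_integral_0_iff_AE)
    then have "(\<integral>\<^sup>+G. w G * r G x \<partial>prior) = 0" for x
      by (subst nn_integral_cong_AE[where v = "\<lambda>_. 0"]) auto
    then show ?thesis by simp
  next
    case 3
    define \<nu> where "\<nu> = density prior (\<lambda>G. inverse m * w G)"
    have inv: "m * inverse m = 1" "inverse m * m = 1"
      using 3 ennreal_divide_self[of m] by (auto simp: divide_ennreal_def mult.commute)
    have sets_\<nu>: "sets \<nu> = sets (W2_borel T)"
      by (simp add: \<nu>_def sets_prior)
    have "emeasure \<nu> (space \<nu>) = inverse m * m"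
      by (simp add: \<nu>_def emeasure_density nn_integral_cmult m_def cong: nn_integral_cong)
    then have \<nu>: "prob_space \<nu>"
      by (intro prob_spaceI) (simp add: inv)
    have "AE G in \<nu>. H G G\<^sub>2 \<le> H G\<^sub>0 G\<^sub>2 / 4"
      unfolding \<nu>_def by (subst AE_density) (use near in \<open>auto elim!: eventually_mono simp: zero_less_iff_neq_zero\<close>)
    note affinity = predictive_affinity[OF \<nu> sets_\<nu> G2 this]
    have eq: "(\<integral>\<^sup>+G. w G * r G x \<partial>prior) = m * (\<integral>\<^sup>+G. r G x \<partial>\<nu>)" if x: "x \<in> space P\<^sub>0" for x
    proof -
      note [measurable] = r_measurable_prior[OF x]
      have "m * (\<integral>\<^sup>+G. r G x \<partial>\<nu>) = m * (\<integral>\<^sup>+G. inverse m * (w G * r G x) \<partial>prior)"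
        unfolding \<nu>_def by (subst nn_integral_density) (auto simp: mult.assoc)
      also have "\<dots> = m * (inverse m * (\<integral>\<^sup>+G. w G * r G x \<partial>prior))"
        by (subst nn_integral_cmult) auto
      also have "\<dots> = (\<integral>\<^sup>+G. w G * r G x \<partial>prior)"
        by (simp add: mult.assoc[symmetric] inv)
      finally show ?thesis by simp
    qed
    have "(\<lambda>x. \<integral>\<^sup>+G. r G x \<partial>\<nu>) \<in> borel_measurable P\<^sub>0"
    proof -
      interpret \<nu>: prob_space \<nu> by (rule \<nu>)
      have "(\<lambda>(x, G). r G x) \<in> borel_measurable (P\<^sub>0 \<Otimes>\<^sub>M \<nu>)"
        using r_pair' by (simp add: \<nu>_def cong: measurable_cong_sets sets_pair_measure_cong)
      then show ?thesis by measurable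
    qed
    note [measurable] = this
    have "(\<integral>\<^sup>+x. esqrt (\<integral>\<^sup>+G. w G * r G x \<partial>prior) \<partial>P\<^sub>0) = (\<integral>\<^sup>+x. esqrt m * esqrt (\<integral>\<^sup>+G. r G x \<partial>\<nu>) \<partial>P\<^sub>0)"
      by (rule nn_integral_cong) (simp add: eq esqrt_mult)
    also have "\<dots> = esqrt m * (\<integral>\<^sup>+x. esqrt (\<integral>\<^sup>+G. r G x \<partial>\<nu>) \<partial>P\<^sub>0)"
      by (rule nn_integral_cmult) measurable
    also have "\<dots> \<le> esqrt m * ennreal (exp (- H G\<^sub>0 G\<^sub>2 / 4))"
      using exp_ge_add_one_self[of "- H G\<^sub>0 G\<^sub>2 / 4"]
      by (intro mult_left_mono order.trans[OF affinity] ennreal_leI) auto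
    finally show ?thesis by (simp add: m_def mult.commute)
  qed
qed

text \<open>In the induction \<open>w G * lik I G x\<close> acts as an unnormalised posterior given
  the observations already seen. It vanishes wherever \<open>w\<close> does, so the hypothesis
  \<open>near\<close> passes from one step to the next.\<close>

lemma product_affinity:
  assumes I: "finite I" and [measurable]: "w \<in> borel_measurable prior" and G2: "G\<^sub>2 \<in> discrete_measures T"
    and near: "AE G in prior. 0 < w G \<longrightarrow> H G G\<^sub>2 \<le> H G\<^sub>0 G\<^sub>2 / 4"
  shows "(\<integral>\<^sup>+x. esqrt (\<integral>\<^sup>+G. w G * lik I G x \<partial>prior) \<partial>Pn I)
    \<le> ennreal (exp (- (real (card I) * H G\<^sub>0 G\<^sub>2 / 4))) * esqrt (\<integral>\<^sup>+G. w G \<partial>prior)"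
  using I
proof (induction I rule: finite_induct)
  case empty
  show ?case by (simp add: prob_space.emeasure_space_1[OF prob_space_PiM] P0.prob_space_axioms)
next
  case (insert i I)
  let ?E = "ennreal (exp (- H G\<^sub>0 G\<^sub>2 / 4))"
  have meas: "(\<lambda>x. esqrt (\<integral>\<^sup>+G. w G * lik J G x \<partial>prior)) \<in> borel_measurable (Pn J)" for J
  proof -
    have "(\<lambda>z. w (snd z) * (case z of (x, G) \<Rightarrow> lik J G x)) \<in> borel_measurable (Pn J \<Otimes>\<^sub>M prior)"
      by measurable
    then have "(\<lambda>(x, G). w G * lik J G x) \<in> borel_measurable (Pn J \<Otimes>\<^sub>M prior)"
      by (simp add: case_prod_beta')
    then have [measurable]: "(\<lambda>x. \<integral>\<^sup>+G. w G * lik J G x \<partial>prior) \<in> borel_measurable (Pn J)"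
      by (rule prior.borel_measurable_nn_integral[of "\<lambda>x G. w G * lik J G x"])
    show ?thesis by measurable
  qed
  have "(\<integral>\<^sup>+x. esqrt (\<integral>\<^sup>+G. w G * lik (insert i I) G x \<partial>prior) \<partial>Pn (insert i I))
      = (\<integral>\<^sup>+x. (\<integral>\<^sup>+y. esqrt (\<integral>\<^sup>+G. w G * lik (insert i I) G (x(i := y)) \<partial>prior) \<partial>P\<^sub>0) \<partial>Pn I)"
    by (rule Pn.product_nn_integral_insert[OF insert.hyps meas])
  also have "\<dots> = (\<integral>\<^sup>+x. (\<integral>\<^sup>+y. esqrt (\<integral>\<^sup>+G. (w G * lik I G x) * r G y \<partial>prior) \<partial>P\<^sub>0) \<partial>Pn I)"
  proof -
    have "lik (insert i I) G (x(i := y)) = lik I G x * r G y" for G x y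
    proof -
      have "lik I G (x(i := y)) = lik I G x"
        by (rule prod.cong) (use insert.hyps in auto)
      then show ?thesis using insert.hyps by (simp add: mult.commute)
    qed
    then show ?thesis by (simp add: mult.assoc)
  qed
  also have "\<dots> \<le> (\<integral>\<^sup>+x. ?E * esqrt (\<integral>\<^sup>+G. w G * lik I G x \<partial>prior) \<partial>Pn I)"
  proof (rule nn_integral_mono, rule one_step_affinity[OF _ G2])
    fix x assume "x \<in> space (Pn I)"
    note [measurable] = lik_measurable_prior[OF this]
    show "(\<lambda>G. w G * lik I G x) \<in> borel_measurable prior" by measurable
    show "AE G in prior. 0 < w G * lik I G x \<longrightarrow> H G G\<^sub>2 \<le> H G\<^sub>0 G\<^sub>2 / 4"
      using near by eventually_elim (auto simp: zero_less_iff_neq_zero)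
  qed
  also have "\<dots> = ?E * (\<integral>\<^sup>+x. esqrt (\<integral>\<^sup>+G. w G * lik I G x \<partial>prior) \<partial>Pn I)"
    by (rule nn_integral_cmult[OF meas])
  also have "\<dots> \<le> ?E * (ennreal (exp (- (real (card I) * H G\<^sub>0 G\<^sub>2 / 4))) * esqrt (\<integral>\<^sup>+G. w G \<partial>prior))"
    by (intro mult_left_mono insert.IH) auto
  also have "\<dots> = ennreal (exp (- (real (card (insert i I)) * H G\<^sub>0 G\<^sub>2 / 4))) * esqrt (\<integral>\<^sup>+G. w G \<partial>prior)"
  proof -
    have "- H G\<^sub>0 G\<^sub>2 / 4 + - (real (card I) * H G\<^sub>0 G\<^sub>2 / 4) = - (real (card (insert i I)) * H G\<^sub>0 G\<^sub>2 / 4)"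
      using insert.hyps by (simp add: algebra_simps add_divide_distrib)
    then show ?thesis
      unfolding mult.assoc[symmetric] by (subst ennreal_mult[symmetric]) (simp_all only: exp_ge_zero exp_add[symmetric])
  qed
  finally show ?case .
qed

lemma lik_integral_le:
  assumes "finite I" "G \<in> discrete_measures T"
  shows "(\<integral>\<^sup>+x. lik I G x \<partial>Pn I) \<le> 1"
proof -
  have "(\<integral>\<^sup>+x. lik I G x \<partial>Pn I) = (\<Prod>i\<in>I. \<integral>\<^sup>+x. r G x \<partial>P\<^sub>0)"
    by (rule Pn.product_nn_integral_prod[OF assms(1)]) (use r_measurable[OF assms(2)] in measurable)
  also have "\<dots> \<le> 1"
    by (intro prod_le_1) (use r_integral_le[OF assms(2)] in auto)
  finally show ?thesis .
qed

text \<open>Used for the remainder of the parameter space, for which no separation from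
  \<open>G\<^sub>0\<close> is available and no exponential gain is expected.\<close>

lemma evidence_integral_le:
  assumes I: "finite I" and [measurable]: "B \<in> sets prior"
  shows "(\<integral>\<^sup>+x. (\<integral>\<^sup>+G. indicator B G * lik I G x \<partial>prior) \<partial>Pn I) \<le> emeasure prior B"
proof -
  interpret pair: pair_sigma_finite prior "Pn I"
    by (intro pair_sigma_finite.intro) (auto intro: prior.sigma_finite_measure_axioms Pn.sigma_finite_measure_axioms)
  have meas: "(\<lambda>(G, x). indicator B G * lik I G x) \<in> borel_measurable (prior \<Otimes>\<^sub>M Pn I)"
  proof -
    have "(\<lambda>z. indicator B (fst z) * (case z of (G, x) \<Rightarrow> lik I G x)) \<in> borel_measurable (prior \<Otimes>\<^sub>M Pn I)"
      by measurable
    then show ?thesis by (simp add: case_prod_beta')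
  qed
  have "(\<integral>\<^sup>+x. (\<integral>\<^sup>+G. indicator B G * lik I G x \<partial>prior) \<partial>Pn I)
      = (\<integral>\<^sup>+G. (\<integral>\<^sup>+x. indicator B G * lik I G x \<partial>Pn I) \<partial>prior)"
    by (rule pair.Fubini'[OF meas])
  also have "\<dots> \<le> (\<integral>\<^sup>+G. indicator B G \<partial>prior)"
  proof (rule nn_integral_mono)
    fix G assume "G \<in> space prior"
    then have G: "G \<in> discrete_measures T" by (simp add: space_prior)
    then show "(\<integral>\<^sup>+x. indicator B G * lik I G x \<partial>Pn I) \<le> indicator B G"
      using lik_integral_le[OF I G] by (cases "G \<in> B") auto
  qed
  finally show ?thesis by simp
qed

section \<open>Kullback--Leibler neighbourhoods\<close>

abbreviation l :: "'t pmf \<Rightarrow> 'x \<Rightarrow> real"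
  where "l G x \<equiv> ln (p G x / p G\<^sub>0 x)"

abbreviation KL :: "real \<Rightarrow> 't pmf set"
  where "KL \<equiv> KL_neighbourhood \<mu> T f G\<^sub>0"

lemma KL_D:
  assumes "G \<in> KL e"
  shows "G \<in> discrete_measures T" "AE x in P\<^sub>0. 0 < p G x" "integrable P\<^sub>0 (l G)"
    "integrable P\<^sub>0 (\<lambda>x. (l G x)\<^sup>2)" "- e\<^sup>2 \<le> (\<integral>x. l G x \<partial>P\<^sub>0)" "(\<integral>x. (l G x)\<^sup>2 \<partial>P\<^sub>0) \<le> e\<^sup>2"
  using assms by (auto simp: KL_neighbourhood_def Let_def)

text \<open>From ln t \<le> 2 (sqrt t - 1), the mean log-ratio is at most twice the affinity minus
  2. As both densities have mass at most 1, this is at most \<open>- 2 * H G\<^sub>0 G\<close>. The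
  bound serves to rule out shells of index 0.\<close>

lemma KL_hellinger_le:
  assumes "G \<in> KL e"
  shows "H G\<^sub>0 G \<le> e\<^sup>2 / 2"
proof -
  note KL = KL_D[OF assms]
  note G = KL(1)
  note [measurable] = mixture_density_measurable[OF G]
  note int = mixture_density_integrable[OF G] mixture_density_integrable[OF G0]
  have le1: "(\<integral>x. p G' x \<partial>\<mu>) \<le> 1" if "G' \<in> discrete_measures T" for G'
    using mixture_density_integral_le[OF that]
    by (subst (asm) nn_integral_eq_integral)
      (auto simp: mixture_density_integrable mixture_density_nonneg that intro!: AE_I2)
  have sq: "(sqrt (p G' x))\<^sup>2 = p G' x" if "G' \<in> discrete_measures T" "x \<in> space \<mu>" for G' x
    using mixture_density_nonneg[OF that] by simp
  have int_sq: "integrable \<mu> (\<lambda>x. (sqrt (p G' x))\<^sup>2)" if "G' \<in> discrete_measures T" for G'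
    using mixture_density_integrable[OF that]
    by (subst Bochner_Integration.integrable_cong[OF refl sq[OF that]]) auto
  have cross: "integrable \<mu> (\<lambda>x. sqrt (p G\<^sub>0 x) * sqrt (p G x))"
    by (rule integrable_mult_square) (use int_sq G G0 in auto)
  define s where "s x = sqrt (p G x / p G\<^sub>0 x)" for x
  have [measurable]: "s \<in> borel_measurable \<mu>" unfolding s_def by measurable
  have s: "p G\<^sub>0 x * s x = sqrt (p G\<^sub>0 x) * sqrt (p G x)" if "x \<in> space \<mu>" for x
    using mixture_density_nonneg[OF G0 that]
    by (cases "p G\<^sub>0 x = 0") (auto simp: s_def real_sqrt_divide field_simps)
  have nn: "AE x in \<mu>. 0 \<le> p G\<^sub>0 x"
    using mixture_density_nonneg[OF G0] by (auto intro!: AE_I2)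
  have s_int: "integrable P\<^sub>0 s"
    unfolding mixture_measure_def
    by (subst integrable_real_density[OF p0_measurable nn])
      (use cross s in \<open>auto cong: Bochner_Integration.integrable_cong\<close>)
  have "(\<integral>x. s x \<partial>P\<^sub>0) = (\<integral>x. p G\<^sub>0 x * s x \<partial>\<mu>)"
    unfolding mixture_measure_def by (rule integral_real_density[OF p0_measurable nn]) measurable
  also have "\<dots> = (\<integral>x. sqrt (p G\<^sub>0 x) * sqrt (p G x) \<partial>\<mu>)"
    by (rule Bochner_Integration.integral_cong) (auto simp: s)
  finally have s_eq: "(\<integral>x. s x \<partial>P\<^sub>0) = (\<integral>x. sqrt (p G\<^sub>0 x) * sqrt (p G x) \<partial>\<mu>)" .
  have "(\<integral>x. l G x \<partial>P\<^sub>0) \<le> (\<integral>x. 2 * (s x - 1) \<partial>P\<^sub>0)"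
  proof (rule integral_mono_AE[OF KL(3)])
    show "integrable P\<^sub>0 (\<lambda>x. 2 * (s x - 1))" using s_int by simp
    show "AE x in P\<^sub>0. l G x \<le> 2 * (s x - 1)"
      using KL(2) p0_positive
    proof eventually_elim
      case (elim x)
      then have pos: "p G x / p G\<^sub>0 x > 0" by simp
      have "l G x = 2 * ln (s x)"
        using pos by (simp add: s_def ln_sqrt)
      also have "\<dots> \<le> 2 * (s x - 1)"
        using pos by (intro mult_left_mono ln_le_minus_one) (auto simp: s_def)
      finally show ?case .
    qed
  qed
  also have "\<dots> = 2 * ((\<integral>x. s x \<partial>P\<^sub>0) - 1)"
    using s_int by (simp add: P0.prob_space)
  finally have "- e\<^sup>2 \<le> 2 * ((\<integral>x. sqrt (p G\<^sub>0 x) * sqrt (p G x) \<partial>\<mu>) - 1)"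
    unfolding s_eq by (rule order.trans[OF KL(5)])
  moreover have "2 * H G\<^sub>0 G = (\<integral>x. p G\<^sub>0 x + p G x - 2 * (sqrt (p G\<^sub>0 x) * sqrt (p G x)) \<partial>\<mu>)"
    unfolding hellinger_sq_def
    by (simp, rule Bochner_Integration.integral_cong)
      (auto simp: power2_diff sq G G0)
  moreover have "\<dots> = (\<integral>x. p G\<^sub>0 x \<partial>\<mu>) + (\<integral>x. p G x \<partial>\<mu>) - 2 * (\<integral>x. sqrt (p G\<^sub>0 x) * sqrt (p G x) \<partial>\<mu>)"
    using int cross by simp
  moreover have "h \<le> E / 2"
    if "- E \<le> 2 * (X - 1)" "2 * h = Y" "Y = a + b - 2 * X" "a \<le> 1" "b \<le> 1" for E X h Y a b :: real
    using that by argo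
  ultimately show ?thesis
    using le1[OF G0] le1[OF G] by blast
qed

end

section \<open>Second moments of centered sums and Jensen's inequality\<close>

lemma
  fixes U :: "'a \<Rightarrow> real" and I :: "'i set"
  assumes M: "prob_space M" and I: "finite I"
    and U: "integrable M U" "integrable M (\<lambda>x. (U x)\<^sup>2)" "(\<integral>x. U x \<partial>M) = 0"
  shows integrable_centered_sum_square: "integrable (Pi\<^sub>M I (\<lambda>_. M)) (\<lambda>x. (\<Sum>i\<in>I. U (x i))\<^sup>2)"
    and integral_centered_sum_square:
      "(\<integral>x. (\<Sum>i\<in>I. U (x i))\<^sup>2 \<partial>Pi\<^sub>M I (\<lambda>_. M)) = real (card I) * (\<integral>x. (U x)\<^sup>2 \<partial>M)"
proof -
  interpret M: prob_space M by fact
  interpret P: product_prob_space "\<lambda>_::'i. M" I by standard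
  \<comment> \<open>Writes U(x_i) U(x_j) as a product over all coordinates, equal to 1 off i and j
    and to U^2 at a coincidence, so that product integration applies. For distinct i and j one
    factor integrates to 0.\<close>
  define g where "g i j k y = (if k = i then U y else 1) * (if k = j then U y else 1)" for i j k :: 'i and y
  have g_int: "integrable M (g i j k)" for i j k
    unfolding g_def using U by (cases "k = i"; cases "k = j") (auto simp: power2_eq_square)
  have g_prod: "(\<Prod>k\<in>I. g i j k (x k)) = U (x i) * U (x j)" if "i \<in> I" "j \<in> I" for i j x
    using that I by (simp add: g_def prod.distrib)
  have cross_int: "integrable (Pi\<^sub>M I (\<lambda>_. M)) (\<lambda>x. U (x i) * U (x j))" if "i \<in> I" "j \<in> I" for i j
    using P.product_integrable_prod[OF I, of "g i j"] g_int g_prod[OF that] by simp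
  have cross: "(\<integral>x. U (x i) * U (x j) \<partial>Pi\<^sub>M I (\<lambda>_. M)) = (if i = j then \<integral>x. (U x)\<^sup>2 \<partial>M else 0)"
    if ij: "i \<in> I" "j \<in> I" for i j
  proof -
    have "(\<integral>x. U (x i) * U (x j) \<partial>Pi\<^sub>M I (\<lambda>_. M)) = (\<Prod>k\<in>I. \<integral>y. g i j k y \<partial>M)"
      using P.product_integral_prod[OF I, of "g i j"] g_int g_prod[OF ij] by simp
    also have "\<dots> = (if i = j then \<integral>x. (U x)\<^sup>2 \<partial>M else 0)"
    proof (cases "i = j")
      case True
      have "(\<integral>y. g i j k y \<partial>M) = (if k = i then \<integral>x. (U x)\<^sup>2 \<partial>M else 1)" for k
        using True by (simp add: g_def power2_eq_square M.prob_space)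
      then show ?thesis using True ij I by simp
    next
      case False
      then have "(\<integral>y. g i j i y \<partial>M) = 0" by (simp add: g_def U(3))
      then show ?thesis using False ij I by (auto simp: prod_zero_iff)
    qed
    finally show ?thesis .
  qed
  have eq: "(\<Sum>i\<in>I. U (x i))\<^sup>2 = (\<Sum>i\<in>I. \<Sum>j\<in>I. U (x i) * U (x j))" for x
    by (simp add: power2_eq_square sum_product)
  show "integrable (Pi\<^sub>M I (\<lambda>_. M)) (\<lambda>x. (\<Sum>i\<in>I. U (x i))\<^sup>2)"
    unfolding eq by (intro Bochner_Integration.integrable_sum cross_int)
  show "(\<integral>x. (\<Sum>i\<in>I. U (x i))\<^sup>2 \<partial>Pi\<^sub>M I (\<lambda>_. M)) = real (card I) * (\<integral>x. (U x)\<^sup>2 \<partial>M)"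
    unfolding eq using I by (simp add: cross_int cross Bochner_Integration.integral_sum Bochner_Integration.integrable_sum)
qed

text \<open>Jensen by the tangent line of exp at the mean. The exponential may fail to be
  integrable, hence the nonnegative integral on the right; the positive part of the tangent line
  mediates between the two integrals.\<close>

lemma (in prob_space) exp_integral_le_nn_integral_exp:
  assumes s: "integrable M s"
  shows "ennreal (exp (\<integral>x. s x \<partial>M)) \<le> (\<integral>\<^sup>+x. ennreal (exp (s x)) \<partial>M)"
proof -
  define c where "c = (\<integral>x. s x \<partial>M)"
  have int: "integrable M (\<lambda>x. exp c * (1 + s x - c))"
    using s by simp
  have "exp c = (\<integral>x. exp c * (1 + s x - c) \<partial>M)"
    using s by (simp add: prob_space c_def)
  also have "\<dots> \<le> (\<integral>x. max 0 (exp c * (1 + s x - c)) \<partial>M)"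
    by (rule integral_mono) (use int in auto)
  finally have "ennreal (exp c) \<le> ennreal (\<integral>x. max 0 (exp c * (1 + s x - c)) \<partial>M)"
    by (rule ennreal_leI)
  also have "\<dots> = (\<integral>\<^sup>+x. ennreal (max 0 (exp c * (1 + s x - c))) \<partial>M)"
    by (rule nn_integral_eq_integral[symmetric]) (use int in auto)
  also have "\<dots> \<le> (\<integral>\<^sup>+x. ennreal (exp (s x)) \<partial>M)"
  proof (intro nn_integral_mono ennreal_leI)
    fix x
    have "exp c * (1 + (s x - c)) \<le> exp c * exp (s x - c)"
      by (intro mult_left_mono exp_ge_add_one_self) auto
    then show "max 0 (exp c * (1 + s x - c)) \<le> exp (s x)"
      by (simp add: exp_add[symmetric] add_diff_eq)
  qed
  finally show ?thesis by (simp add: c_def)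
qed

section \<open>Lower bound for the evidence\<close>

context mixture_bayes
begin

text \<open>With \<open>Q\<close> the prior conditioned on \<open>B\<close>, Jensen bounds the
  log-evidence below by a sum of independent copies of \<open>Y\<close>, the
  \<open>Q\<close>-average of the log-ratio. The neighbourhood conditions give \<open>Y\<close> mean
  at least \<open>- e\<^sup>2\<close> and second moment at most \<open>e\<^sup>2\<close>.
  Chebyshev's inequality then allows a deviation of \<open>C\<close> times
  \<open>card I * e\<^sup>2\<close>; \<open>A\<close> is the exceptional set.\<close>

lemma evidence_lower_bound:
  assumes I: "finite I" "I \<noteq> {}" and B: "B \<in> sets prior" "B \<subseteq> KL e" "0 < prior.prob B"
    and e: "e > 0" and C: "C > 0"
  shows "\<exists>A\<in>sets (Pn I). measure (Pn I) A \<le> 1 / (C\<^sup>2 * (real (card I) * e\<^sup>2)) \<and>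
    (AE x in Pn I. x \<notin> A \<longrightarrow>
      ennreal (prior.prob B * exp (- ((1 + C) * (real (card I) * e\<^sup>2)))) \<le> (\<integral>\<^sup>+G. indicator B G * lik I G x \<partial>prior))"
proof -
  define N where "N = real (card I)"
  have N: "N > 0" using I by (simp add: N_def card_gt_0_iff)
  define b where "b = prior.prob B"
  have b: "b > 0" using B by (simp add: b_def)
  note [measurable] = B(1)
  define Q where "Q = density prior (\<lambda>G. ennreal (1 / b) * indicator B G)"
  have sets_Q [measurable_cong]: "sets Q = sets prior" by (simp add: Q_def)
  have "emeasure Q (space Q) = ennreal (1 / b) * emeasure prior B"
    by (simp add: Q_def emeasure_density nn_integral_cmult cong: nn_integral_cong)
  also have "\<dots> = 1"
    using b by (simp add: prior.emeasure_eq_measure b_def ennreal_mult[symmetric])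
  finally interpret Q: prob_space Q by (rule prob_spaceI)
  have Q_B: "AE G in Q. G \<in> B"
    unfolding Q_def by (subst AE_density) (auto simp: indicator_def)
  interpret QP: pair_prob_space Q P\<^sub>0 ..
  have [measurable]: "(\<lambda>(G, x). p G x) \<in> borel_measurable (Q \<Otimes>\<^sub>M P\<^sub>0)"
    by measurable
  have l_pair [measurable]: "(\<lambda>(G, x). l G x) \<in> borel_measurable (Q \<Otimes>\<^sub>M P\<^sub>0)"
  proof -
    have "(\<lambda>z. ln ((case z of (G, x) \<Rightarrow> p G x) / p G\<^sub>0 (snd z))) \<in> borel_measurable (Q \<Otimes>\<^sub>M P\<^sub>0)"
      by measurable
    then show ?thesis by (simp add: case_prod_beta')
  qed
  have l2_pair [measurable]: "(\<lambda>(G, x). (l G x)\<^sup>2) \<in> borel_measurable (Q \<Otimes>\<^sub>M P\<^sub>0)"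
  proof -
    have "(\<lambda>z. (case z of (G, x) \<Rightarrow> l G x)\<^sup>2) \<in> borel_measurable (Q \<Otimes>\<^sub>M P\<^sub>0)"
      by measurable
    then show ?thesis by (simp add: case_prod_beta')
  qed
  note KL = KL_D[OF subsetD[OF B(2)]]
  have l2_int: "integrable (Q \<Otimes>\<^sub>M P\<^sub>0) (\<lambda>(G, x). (l G x)\<^sup>2)"
  proof (rule QP.Fubini_integrable[OF l2_pair])
    have "integrable Q (\<lambda>G. \<integral>x. (l G x)\<^sup>2 \<partial>P\<^sub>0)"
    proof (rule Q.integrable_const_bound[where B = "e\<^sup>2"])
      show "AE G in Q. norm (\<integral>x. (l G x)\<^sup>2 \<partial>P\<^sub>0) \<le> e\<^sup>2"
        using Q_B by eventually_elim (use KL(6) in auto)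
      show "(\<lambda>G. \<integral>x. (l G x)\<^sup>2 \<partial>P\<^sub>0) \<in> borel_measurable Q"
        by (rule P0.borel_measurable_lebesgue_integral[OF l2_pair])
    qed
    then show "integrable Q (\<lambda>G. \<integral>x. norm (case (G, x) of (G, x) \<Rightarrow> (l G x)\<^sup>2) \<partial>P\<^sub>0)"
      by simp
    show "AE G in Q. integrable P\<^sub>0 (\<lambda>x. case (G, x) of (G, x) \<Rightarrow> (l G x)\<^sup>2)"
      using Q_B by eventually_elim (use KL(4) in auto)
  qed
  have l_int: "integrable (Q \<Otimes>\<^sub>M P\<^sub>0) (\<lambda>(G, x). l G x)"
    by (rule QP.P.square_integrable_imp_integrable) (use l_pair l2_int in \<open>auto simp: case_prod_beta'\<close>)
  define Y where "Y x = (\<integral>G. l G x \<partial>Q)" for x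
  define V where "V x = (\<integral>G. (l G x)\<^sup>2 \<partial>Q)" for x
  have Y_int: "integrable P\<^sub>0 Y" and V_int: "integrable P\<^sub>0 V"
    unfolding Y_def V_def by (rule QP.integrable_snd, rule l_int) (rule QP.integrable_snd, rule l2_int)
  have [measurable]: "Y \<in> borel_measurable P\<^sub>0" "V \<in> borel_measurable P\<^sub>0"
    using Y_int V_int by auto
  define m where "m = (\<integral>x. Y x \<partial>P\<^sub>0)"
  have "m = (\<integral>G. (\<integral>x. l G x \<partial>P\<^sub>0) \<partial>Q)"
    unfolding m_def Y_def QP.integral_snd[OF l_int] QP.integral_fst[OF l_int] ..
  moreover have "(\<integral>G. - e\<^sup>2 \<partial>Q) \<le> (\<integral>G. (\<integral>x. l G x \<partial>P\<^sub>0) \<partial>Q)"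
  proof (rule integral_mono_AE)
    show "integrable Q (\<lambda>G. \<integral>x. l G x \<partial>P\<^sub>0)"
      by (rule QP.integrable_fst[OF l_int])
    show "AE G in Q. - e\<^sup>2 \<le> (\<integral>x. l G x \<partial>P\<^sub>0)"
      using Q_B by eventually_elim (rule KL(5))
  qed simp
  ultimately have m: "- e\<^sup>2 \<le> m" by (simp add: Q.prob_space)
  have good1: "AE x in P\<^sub>0. integrable Q (\<lambda>G. l G x)" and good2: "AE x in P\<^sub>0. integrable Q (\<lambda>G. (l G x)\<^sup>2)"
    by (rule QP.AE_integrable_snd[OF l_int], rule QP.AE_integrable_snd[OF l2_int])
  \<comment> \<open>Nonnegativity of the variance under \<open>Q\<close>, which carries the
    second-moment condition over to the average \<open>Y\<close>.\<close>
  have Y_V: "AE x in P\<^sub>0. (Y x)\<^sup>2 \<le> V x"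
    using good1 good2
  proof eventually_elim
    case (elim x)
    have "0 \<le> Q.variance (\<lambda>G. l G x)" by (rule Q.variance_positive)
    then show ?case using Q.variance_eq[OF elim] by (simp add: Y_def V_def)
  qed
  have Y2_int: "integrable P\<^sub>0 (\<lambda>x. (Y x)\<^sup>2)"
    by (rule Bochner_Integration.integrable_bound[OF V_int]) (use Y_V in \<open>auto elim!: eventually_mono\<close>)
  have "(\<integral>x. (Y x)\<^sup>2 \<partial>P\<^sub>0) \<le> (\<integral>x. V x \<partial>P\<^sub>0)"
    by (rule integral_mono_AE[OF Y2_int V_int Y_V])
  also have "\<dots> = (\<integral>G. (\<integral>x. (l G x)\<^sup>2 \<partial>P\<^sub>0) \<partial>Q)"
    unfolding V_def QP.integral_snd[OF l2_int] QP.integral_fst[OF l2_int] ..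
  also have "\<dots> \<le> (\<integral>G. e\<^sup>2 \<partial>Q)"
  proof (rule integral_mono_AE)
    show "integrable Q (\<lambda>G. \<integral>x. (l G x)\<^sup>2 \<partial>P\<^sub>0)"
      by (rule QP.integrable_fst[OF l2_int])
    show "AE G in Q. (\<integral>x. (l G x)\<^sup>2 \<partial>P\<^sub>0) \<le> e\<^sup>2"
      using Q_B by eventually_elim (rule KL(6))
  qed simp
  finally have Y2_le: "(\<integral>x. (Y x)\<^sup>2 \<partial>P\<^sub>0) \<le> e\<^sup>2" by (simp add: Q.prob_space)
  define U where "U = (\<lambda>x. Y x - m)"
  have [measurable]: "U \<in> borel_measurable P\<^sub>0" unfolding U_def by measurable
  have U_int: "integrable P\<^sub>0 U" "(\<integral>x. U x \<partial>P\<^sub>0) = 0"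
    using Y_int by (auto simp: U_def m_def P0.prob_space)
  have U2_int: "integrable P\<^sub>0 (\<lambda>x. (U x)\<^sup>2)"
    using Y_int Y2_int by (simp add: U_def power2_diff)
  have "(\<integral>x. (U x)\<^sup>2 \<partial>P\<^sub>0) = (\<integral>x. (Y x)\<^sup>2 \<partial>P\<^sub>0) - m\<^sup>2"
    using P0.variance_eq[OF Y_int Y2_int] by (simp add: U_def m_def)
  then have U2_le: "(\<integral>x. (U x)\<^sup>2 \<partial>P\<^sub>0) \<le> e\<^sup>2" using Y2_le by (smt (verit) zero_le_power2)
  define S where "S x = (\<Sum>i\<in>I. U (x i))" for x
  have [measurable]: "S \<in> borel_measurable (Pn I)"
    unfolding S_def by measurable
  define A where "A = {x \<in> space (Pn I). (C * (N * e\<^sup>2))\<^sup>2 \<le> (S x)\<^sup>2}"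
  have A: "A \<in> sets (Pn I)" unfolding A_def by measurable
  have pos: "0 < (C * (N * e\<^sup>2))\<^sup>2" using C N e by simp
  have "measure (Pn I) A \<le> (\<integral>x. (S x)\<^sup>2 \<partial>Pn I) / (C * (N * e\<^sup>2))\<^sup>2"
    unfolding A_def
    by (rule integral_Markov_inequality_measure[where A = "{}", OF _ _ _ pos])
      (use integrable_centered_sum_square[OF P0.prob_space_axioms I(1) U_int(1) U2_int U_int(2)] in \<open>auto simp: S_def\<close>)
  also have "(\<integral>x. (S x)\<^sup>2 \<partial>Pn I) = N * (\<integral>x. (U x)\<^sup>2 \<partial>P\<^sub>0)"
    unfolding S_def N_def by (rule integral_centered_sum_square[OF P0.prob_space_axioms I(1) U_int(1) U2_int U_int(2)])
  also have "N * (\<integral>x. (U x)\<^sup>2 \<partial>P\<^sub>0) / (C * (N * e\<^sup>2))\<^sup>2 \<le> N * e\<^sup>2 / (C * (N * e\<^sup>2))\<^sup>2"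
    using U2_le N by (intro divide_right_mono mult_left_mono) auto
  also have "\<dots> = 1 / (C\<^sup>2 * (N * e\<^sup>2))"
    using C N e by (simp add: power2_eq_square field_simps)
  finally have measure_A: "measure (Pn I) A \<le> 1 / (C\<^sup>2 * (N * e\<^sup>2))" .
  \<comment> \<open>Each \<open>G\<close> in the neighbourhood has its own null set where its
    density vanishes. Measurability in the pair swaps the quantifiers, giving one null set of
    observations outside which almost every \<open>G\<close> is fine.\<close>
  have good3: "AE x in P\<^sub>0. AE G in Q. 0 < p G x"
  proof (subst QP.AE_commute[symmetric])
    show "{z \<in> space (Q \<Otimes>\<^sub>M P\<^sub>0). 0 < p (fst z) (snd z)} \<in> sets (Q \<Otimes>\<^sub>M P\<^sub>0)"
    proof -
      have "{z \<in> space (Q \<Otimes>\<^sub>M P\<^sub>0). 0 < (case z of (G, x) \<Rightarrow> p G x)} \<in> sets (Q \<Otimes>\<^sub>M P\<^sub>0)"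
        by measurable
      then show ?thesis by (simp add: case_prod_beta')
    qed
    show "AE G in Q. AE x in P\<^sub>0. 0 < p G x"
      using Q_B by eventually_elim (rule KL(2))
  qed
  have "AE x in P\<^sub>0. integrable Q (\<lambda>G. l G x) \<and> (AE G in Q. 0 < p G x) \<and> 0 < p G\<^sub>0 x"
    using good1 good3 p0_positive by eventually_elim auto
  then have "AE x in Pn I. \<forall>i\<in>I. integrable Q (\<lambda>G. l G (x i)) \<and> (AE G in Q. 0 < p G (x i)) \<and> 0 < p G\<^sub>0 (x i)"
    using I(1) by (intro AE_finite_allI AE_PiM_component P0.prob_space_axioms)
  then have "AE x in Pn I. x \<notin> A \<longrightarrow>
      ennreal (b * exp (- ((1 + C) * (N * e\<^sup>2)))) \<le> (\<integral>\<^sup>+G. indicator B G * lik I G x \<partial>prior)"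
    using AE_space
  proof eventually_elim
    case (elim x)
    show ?case
    proof
      assume "x \<notin> A"
      then have "(S x)\<^sup>2 < (C * (N * e\<^sup>2))\<^sup>2" using elim by (auto simp: A_def)
      then have "\<bar>S x\<bar>\<^sup>2 < (C * (N * e\<^sup>2))\<^sup>2" by (simp only: power2_abs)
      moreover have "0 \<le> C * (N * e\<^sup>2)" using C N e by simp
      ultimately have "\<bar>S x\<bar> < C * (N * e\<^sup>2)" by (rule power2_less_imp_less)
      moreover define c where "c = (\<Sum>i\<in>I. Y (x i))"
      moreover have "S x = c - N * m"
        by (simp add: S_def U_def c_def N_def sum_subtractf)
      \<comment> \<open>The mean contributes at worst \<open>- N * e\<^sup>2\<close> and the
        fluctuation at worst \<open>- C * N * e\<^sup>2\<close>, whence the factor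
        \<open>1 + C\<close>.\<close>
      moreover have "N * - e\<^sup>2 \<le> N * m" using m N by (intro mult_left_mono) auto
      ultimately have c: "- ((1 + C) * (N * e\<^sup>2)) \<le> c"
        by (simp add: algebra_simps)
      note [measurable] = lik_measurable_prior[OF elim(2)]
      have s_int: "integrable Q (\<lambda>G. \<Sum>i\<in>I. l G (x i))"
        using elim(1) by auto
      have "c = (\<integral>G. (\<Sum>i\<in>I. l G (x i)) \<partial>Q)"
        unfolding c_def Y_def using elim(1) by (intro Bochner_Integration.integral_sum[symmetric]) auto
      then have "ennreal (exp c) \<le> (\<integral>\<^sup>+G. ennreal (exp (\<Sum>i\<in>I. l G (x i))) \<partial>Q)"
        using Q.exp_integral_le_nn_integral_exp[OF s_int] by simp
      also have "\<dots> = (\<integral>\<^sup>+G. lik I G x \<partial>Q)"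
      proof (rule nn_integral_cong_AE)
        have "AE G in Q. \<forall>i\<in>I. 0 < p G (x i)"
          using elim(1) I(1) by (intro AE_finite_allI) auto
        then show "AE G in Q. ennreal (exp (\<Sum>i\<in>I. l G (x i))) = lik I G x"
        proof eventually_elim
          fix G assume G: "\<forall>i\<in>I. 0 < p G (x i)"
          \<comment> \<open>Positivity of both densities matters here: \<open>ln\<close> takes a
            default value at 0, where its exponential would not be the ratio.\<close>
          have "exp (\<Sum>i\<in>I. l G (x i)) = (\<Prod>i\<in>I. p G (x i) / p G\<^sub>0 (x i))"
            unfolding exp_sum[OF I(1)] by (rule prod.cong) (use G elim(1) in auto)
          then show "ennreal (exp (\<Sum>i\<in>I. l G (x i))) = lik I G x"
            using G elim(1) by (simp add: r_def prod_ennreal less_imp_le)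
        qed
      qed
      also have "\<dots> = (\<integral>\<^sup>+G. ennreal (1 / b) * (indicator B G * lik I G x) \<partial>prior)"
        unfolding Q_def by (subst nn_integral_density) (auto simp: mult.assoc)
      also have "\<dots> = ennreal (1 / b) * (\<integral>\<^sup>+G. indicator B G * lik I G x \<partial>prior)"
        by (rule nn_integral_cmult) measurable
      finally have "ennreal b * ennreal (exp c)
          \<le> ennreal b * (ennreal (1 / b) * (\<integral>\<^sup>+G. indicator B G * lik I G x \<partial>prior))"
        by (rule mult_left_mono) simp
      also have "\<dots> = (\<integral>\<^sup>+G. indicator B G * lik I G x \<partial>prior)"
        using b by (simp add: mult.assoc[symmetric] ennreal_mult[symmetric])
      finally have "ennreal (b * exp c) \<le> (\<integral>\<^sup>+G. indicator B G * lik I G x \<partial>prior)"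
        using b by (simp add: ennreal_mult)
      moreover have "b * exp (- ((1 + C) * (N * e\<^sup>2))) \<le> b * exp c"
        using b c by simp
      ultimately show "ennreal (b * exp (- ((1 + C) * (N * e\<^sup>2)))) \<le> (\<integral>\<^sup>+G. indicator B G * lik I G x \<partial>prior)"
        by (meson ennreal_leI order.trans)
    qed
  qed
  then show ?thesis using A measure_A unfolding N_def b_def by blast
qed

end

section \<open>Union bound for the posterior\<close>

lemma sum_le_infsum_ennreal:
  fixes g :: "'a \<Rightarrow> ennreal"
  assumes "finite B" "B \<subseteq> A"
  shows "sum g B \<le> infsum g A"
  unfolding nonneg_infsum_complete[of A g, simplified] using assms by (intro SUP_upper) auto

lemma suminf_le_infsum_ennreal:
  fixes g :: "nat \<Rightarrow> ennreal"
  shows "(\<Sum>i. g (m + i)) \<le> infsum g {m..}"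
proof (rule suminf_le_const)
  show "summable (\<lambda>i. g (m + i))" by simp
  fix k
  have "(\<Sum>i<k. g (m + i)) = sum g ((+) m ` {..<k})"
    by (simp add: sum.reindex o_def)
  also have "\<dots> \<le> infsum g {m..}"
    by (rule sum_le_infsum_ennreal) auto
  finally show "(\<Sum>i<k. g (m + i)) \<le> infsum g {m..}" .
qed

lemma divide_left_mono_ennreal:
  fixes a b c :: ennreal
  assumes "a \<le> b"
  shows "c / b \<le> c / a"
proof -
  have "inverse b \<le> inverse a"
    using assms including ennreal.lifting by transfer (rule ereal_inverse_antimono)
  then show ?thesis
    unfolding divide_ennreal_def by (rule mult_left_mono) simp
qed

lemma divide_le_one_ennreal:
  fixes a b :: ennreal
  assumes "a \<le> b"
  shows "a / b \<le> 1"
proof (cases "b = 0 \<or> b = \<top>")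
  case False
  then have "a / b \<le> b / b" using assms by (intro divide_right_mono_ennreal)
  then show ?thesis using False by (simp add: less_top)
qed (use assms in auto)

text \<open>Ratios at most 1 may be replaced by their square roots in the union bound.\<close>

lemma ratio_le_sum_esqrt:
  fixes a :: "nat \<Rightarrow> 'a \<Rightarrow> ennreal"
  assumes u: "u \<le> b + (\<Sum>j. \<Sum>i\<in>F j. a j i)" and d: "d \<le> e" and a: "\<And>j i. a j i \<le> e"
  shows "u / e \<le> b / d + (\<Sum>j. \<Sum>i\<in>F j. esqrt (a j i / d))"
proof -
  have "u / e \<le> (b + (\<Sum>j. \<Sum>i\<in>F j. a j i)) / e"
    using u by (rule divide_right_mono_ennreal)
  also have "\<dots> = b / e + (\<Sum>j. \<Sum>i\<in>F j. a j i / e)"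
    by (simp add: divide_ennreal_def ring_distribs sum_distrib_right ennreal_suminf_multc[symmetric])
  also have "\<dots> \<le> b / d + (\<Sum>j. \<Sum>i\<in>F j. esqrt (a j i / d))"
  proof (intro add_mono suminf_le sum_mono divide_left_mono_ennreal[OF d])
    fix j i
    have "a j i / e \<le> esqrt (a j i / e)"
      by (intro esqrt_self_le divide_le_one_ennreal a)
    also have "\<dots> \<le> esqrt (a j i / d)"
      by (intro esqrt_mono divide_left_mono_ennreal d)
    finally show "a j i / e \<le> esqrt (a j i / d)" .
  qed auto
  finally show ?thesis .
qed

context mixture_bayes
begin

abbreviation ev :: "nat set \<Rightarrow> 't pmf set \<Rightarrow> (nat \<Rightarrow> 'x) \<Rightarrow> ennreal"
  where "ev I B x \<equiv> \<integral>\<^sup>+G. indicator B G * lik I G x \<partial>prior"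

lemma ev_measurable [measurable]:
  assumes [measurable]: "B \<in> sets prior"
  shows "ev I B \<in> borel_measurable (Pn I)"
proof -
  have "(\<lambda>z. indicator B (snd z) * (case z of (x, G) \<Rightarrow> lik I G x)) \<in> borel_measurable (Pn I \<Otimes>\<^sub>M prior)"
    by measurable
  then have "(\<lambda>(x, G). indicator B G * lik I G x) \<in> borel_measurable (Pn I \<Otimes>\<^sub>M prior)"
    by (simp add: case_prod_beta')
  then show ?thesis
    by (rule prior.borel_measurable_nn_integral[of "\<lambda>x G. indicator B G * lik I G x"])
qed

lemma ev_mono: "A \<subseteq> B \<Longrightarrow> ev I A x \<le> ev I B x"
  by (intro nn_integral_mono mult_right_mono) (auto simp: indicator_def)

lemma ev_cover:
  fixes A :: "nat \<Rightarrow> 'b \<Rightarrow> 't pmf set"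
  assumes x: "x \<in> space (Pn I)" and sets: "R \<in> sets prior" "\<And>j i. i \<in> F j \<Longrightarrow> A j i \<in> sets prior"
    and F: "\<And>j. finite (F j)" and U: "U \<subseteq> R \<union> (\<Union>j. \<Union>i\<in>F j. A j i)"
  shows "ev I U x \<le> ev I R x + (\<Sum>j. \<Sum>i\<in>F j. ev I (A j i) x)"
proof -
  note [measurable] = sets lik_measurable_prior[OF x]
  have ind: "indicator U G \<le> (indicator R G + (\<Sum>j. \<Sum>i\<in>F j. indicator (A j i) G) :: ennreal)" for G
  proof (cases "G \<in> U - R")
    case True
    with U obtain j i where ji: "i \<in> F j" "G \<in> A j i" by auto
    have "(1::ennreal) = indicator (A j i) G" using ji by simp
    also have "\<dots> \<le> (\<Sum>i\<in>F j. indicator (A j i) G)"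
      using ji F by (intro member_le_sum) auto
    also have "\<dots> \<le> (\<Sum>j. \<Sum>i\<in>F j. indicator (A j i) G)"
      using sum_le_suminf[of "\<lambda>j. \<Sum>i\<in>F j. indicator (A j i) G :: ennreal" "{j}"] by simp
    finally have "1 \<le> (\<Sum>j. \<Sum>i\<in>F j. indicator (A j i) G :: ennreal)" .
    then show ?thesis using True by (simp add: add_increasing)
  qed (auto simp: indicator_def add_increasing2)
  have "ev I U x \<le> (\<integral>\<^sup>+G. (indicator R G + (\<Sum>j. \<Sum>i\<in>F j. indicator (A j i) G)) * lik I G x \<partial>prior)"
    by (intro nn_integral_mono mult_right_mono ind) auto
  also have "\<dots> = (\<integral>\<^sup>+G. indicator R G * lik I G x + (\<Sum>j. \<Sum>i\<in>F j. indicator (A j i) G * lik I G x) \<partial>prior)"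
    by (simp add: ring_distribs sum_distrib_right ennreal_suminf_multc[symmetric])
  also have "\<dots> = ev I R x + (\<Sum>j. \<Sum>i\<in>F j. ev I (A j i) x)"
    by (subst nn_integral_add; (subst nn_integral_suminf)?; (subst nn_integral_sum)?) measurable
  finally show ?thesis .
qed

text \<open>Numerator and denominator share the likelihood of \<open>G\<^sub>0\<close> as a factor,
  and it cancels since it is neither 0 nor infinite at such sample points.\<close>

lemma posterior_eq:
  assumes x: "x \<in> space (Pn {1..n})" "\<And>i. i \<in> {1..n} \<Longrightarrow> 0 < p G\<^sub>0 (x i)" and [measurable]: "B \<in> sets prior"
  shows "posterior prior f n x B = ev {1..n} B x / ev {1..n} (space prior) x"
proof -
  define c where "c = (\<Prod>i\<in>{1..n}. ennreal (p G\<^sub>0 (x i)))"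
  have "c = ennreal (\<Prod>i\<in>{1..n}. p G\<^sub>0 (x i))"
    unfolding c_def using x(2) by (intro prod_ennreal) (auto intro: less_imp_le)
  moreover have "0 < (\<Prod>i\<in>{1..n}. p G\<^sub>0 (x i))"
    using x(2) by (intro prod_pos) auto
  ultimately obtain z where "c = ennreal z" "0 < z" by blast
  then have c: "c \<noteq> 0" "c \<noteq> \<infinity>"
    by auto
  note [measurable] = lik_measurable_prior[OF x(1)]
  have eq: "(\<Prod>i\<in>{1..n}. ennreal (p G (x i))) = lik {1..n} G x * c" if "G \<in> space prior" for G
    unfolding c_def prod.distrib[symmetric]
  proof (rule prod.cong)
    fix i assume i: "i \<in> {1..n}"
    then have "x i \<in> space \<mu>" using x(1) by (auto simp: space_PiM space_P0)
    then show "ennreal (p G (x i)) = r G (x i) * ennreal (p G\<^sub>0 (x i))"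
      using x(2)[OF i] mixture_density_nonneg[of G "x i"] that
      by (simp add: r_def space_prior ennreal_mult[symmetric])
  qed simp
  have num: "(\<integral>\<^sup>+G\<in>A. (\<Prod>i\<in>{1..n}. ennreal (p G (x i))) \<partial>prior) = ev {1..n} A x * c"
    if [measurable]: "A \<in> sets prior" for A
  proof -
    have "(\<integral>\<^sup>+G\<in>A. (\<Prod>i\<in>{1..n}. ennreal (p G (x i))) \<partial>prior) = (\<integral>\<^sup>+G. (indicator A G * lik {1..n} G x) * c \<partial>prior)"
      by (rule nn_integral_cong) (simp only: eq mult_ac)
    also have "\<dots> = ev {1..n} A x * c"
      by (rule nn_integral_multc) measurable
    finally show ?thesis .
  qed
  have "(\<integral>\<^sup>+G. (\<Prod>i\<in>{1..n}. ennreal (p G (x i))) \<partial>prior)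
      = (\<integral>\<^sup>+G\<in>space prior. (\<Prod>i\<in>{1..n}. ennreal (p G (x i))) \<partial>prior)"
    by (rule nn_integral_cong) simp
  also have "\<dots> = ev {1..n} (space prior) x * c"
    by (rule num) simp
  finally show ?thesis
    unfolding posterior_def num[OF assms(3)] using divide_mult_eq[OF c] by simp
qed

text \<open>The exceptional set joins two events: failure of the evidence bound, controlled by
  Chebyshev, and a large value of the dominating sum \<open>V\<close>, controlled by Markov at level
  \<open>\<delta>\<close>. The remainder \<open>R\<close> enters linearly, the separated pieces
  through square roots.\<close>

lemma posterior_union_bound:
  fixes A :: "nat \<Rightarrow> 't pmf \<Rightarrow> 't pmf set"
  assumes n: "n \<ge> 1" and K: "K \<in> sets prior" "K \<subseteq> KL e" "0 < prior.prob K" and e: "e > 0" and C: "C > 0"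
    and \<delta>: "\<delta> > 0"
    and sets: "U \<in> sets prior" "R \<in> sets prior" "\<And>j G. G \<in> F j \<Longrightarrow> A j G \<in> sets prior"
    and F: "\<And>j. finite (F j)" "\<And>j. F j \<subseteq> discrete_measures T"
    and U: "U \<subseteq> R \<union> (\<Union>j. \<Union>G\<in>F j. A j G)"
    and near: "\<And>j G G'. G \<in> F j \<Longrightarrow> G' \<in> A j G \<Longrightarrow> H G' G \<le> H G\<^sub>0 G / 4"
  defines "d \<equiv> ennreal (prior.prob K * exp (- ((1 + C) * (real n * e\<^sup>2))))"
  shows "\<exists>Z\<in>sets (Pn {1..n}).
    emeasure (Pn {1..n}) Z \<le> ennreal (1 / (C\<^sup>2 * (real n * e\<^sup>2))) + ennreal (1 / \<delta>) *
      (emeasure prior R / d + (\<Sum>j. \<Sum>G\<in>F j. ennreal (exp (- (real n * H G\<^sub>0 G / 4))) * esqrt (emeasure prior (A j G) / d))) \<and>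
    (AE x in Pn {1..n}. x \<notin> Z \<longrightarrow> posterior prior f n x U \<le> ennreal \<delta>)"
proof -
  let ?I = "{1..n}"
  note [measurable] = sets
  obtain Z1 where Z1: "Z1 \<in> sets (Pn ?I)" "measure (Pn ?I) Z1 \<le> 1 / (C\<^sup>2 * (real n * e\<^sup>2))"
    "AE x in Pn ?I. x \<notin> Z1 \<longrightarrow> d \<le> ev ?I K x"
    using evidence_lower_bound[of ?I, OF _ _ K e C] n unfolding d_def by auto
  define V where "V x = ev ?I R x / d + (\<Sum>j. \<Sum>G\<in>F j. esqrt (ev ?I (A j G) x / d))" for x
  have [measurable]: "V \<in> borel_measurable (Pn ?I)"
    unfolding V_def by measurable
  define Z2 where "Z2 = {x \<in> space (Pn ?I). 1 \<le> ennreal (1 / \<delta>) * V x}"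
  have Z2_sets [measurable]: "Z2 \<in> sets (Pn ?I)" unfolding Z2_def by measurable
  have "emeasure (Pn ?I) Z2 \<le> ennreal (1 / \<delta>) * (\<integral>\<^sup>+x. V x * indicator (space (Pn ?I)) x \<partial>Pn ?I)"
    unfolding Z2_def by (rule nn_integral_Markov_inequality) measurable
  also have "(\<integral>\<^sup>+x. V x * indicator (space (Pn ?I)) x \<partial>Pn ?I) = (\<integral>\<^sup>+x. V x \<partial>Pn ?I)"
    by (rule nn_integral_cong) simp
  also have "\<dots> = (\<integral>\<^sup>+x. ev ?I R x / d \<partial>Pn ?I) + (\<Sum>j. \<Sum>G\<in>F j. \<integral>\<^sup>+x. esqrt (ev ?I (A j G) x / d) \<partial>Pn ?I)"
  proof -
    have "(\<integral>\<^sup>+x. V x \<partial>Pn ?I) = (\<integral>\<^sup>+x. ev ?I R x / d \<partial>Pn ?I)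
        + (\<integral>\<^sup>+x. (\<Sum>j. \<Sum>G\<in>F j. esqrt (ev ?I (A j G) x / d)) \<partial>Pn ?I)"
      unfolding V_def by (rule nn_integral_add) measurable
    also have "(\<integral>\<^sup>+x. (\<Sum>j. \<Sum>G\<in>F j. esqrt (ev ?I (A j G) x / d)) \<partial>Pn ?I)
        = (\<Sum>j. \<integral>\<^sup>+x. (\<Sum>G\<in>F j. esqrt (ev ?I (A j G) x / d)) \<partial>Pn ?I)"
      by (rule nn_integral_suminf) measurable
    also have "\<dots> = (\<Sum>j. \<Sum>G\<in>F j. \<integral>\<^sup>+x. esqrt (ev ?I (A j G) x / d) \<partial>Pn ?I)"
      by (intro suminf_cong nn_integral_sum) measurable
    finally show ?thesis .
  qed
  also have "\<dots> \<le> emeasure prior R / d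
      + (\<Sum>j. \<Sum>G\<in>F j. ennreal (exp (- (real n * H G\<^sub>0 G / 4))) * esqrt (emeasure prior (A j G) / d))"
  proof (intro add_mono suminf_le sum_mono)
    have "(\<integral>\<^sup>+x. ev ?I R x / d \<partial>Pn ?I) = (\<integral>\<^sup>+x. ev ?I R x \<partial>Pn ?I) / d"
      by (rule nn_integral_divide) measurable
    also have "\<dots> \<le> emeasure prior R / d"
      by (intro divide_right_mono_ennreal evidence_integral_le) auto
    finally show "(\<integral>\<^sup>+x. ev ?I R x / d \<partial>Pn ?I) \<le> emeasure prior R / d" .
    fix j G assume G: "G \<in> F j"
    have GT: "G \<in> discrete_measures T" using F(2) G by auto
    have [measurable]: "A j G \<in> sets prior" using sets(3) G by auto
    have "(\<integral>\<^sup>+x. esqrt (ev ?I (A j G) x / d) \<partial>Pn ?I) = (\<integral>\<^sup>+x. esqrt (ev ?I (A j G) x) * esqrt (inverse d) \<partial>Pn ?I)"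
      by (simp add: divide_ennreal_def esqrt_mult)
    also have "\<dots> = (\<integral>\<^sup>+x. esqrt (ev ?I (A j G) x) \<partial>Pn ?I) * esqrt (inverse d)"
      by (rule nn_integral_multc) measurable
    also have "(\<integral>\<^sup>+x. esqrt (ev ?I (A j G) x) \<partial>Pn ?I)
        \<le> ennreal (exp (- (real (card ?I) * H G\<^sub>0 G / 4))) * esqrt (\<integral>\<^sup>+G'. indicator (A j G) G' \<partial>prior)"
      by (rule product_affinity[OF _ _ GT]) (use near[OF G] in \<open>auto simp: indicator_def\<close>)
    finally show "(\<integral>\<^sup>+x. esqrt (ev ?I (A j G) x / d) \<partial>Pn ?I)
        \<le> ennreal (exp (- (real n * H G\<^sub>0 G / 4))) * esqrt (emeasure prior (A j G) / d)"
      by (simp add: divide_ennreal_def esqrt_mult mult.assoc mult_right_mono)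
  qed auto
  finally have Z2: "emeasure (Pn ?I) Z2 \<le> ennreal (1 / \<delta>) * (emeasure prior R / d
      + (\<Sum>j. \<Sum>G\<in>F j. ennreal (exp (- (real n * H G\<^sub>0 G / 4))) * esqrt (emeasure prior (A j G) / d)))"
    by (simp add: mult_left_mono)
  have "AE x in Pn ?I. \<forall>i\<in>?I. 0 < p G\<^sub>0 (x i)"
    by (intro AE_finite_allI AE_PiM_component P0.prob_space_axioms p0_positive) auto
  then have "AE x in Pn ?I. x \<notin> Z1 \<union> Z2 \<longrightarrow> posterior prior f n x U \<le> ennreal \<delta>"
    using Z1(3) AE_space
  proof eventually_elim
    case (elim x)
    show ?case
    proof
      assume x: "x \<notin> Z1 \<union> Z2"
      have d: "d \<le> ev ?I (space prior) x"
        using elim(2) x by (auto intro: order.trans ev_mono[OF sets.sets_into_space[OF K(1)]])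
      have "posterior prior f n x U = ev ?I U x / ev ?I (space prior) x"
        by (rule posterior_eq) (use elim sets in auto)
      \<comment> \<open>The intersection with the space is needed because
        \<open>ratio_le_sum_esqrt\<close> asks for ratios at most 1 at every index, also for
        \<open>G\<close> outside \<open>F j\<close>, where nothing is known about
        \<open>A j G\<close>.\<close>
      also have "\<dots> \<le> ev ?I R x / d + (\<Sum>j. \<Sum>G\<in>F j. esqrt (ev ?I (A j G \<inter> space prior) x / d))"
        by (rule ratio_le_sum_esqrt[OF order.trans[OF ev_cover[OF elim(3) sets(2,3) F(1) U]] d ev_mono])
          (auto intro!: add_left_mono suminf_le sum_mono ev_mono dest: sets.sets_into_space[OF sets(3)])
      also have "\<dots> \<le> V x"
        unfolding V_def by (intro add_left_mono suminf_le sum_mono esqrt_mono divide_right_mono_ennreal ev_mono) auto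
      also have "V x \<le> ennreal \<delta>"
      proof -
        have "ennreal (1 / \<delta>) * V x \<le> 1" using x elim(3) by (auto simp: Z2_def)
        then have "ennreal \<delta> * (ennreal (1 / \<delta>) * V x) \<le> ennreal \<delta> * 1"
          by (rule mult_left_mono) simp
        then show ?thesis
          using \<delta> by (simp add: mult.assoc[symmetric] ennreal_mult[symmetric])
      qed
      finally show "posterior prior f n x U \<le> ennreal \<delta>" .
    qed
  qed
  moreover have "emeasure (Pn ?I) (Z1 \<union> Z2) \<le> ennreal (1 / (C\<^sup>2 * (real n * e\<^sup>2))) + ennreal (1 / \<delta>) *
      (emeasure prior R / d + (\<Sum>j. \<Sum>G\<in>F j. ennreal (exp (- (real n * H G\<^sub>0 G / 4))) * esqrt (emeasure prior (A j G) / d)))"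
    using Z1(1,2) Z2 Z2_sets
    by (intro order.trans[OF emeasure_subadditive] add_mono) (auto simp: Pn.emeasure_eq_measure intro!: ennreal_leI)
  ultimately show ?thesis using Z1(1) Z2_sets by (intro bexI[of _ "Z1 \<union> Z2"]) auto
qed

end

section \<open>Packings and covers\<close>

lemma packing_number_ge_one:
  assumes "G \<in> S"
  shows "1 \<le> packing_number r S"
proof -
  have "enat (card {G}) \<le> packing_number r S"
    unfolding packing_number_def by (rule SUP_upper) (use assms in auto)
  then show ?thesis by (simp add: one_enat_def)
qed

text \<open>A separated set of greatest cardinality is a cover, since an uncovered point could be
  added to it. The alternative \<open>G' = G\<close> matters when \<open>r\<close> is 0, as a point
  is then not within distance less than \<open>r\<close> of itself.\<close>

lemma finite_packing_cover:
  fixes S :: "'t::metric_space pmf set"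
  assumes N: "packing_number (ereal r) S = enat N"
  obtains F where "finite F" "F \<subseteq> S" "card F \<le> N" "\<And>G. G \<in> S \<Longrightarrow> \<exists>G'\<in>F. W2 G' G < r \<or> G' = G"
proof -
  define sep where "sep F \<longleftrightarrow> finite F \<and> F \<subseteq> S \<and> pairwise (\<lambda>G G'. ereal r \<le> ereal (W2 G G')) F" for F
  have bound: "card F \<le> N" if "sep F" for F
  proof -
    have "enat (card F) \<le> packing_number (ereal r) S"
      unfolding packing_number_def by (rule SUP_upper) (use that in \<open>auto simp: sep_def\<close>)
    then show ?thesis by (simp add: N)
  qed
  have "sep {}" by (simp add: sep_def)
  with ex_has_greatest_nat[of sep "{}" card "Suc N"] bound
  obtain F where F: "sep F" and greatest: "\<And>F'. sep F' \<Longrightarrow> card F' \<le> card F"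
    by (auto simp: less_Suc_eq_le)
  have "\<exists>G'\<in>F. W2 G' G < r \<or> G' = G" if G: "G \<in> S" for G
  proof (rule ccontr)
    assume far: "\<not> (\<exists>G'\<in>F. W2 G' G < r \<or> G' = G)"
    then have "sep (insert G F)"
      using F G by (auto simp: sep_def pairwise_insert not_less W2_commute[of G])
    moreover have "G \<notin> F" using far by auto
    ultimately show False
      using greatest[of "insert G F"] F by (simp add: sep_def)
  qed
  then show thesis using that[of F] F bound[OF F] by (auto simp: sep_def)
qed

text \<open>Both numbers are at least 1, so both logarithms are nonnegative. Hence no cancellation
  of infinities can occur, and the finite bound makes both numbers finite.\<close>

lemma log_enat_sum_le:
  assumes le: "log_enat a + s \<le> ereal c" and b: "log_enat b \<le> s" and one: "1 \<le> a" "1 \<le> b"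
  shows "\<exists>m k. a = enat m \<and> b = enat k \<and> real m * real k \<le> exp c"
proof -
  have nonneg: "0 \<le> log_enat z" if "1 \<le> z" for z
    using that by (cases z) (auto simp: log_enat_def one_enat_def)
  have sum: "log_enat a + log_enat b \<le> ereal c"
    using add_left_mono[OF b, of "log_enat a"] le by (rule order.trans)
  obtain m where m: "a = enat m" "m \<ge> 1"
    using sum one nonneg[OF one(2)] by (cases a) (auto simp: log_enat_def one_enat_def)
  obtain k where k: "b = enat k" "k \<ge> 1"
    using sum one nonneg[OF one(1)] by (cases b) (auto simp: log_enat_def one_enat_def)
  have "ln (real m) + ln (real k) \<le> c"
    using sum m k by (simp add: log_enat_def)
  then have "ln (real m * real k) \<le> c"
    using m k by (simp add: ln_mult)
  then have "exp (ln (real m * real k)) \<le> exp c" by simp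
  then show ?thesis using m k by auto
qed

lemma exp_ereal_ereal [simp]: "exp_ereal (ereal x) = ennreal (exp x)"
  by (simp add: exp_ereal_def)

context mixture_bayes
begin

abbreviation \<Psi> :: "'t pmf set \<Rightarrow> real \<Rightarrow> ereal"
  where "\<Psi> \<equiv> hellinger_information \<mu> f G\<^sub>0"

lemma hellinger_information_le:
  "G \<in> \<G> \<Longrightarrow> e / 2 \<le> W2 G\<^sub>0 G \<Longrightarrow> \<Psi> \<G> e \<le> ereal (H G\<^sub>0 G)"
  unfolding hellinger_information_def by (rule INF_lower) auto

lemma hellinger_information_nonneg: "0 \<le> \<Psi> \<G> e"
  unfolding hellinger_information_def by (intro INF_greatest) (auto simp: hellinger_sq_nonneg)

text \<open>In a space of diameter 0 every transport cost vanishes. Positivity keeps the power of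
  the diameter in the separation radius positive.\<close>

lemma diameter_pos:
  assumes "G \<in> discrete_measures T" "0 < W2 G\<^sub>0 G"
  shows "0 < diameter T"
proof (rule ccontr)
  assume "\<not> 0 < diameter T"
  then have D: "diameter T = 0" using diameter_ge_0[OF bounded_T] by simp
  obtain q where q: "q \<in> couplings G\<^sub>0 G" using couplings_nonempty by blast
  have "(\<integral>z. (dist (fst z) (snd z))\<^sup>2 \<partial>measure_pmf q) = (\<integral>z. 0 \<partial>measure_pmf q)"
  proof (rule integral_cong_AE)
    show "AE z in measure_pmf q. (dist (fst z) (snd z))\<^sup>2 = 0"
      using set_pmf_coupling[OF q G0 assms(1)] diameter_bounded_bound[OF bounded_T] D
      by (fastforce simp: AE_measure_pmf_iff)
  qed auto
  then have "coupling_cost q = 0" by (simp add: case_prod_beta')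
  then show False using W2_le_coupling[OF q] assms(2) by simp
qed

text \<open>A cover on two scales: \<open>e / 2\<close> for the shell, then \<open>\<delta>\<close>
  inside each \<open>e / 2\<close>-ball around a first-scale centre. The supremum over
  \<open>G\<^sub>1\<close> in the entropy bound controls the second scale uniformly, so the product
  of the two counts is at most \<open>exp a\<close>.\<close>

lemma shell_cover:
  assumes \<G>: "\<G> \<subseteq> discrete_measures T" and e: "e > 0" and C1: "C\<^sub>1 > 0" and \<alpha>: "\<alpha> \<ge> 1"
    and hellinger: "\<And>\<theta> \<theta>'. \<theta> \<in> T \<Longrightarrow> \<theta>' \<in> T \<Longrightarrow>
      hellinger_sq \<mu> (f \<theta>) (f \<theta>') \<le> C\<^sub>1 * dist \<theta> \<theta>' powr (2 * \<alpha>)"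
    and entropy:
      "log_enat (packing_number (ereal (e / 2)) (\<G> \<inter> W_ball T G\<^sub>0 (2 * e) - W_ball T G\<^sub>0 e))
        + (SUP G\<^sub>1\<in>\<G>. log_enat (local_packing \<mu> T f G\<^sub>0 C\<^sub>1 \<alpha> \<G> G\<^sub>1 e)) \<le> ereal a"
  shows "\<exists>F \<delta>. finite F \<and> F \<subseteq> discrete_measures T \<and> real (card F) \<le> exp a \<and>
    \<G> \<inter> W_ball T G\<^sub>0 (2 * e) - W_ball T G\<^sub>0 e \<subseteq> (\<Union>G\<in>F. W_ball T G \<delta>) \<and>
    (\<forall>G\<in>F. \<Psi> \<G> e \<le> ereal (H G\<^sub>0 G) \<and> (\<forall>G'\<in>W_ball T G \<delta>. H G' G \<le> H G\<^sub>0 G / 4))"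
proof (cases "\<G> \<inter> W_ball T G\<^sub>0 (2 * e) - W_ball T G\<^sub>0 e = {}")
  case True
  show ?thesis unfolding True by (intro exI[of _ "{}"]) simp
next
  case False
  define S where "S = \<G> \<inter> W_ball T G\<^sub>0 (2 * e) - W_ball T G\<^sub>0 e"
  have S: "G \<in> \<G>" "G \<in> discrete_measures T" "e < W2 G\<^sub>0 G" if "G \<in> S" for G
    using that by (auto simp: S_def W_ball_def not_le)
  obtain Gs where Gs: "Gs \<in> S" using False by (auto simp: S_def)
  have D: "diameter T > 0"
    using diameter_pos[OF S(2)[OF Gs]] S(3)[OF Gs] e by simp
  have "\<Psi> \<G> e \<le> ereal (H G\<^sub>0 Gs)"
    using S[OF Gs] e by (intro hellinger_information_le) auto
  then obtain \<psi> where \<psi>: "\<Psi> \<G> e = ereal \<psi>" "0 \<le> \<psi>"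
    using hellinger_information_nonneg[of \<G> e] by (cases "\<Psi> \<G> e") auto
  define D' where "D' = diameter T powr (\<alpha> - 1)"
  have D': "D' > 0" using D by (simp add: D'_def)
  \<comment> \<open>The separation used in \<open>local_packing\<close>. It solves C1 D'^2
    \<delta>^2 = \<psi> / 4, so the Lipschitz bound puts a \<delta>-ball inside the required
    Hellinger ball.\<close>
  define \<delta> where "\<delta> = sqrt \<psi> / (2 * D' * sqrt C\<^sub>1)"
  have \<delta>: "\<delta> \<ge> 0" using \<psi> D' C1 by (simp add: \<delta>_def)
  have local: "local_packing \<mu> T f G\<^sub>0 C\<^sub>1 \<alpha> \<G> G1 e = packing_number (ereal \<delta>) (\<G> \<inter> W_ball T G1 (e / 2))" for G1
    using D' C1 by (simp add: local_packing_def \<psi> sqrt_ereal_def \<delta>_def D'_def[symmetric])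
  have packings: "\<exists>m k. packing_number (ereal (e / 2)) S = enat m \<and>
      local_packing \<mu> T f G\<^sub>0 C\<^sub>1 \<alpha> \<G> G1 e = enat k \<and> real m * real k \<le> exp a" if G1: "G1 \<in> S" for G1
  proof (rule log_enat_sum_le[OF entropy[folded S_def]])
    show "log_enat (local_packing \<mu> T f G\<^sub>0 C\<^sub>1 \<alpha> \<G> G1 e)
        \<le> (SUP G\<^sub>1\<in>\<G>. log_enat (local_packing \<mu> T f G\<^sub>0 C\<^sub>1 \<alpha> \<G> G\<^sub>1 e))"
      by (rule SUP_upper) (use S G1 in auto)
    show "1 \<le> local_packing \<mu> T f G\<^sub>0 C\<^sub>1 \<alpha> \<G> G1 e"
      unfolding local by (rule packing_number_ge_one[of G1]) (use S[OF G1] e in \<open>auto simp: W_ball_def W2_self\<close>)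
  qed (rule packing_number_ge_one[OF G1])
  obtain m where m: "packing_number (ereal (e / 2)) S = enat m"
    using packings[OF Gs] by blast
  obtain F1 where F1: "finite F1" "F1 \<subseteq> S" "card F1 \<le> m"
    "\<And>G. G \<in> S \<Longrightarrow> \<exists>G'\<in>F1. W2 G' G < e / 2 \<or> G' = G"
    by (rule finite_packing_cover[OF m]) blast
  have "\<exists>F2. finite F2 \<and> F2 \<subseteq> \<G> \<inter> W_ball T G1 (e / 2) \<and> real m * real (card F2) \<le> exp a \<and>
      (\<forall>G\<in>\<G> \<inter> W_ball T G1 (e / 2). \<exists>G'\<in>F2. W2 G' G < \<delta> \<or> G' = G)" if G1: "G1 \<in> S" for G1
  proof -
    obtain k where k: "packing_number (ereal \<delta>) (\<G> \<inter> W_ball T G1 (e / 2)) = enat k" "real m * real k \<le> exp a"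
      using packings[OF G1] m by (auto simp: local)
    obtain F2 where F2: "finite F2" "F2 \<subseteq> \<G> \<inter> W_ball T G1 (e / 2)" "card F2 \<le> k"
      "\<And>G. G \<in> \<G> \<inter> W_ball T G1 (e / 2) \<Longrightarrow> \<exists>G'\<in>F2. W2 G' G < \<delta> \<or> G' = G"
      by (rule finite_packing_cover[OF k(1)]) blast
    have "real m * real (card F2) \<le> real m * real k"
      using F2(3) by (intro mult_left_mono) auto
    then show ?thesis using F2 k(2) by (intro exI[of _ F2]) auto
  qed
  then obtain F2 where F2: "\<And>G1. G1 \<in> S \<Longrightarrow> finite (F2 G1)"
    "\<And>G1. G1 \<in> S \<Longrightarrow> F2 G1 \<subseteq> \<G> \<inter> W_ball T G1 (e / 2)"
    "\<And>G1. G1 \<in> S \<Longrightarrow> real m * real (card (F2 G1)) \<le> exp a"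
    "\<And>G1 G. G1 \<in> S \<Longrightarrow> G \<in> \<G> \<inter> W_ball T G1 (e / 2) \<Longrightarrow> \<exists>G'\<in>F2 G1. W2 G' G < \<delta> \<or> G' = G"
    by metis
  define F where "F = (\<Union>G1\<in>F1. F2 G1)"
  have "finite F" unfolding F_def using F1 F2 by auto
  moreover have F_sub: "F \<subseteq> discrete_measures T" unfolding F_def using F1 F2 \<G> by blast
  moreover have "real (card F) \<le> exp a"
  proof -
    have "F1 \<noteq> {}" using F1(4)[OF Gs] by auto
    then have m_pos: "m > 0" using F1(1,3) by (metis card_gt_0_iff less_le_trans)
    have "card F \<le> (\<Sum>G1\<in>F1. card (F2 G1))"
      unfolding F_def by (rule card_UN_le) (rule F1)
    then have "real (card F) \<le> (\<Sum>G1\<in>F1. real (card (F2 G1)))"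
      by (metis of_nat_le_iff of_nat_sum)
    also have "\<dots> \<le> (\<Sum>G1\<in>F1. exp a / real m)"
      using F2(3) F1(2) m_pos by (intro sum_mono) (auto simp: field_simps)
    also have "\<dots> = real (card F1) * (exp a / real m)" by simp
    also have "\<dots> \<le> real m * (exp a / real m)"
      using F1(3) by (intro mult_right_mono) auto
    also have "\<dots> = exp a" using m_pos by simp
    finally show ?thesis .
  qed
  moreover have "S \<subseteq> (\<Union>G\<in>F. W_ball T G \<delta>)"
  proof
    fix G assume G: "G \<in> S"
    obtain G1 where G1: "G1 \<in> F1" "W2 G1 G < e / 2 \<or> G1 = G" using F1(4)[OF G] by auto
    then have "G \<in> \<G> \<inter> W_ball T G1 (e / 2)"
      using S[OF G] e by (auto simp: W_ball_def W2_self)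
    then obtain G2 where G2: "G2 \<in> F2 G1" "W2 G2 G < \<delta> \<or> G2 = G"
      using F2(4) G1(1) F1(2) by blast
    then have "G \<in> W_ball T G2 \<delta>"
      using S(2)[OF G] \<delta> by (auto simp: W_ball_def W2_self)
    then show "G \<in> (\<Union>G\<in>F. W_ball T G \<delta>)" using G1(1) G2(1) by (auto simp: F_def)
  qed
  moreover have "\<Psi> \<G> e \<le> ereal (H G\<^sub>0 G) \<and> (\<forall>G'\<in>W_ball T G \<delta>. H G' G \<le> H G\<^sub>0 G / 4)" if G: "G \<in> F" for G
  proof -
    obtain G1 where G1: "G1 \<in> S" "G \<in> \<G>" "W2 G1 G \<le> e / 2" "G \<in> discrete_measures T"
      using G F1(2) F2(2) by (fastforce simp: F_def W_ball_def)
    \<comment> \<open>A second-scale centre may leave the shell, but it is within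
      \<open>e / 2\<close> of a point farther than \<open>e\<close> from \<open>G\<^sub>0\<close>.
      It stays beyond \<open>e / 2\<close>, the threshold in the Hellinger information.\<close>
    have "e < W2 G\<^sub>0 G + W2 G1 G"
      using W2_triangle[OF bounded_T G0 G1(4) S(2)[OF G1(1)]] S(3)[OF G1(1)]
      by (simp add: W2_commute[of G1])
    then have info: "\<Psi> \<G> e \<le> ereal (H G\<^sub>0 G)"
      using G1 by (intro hellinger_information_le) auto
    have "H G' G \<le> H G\<^sub>0 G / 4" if G': "G' \<in> W_ball T G \<delta>" for G'
    proof -
      have "H G' G \<le> C\<^sub>1 * D'\<^sup>2 * (W2 G' G)\<^sup>2"
        unfolding D'_def
        by (rule hellinger_mixture_le_W2[OF _ G1(4) D C1 \<alpha> hellinger]) (use G' in \<open>auto simp: W_ball_def\<close>)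
      also have "\<dots> \<le> C\<^sub>1 * D'\<^sup>2 * \<delta>\<^sup>2"
        using G' C1 W2_nonneg by (intro mult_left_mono power_mono) (auto simp: W_ball_def W2_commute)
      also have "\<dots> = \<psi> / 4"
        using C1 D' \<psi> by (simp add: \<delta>_def power_divide power_mult_distrib)
      finally show ?thesis using info \<psi> by simp
    qed
    then show ?thesis using info by blast
  qed
  ultimately show ?thesis unfolding S_def[symmetric] by blast
qed

section \<open>Posterior contraction\<close>

text \<open>Each term has exponent at most - n \<psi> / 4 + n \<psi> / 32 + y / 2, where \<psi> / 32
  is half the exponent of the shell mass and y / 2 half that of the evidence. This is at most
  \<kappa> + a - n \<psi> / 16, and the number of pieces adds another a.\<close>

lemma shell_sum_le:
  fixes F :: "'t pmf set"
  assumes F: "finite F" "real (card F) \<le> exp a" "\<And>G. G \<in> F \<Longrightarrow> \<Psi> \<G> e \<le> ereal (H G\<^sub>0 G)"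
    and A: "\<And>G. G \<in> F \<Longrightarrow> A G \<subseteq> S" and S: "S \<in> sets prior"
    and b: "0 < b" and mass: "emeasure prior S / ennreal b \<le> exp_ereal (ereal (real n) * \<Psi> \<G> e / 16)"
    and y: "y \<le> 2 * a + \<kappa>" "0 \<le> \<kappa>"
  shows "(\<Sum>G\<in>F. ennreal (exp (- (real n * H G\<^sub>0 G / 4))) * esqrt (emeasure prior (A G) / ennreal (b * exp (- y))))
    \<le> ennreal (exp \<kappa> * exp (2 * a)) * exp_ereal (- (ereal (real n) * \<Psi> \<G> e / 16))"
proof (cases "F = {}")
  case False
  then obtain G where "G \<in> F" by blast
  from F(3)[OF this] obtain \<psi> where \<psi>: "\<Psi> \<G> e = ereal \<psi>" "0 \<le> \<psi>"
    using hellinger_information_nonneg[of \<G> e] by (cases "\<Psi> \<G> e") auto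
  define s where "s = prior.prob S"
  have "ennreal (s / b) \<le> ennreal (exp (real n * \<psi> / 16))"
    using mass b by (simp add: \<psi> s_def prior.emeasure_eq_measure divide_ennreal)
  then have s: "s / b \<le> exp (real n * \<psi> / 16)" by simp
  have term_le: "ennreal (exp (- (real n * H G\<^sub>0 G / 4))) * esqrt (emeasure prior (A G) / ennreal (b * exp (- y)))
      \<le> ennreal (exp (\<kappa> + a - real n * \<psi> / 16))" if G: "G \<in> F" for G
  proof -
    have "emeasure prior (A G) / ennreal (b * exp (- y)) \<le> emeasure prior S / ennreal (b * exp (- y))"
      by (intro divide_right_mono_ennreal emeasure_mono A G S)
    also have "\<dots> = ennreal (s / b * exp y)"
      using b by (simp add: s_def prior.emeasure_eq_measure divide_ennreal exp_minus field_simps)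
    also have "\<dots> \<le> ennreal (exp (real n * \<psi> / 16) * exp y)"
      by (intro ennreal_leI mult_right_mono s) simp
    finally have "esqrt (emeasure prior (A G) / ennreal (b * exp (- y))) \<le> esqrt (ennreal (exp (real n * \<psi> / 16) * exp y))"
      by (rule esqrt_mono)
    also have "\<dots> = ennreal (exp (real n * \<psi> / 32 + y / 2))"
    proof -
      have "sqrt (exp u) = exp (u / 2)" for u :: real
        by (rule real_sqrt_unique) (auto simp: power2_eq_square exp_add[symmetric])
      then show ?thesis by (simp add: esqrt_ennreal exp_add[symmetric] add_divide_distrib)
    qed
    finally have "ennreal (exp (- (real n * H G\<^sub>0 G / 4))) * esqrt (emeasure prior (A G) / ennreal (b * exp (- y)))
        \<le> ennreal (exp (- (real n * H G\<^sub>0 G / 4))) * ennreal (exp (real n * \<psi> / 32 + y / 2))"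
      by (rule mult_left_mono) simp
    also have "\<dots> = ennreal (exp (- (real n * H G\<^sub>0 G / 4) + (real n * \<psi> / 32 + y / 2)))"
      by (subst ennreal_mult[symmetric]) (simp_all only: exp_ge_zero exp_add[symmetric])
    also have "\<dots> \<le> ennreal (exp (\<kappa> + a - real n * \<psi> / 16))"
    proof -
      have "real n * \<psi> \<le> real n * H G\<^sub>0 G"
        using F(3)[OF G] by (intro mult_left_mono) (auto simp: \<psi>)
      moreover have "0 \<le> real n * \<psi>" using \<psi> by simp
      ultimately have "- (real n * H G\<^sub>0 G / 4) + (real n * \<psi> / 32 + y / 2) \<le> \<kappa> + a - real n * \<psi> / 16"
        using y by argo
      then show ?thesis by (intro ennreal_leI) simp
    qed
    finally show ?thesis .
  qed
  have "(\<Sum>G\<in>F. ennreal (exp (- (real n * H G\<^sub>0 G / 4))) * esqrt (emeasure prior (A G) / ennreal (b * exp (- y))))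
      \<le> (\<Sum>G\<in>F. ennreal (exp (\<kappa> + a - real n * \<psi> / 16)))"
    by (rule sum_mono) (rule term_le)
  also have "\<dots> = ennreal (real (card F)) * ennreal (exp (\<kappa> + a - real n * \<psi> / 16))"
    by (simp add: ennreal_of_nat_eq_real_of_nat)
  also have "\<dots> \<le> ennreal (exp a) * ennreal (exp (\<kappa> + a - real n * \<psi> / 16))"
    by (intro mult_right_mono ennreal_leI F) simp
  also have "\<dots> = ennreal (exp (a + (\<kappa> + a - real n * \<psi> / 16)))"
    by (simp only: ennreal_mult[symmetric] exp_ge_zero exp_add)
  also have "a + (\<kappa> + a - real n * \<psi> / 16) = (\<kappa> + 2 * a) + - (real n * \<psi> / 16)"
    by simp
  also have "ennreal (exp \<dots>) = ennreal (exp \<kappa> * exp (2 * a)) * exp_ereal (- (ereal (real n) * \<Psi> \<G> e / 16))"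
  proof -
    have "- (ereal (real n) * \<Psi> \<G> e / 16) = ereal (- (real n * \<psi> / 16))"
      by (simp add: \<psi>)
    then show ?thesis
      by (simp only: exp_ereal_ereal ennreal_mult[symmetric] exp_ge_zero exp_add mult_nonneg_nonneg)
  qed
  finally show ?thesis .
qed simp

text \<open>One sample size at a time, with all constants explicit: \<open>\<kappa>\<close> absorbs
  the excess of \<open>(1 + C) * (real n * e\<^sup>2)\<close> over twice
  \<open>real n * e\<^sup>2\<close>. The set \<open>R\<close> may exceed the complement of the
  sieve, so that a sphere can be put into it.\<close>

lemma contraction_step:
  assumes n: "n \<ge> 1" and M: "M \<ge> 1" and e: "e > 0"
    and C1: "C\<^sub>1 > 0" and \<alpha>: "\<alpha> \<ge> 1"
    and hellinger: "\<And>\<theta> \<theta>'. \<theta> \<in> T \<Longrightarrow> \<theta>' \<in> T \<Longrightarrow>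
      hellinger_sq \<mu> (f \<theta>) (f \<theta>') \<le> C\<^sub>1 * dist \<theta> \<theta>' powr (2 * \<alpha>)"
    and sets: "\<G> \<in> sets prior" "R \<in> sets prior" "U \<in> sets prior"
    and U: "U \<subseteq> R \<union> {G \<in> discrete_measures T. real M * e < W2 G\<^sub>0 G}" and R: "discrete_measures T - \<G> \<subseteq> R"
    and KL_pos: "0 < emeasure prior (KL e)"
    and entropy: "\<And>e'. e' \<ge> e \<Longrightarrow>
      log_enat (packing_number (ereal (e' / 2)) (\<G> \<inter> W_ball T G\<^sub>0 (2 * e') - W_ball T G\<^sub>0 e'))
        + (SUP G\<^sub>1\<in>\<G>. log_enat (local_packing \<mu> T f G\<^sub>0 C\<^sub>1 \<alpha> \<G> G\<^sub>1 e')) \<le> ereal (real n * e\<^sup>2)"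
    and shell_mass: "\<And>j. j \<ge> M \<Longrightarrow>
      emeasure prior (W_ball T G\<^sub>0 (2 * real j * e) - W_ball T G\<^sub>0 (real j * e)) / emeasure prior (KL e)
      \<le> exp_ereal (ereal (real n) * \<Psi> \<G> (real j * e) / 16)"
    and C: "C > 0" "(1 + C) * (real n * e\<^sup>2) \<le> 2 * (real n * e\<^sup>2) + \<kappa>" "0 \<le> \<kappa>" and \<delta>: "\<delta> > 0"
  shows "\<exists>Z\<in>sets (Pn {1..n}).
    emeasure (Pn {1..n}) Z \<le> ennreal (1 / (C\<^sup>2 * (real n * e\<^sup>2))) + ennreal (1 / \<delta>) *
      (ennreal (exp \<kappa> * exp (2 * (real n * e\<^sup>2))) * (emeasure prior R / emeasure prior (KL e)
        + (\<Sum>\<^sub>\<infinity>j\<in>{M..}. exp_ereal (- (ereal (real n) * \<Psi> \<G> (real j * e) / 16))))) \<and>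
    (AE x in Pn {1..n}. x \<notin> Z \<longrightarrow> posterior prior f n x U \<le> ennreal \<delta>)"
proof -
  define a where "a = real n * e\<^sup>2"
  define b where "b = prior.prob (KL e)"
  have KL: "KL e \<in> sets prior" using KL_pos by (metis emeasure_notin_sets less_irrefl)
  have b: "emeasure prior (KL e) = ennreal b" "b > 0"
    using KL_pos by (auto simp: b_def prior.emeasure_eq_measure)
  define S where "S j = W_ball T G\<^sub>0 (2 * real j * e) - W_ball T G\<^sub>0 (real j * e)" for j
  have ball_sets: "W_ball T G r \<in> sets prior" if "G \<in> discrete_measures T" for G r
    unfolding sets_prior by (rule W_ball_in_sets[OF bounded_T that])
  have S_sets: "S j \<in> sets prior" for j
    unfolding S_def by (intro sets.Diff ball_sets G0)
  have \<G>: "\<G> \<subseteq> discrete_measures T"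
    using sets.sets_into_space[OF sets(1)] by (simp add: space_prior)
  have "\<exists>F \<delta>. finite F \<and> F \<subseteq> discrete_measures T \<and> real (card F) \<le> exp a \<and>
      \<G> \<inter> S j \<subseteq> (\<Union>G\<in>F. W_ball T G \<delta>) \<and>
      (\<forall>G\<in>F. \<Psi> \<G> (real j * e) \<le> ereal (H G\<^sub>0 G) \<and> (\<forall>G'\<in>W_ball T G \<delta>. H G' G \<le> H G\<^sub>0 G / 4))"
    if j: "j \<ge> M" for j
  proof -
    \<comment> \<open>An index at least 1 puts the radius \<open>real j * e\<close> into the range
      of the entropy bound.\<close>
    have "1 * e \<le> real j * e" using j M e by (intro mult_right_mono) auto
    then have je: "e \<le> real j * e" by simp
    have "\<G> \<inter> S j = \<G> \<inter> W_ball T G\<^sub>0 (2 * (real j * e)) - W_ball T G\<^sub>0 (real j * e)"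
      by (auto simp: S_def mult.assoc)
    moreover have "0 < real j * e" using je e by simp
    ultimately show ?thesis
      using shell_cover[OF \<G> _ C1 \<alpha> hellinger entropy[OF je]] by (simp add: a_def)
  qed
  then have "\<forall>i. \<exists>F \<delta>. finite F \<and> F \<subseteq> discrete_measures T \<and> real (card F) \<le> exp a \<and>
      \<G> \<inter> S (M + i) \<subseteq> (\<Union>G\<in>F. W_ball T G \<delta>) \<and>
      (\<forall>G\<in>F. \<Psi> \<G> (real (M + i) * e) \<le> ereal (H G\<^sub>0 G) \<and> (\<forall>G'\<in>W_ball T G \<delta>. H G' G \<le> H G\<^sub>0 G / 4))"
    by (meson le_add1)
  then obtain F \<rho> where F: "\<And>i. finite (F i)" "\<And>i. F i \<subseteq> discrete_measures T" "\<And>i. real (card (F i)) \<le> exp a"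
    and cover: "\<And>i. \<G> \<inter> S (M + i) \<subseteq> (\<Union>G\<in>F i. W_ball T G (\<rho> i))"
    and info: "\<And>i G. G \<in> F i \<Longrightarrow> \<Psi> \<G> (real (M + i) * e) \<le> ereal (H G\<^sub>0 G)"
    and near: "\<And>i G G'. G \<in> F i \<Longrightarrow> G' \<in> W_ball T G (\<rho> i) \<Longrightarrow> H G' G \<le> H G\<^sub>0 G / 4"
    by metis
  define A where "A i G = \<G> \<inter> S (M + i) \<inter> W_ball T G (\<rho> i)" for i G
  have A_sets: "A i G \<in> sets prior" if "G \<in> F i" for i G
    unfolding A_def using F(2) that by (intro sets.Int sets(1) S_sets ball_sets) auto
  have U_cover: "U \<subseteq> R \<union> (\<Union>i. \<Union>G\<in>F i. A i G)"
  proof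
    fix G assume "G \<in> U"
    show "G \<in> R \<union> (\<Union>i. \<Union>G\<in>F i. A i G)"
    proof (cases "G \<in> R")
      case False
      then have G: "G \<in> discrete_measures T" "real M * e < W2 G\<^sub>0 G" "G \<in> \<G>"
        using \<open>G \<in> U\<close> U R by auto
      define w where "w = W2 G\<^sub>0 G / e"
      have w: "real M < w" using G(2) e by (simp add: w_def field_simps)
      \<comment> \<open>The largest integer strictly below \<open>w\<close>, as the inner radius of
        a shell is excluded. Then w \<le> j + 1 \<le> 2 j, the last step by j \<ge> 1.\<close>
      define j where "j = nat \<lceil>w\<rceil> - 1"
      have "int M < \<lceil>w\<rceil>" using w by (simp add: less_ceiling_iff)
      then have j: "M \<le> j" "real j = of_int \<lceil>w\<rceil> - 1"
        unfolding j_def by (auto simp: of_nat_diff)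
      have "real j < w" using j(2) by linarith
      moreover have "w \<le> real j + 1" using j(2) by linarith
      moreover have "1 \<le> real j" using j(1) M by simp
      ultimately have "real j < w" "w \<le> 2 * real j" by auto
      then have "real j * e < W2 G\<^sub>0 G" "W2 G\<^sub>0 G \<le> 2 * real j * e"
        using e by (auto simp: w_def field_simps)
      then have "G \<in> S j" using G by (auto simp: S_def W_ball_def)
      moreover obtain i where "j = M + i" using j(1) le_Suc_ex by blast
      ultimately show ?thesis using cover[of i] G(3) by (auto simp: A_def)
    qed simp
  qed
  let ?y = "(1 + C) * (real n * e\<^sup>2)"
  let ?d = "ennreal (b * exp (- ?y))"
  let ?K = "ennreal (exp \<kappa> * exp (2 * a))"
  let ?t = "\<lambda>j. exp_ereal (- (ereal (real n) * \<Psi> \<G> (real j * e) / 16))"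
  have KL_pos': "0 < prior.prob (KL e)" using b by (simp add: b_def)
  obtain Z where Z: "Z \<in> sets (Pn {1..n})"
    "emeasure (Pn {1..n}) Z \<le> ennreal (1 / (C\<^sup>2 * (real n * e\<^sup>2))) + ennreal (1 / \<delta>) *
      (emeasure prior R / ?d + (\<Sum>i. \<Sum>G\<in>F i. ennreal (exp (- (real n * H G\<^sub>0 G / 4))) * esqrt (emeasure prior (A i G) / ?d)))"
    "AE x in Pn {1..n}. x \<notin> Z \<longrightarrow> posterior prior f n x U \<le> ennreal \<delta>"
    using posterior_union_bound[OF n KL order.refl KL_pos' e C(1) \<delta> sets(3,2) A_sets F(1,2) U_cover, folded b_def]
      near by (auto simp: A_def)
  \<comment> \<open>No square root is taken for the remainder, so it pays the whole evidence factor
    \<open>exp ?y\<close> instead of its root.\<close>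
  have "emeasure prior R / ?d \<le> ?K * (emeasure prior R / ennreal b)"
  proof -
    have "prior.prob R / (b * exp (- z)) = exp z * (prior.prob R / b)" for z
      using b by (simp add: exp_minus field_simps)
    then have "prior.prob R / (b * exp (- ?y)) = exp ?y * (prior.prob R / b)" .
    also have "\<dots> \<le> exp (\<kappa> + 2 * a) * (prior.prob R / b)"
      using C(2) b by (intro mult_right_mono) (auto simp: a_def)
    also have "exp (\<kappa> + 2 * a) = exp \<kappa> * exp (2 * a)" by (rule exp_add)
    finally have "ennreal (prior.prob R / (b * exp (- ?y))) \<le> ennreal (exp \<kappa> * exp (2 * a) * (prior.prob R / b))"
      by (rule ennreal_leI)
    moreover have "emeasure prior R / ?d = ennreal (prior.prob R / (b * exp (- ?y)))"
      unfolding prior.emeasure_eq_measure by (rule divide_ennreal) (use b in auto)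
    moreover have "emeasure prior R / ennreal b = ennreal (prior.prob R / b)"
      unfolding prior.emeasure_eq_measure by (rule divide_ennreal) (use b in auto)
    moreover have "ennreal (exp \<kappa> * exp (2 * a) * (prior.prob R / b)) = ?K * ennreal (prior.prob R / b)"
      by (rule ennreal_mult) (use b in auto)
    ultimately show ?thesis by (simp only:)
  qed
  moreover have "(\<Sum>i. \<Sum>G\<in>F i. ennreal (exp (- (real n * H G\<^sub>0 G / 4))) * esqrt (emeasure prior (A i G) / ?d))
      \<le> (\<Sum>i. ?K * ?t (M + i))"
  proof (intro suminf_le allI)
    fix i
    show "(\<Sum>G\<in>F i. ennreal (exp (- (real n * H G\<^sub>0 G / 4))) * esqrt (emeasure prior (A i G) / ?d)) \<le> ?K * ?t (M + i)"
      by (rule shell_sum_le[OF F(1,3) info _ S_sets[of "M + i"] b(2)])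
        (use shell_mass[of "M + i"] b C in \<open>auto simp: A_def S_def a_def\<close>)
  qed auto
  moreover have "(\<Sum>i. ?K * ?t (M + i)) \<le> ?K * (\<Sum>\<^sub>\<infinity>j\<in>{M..}. ?t j)"
    unfolding ennreal_suminf_cmult by (intro mult_left_mono suminf_le_infsum_ennreal) simp
  ultimately have "emeasure prior R / ?d + (\<Sum>i. \<Sum>G\<in>F i. ennreal (exp (- (real n * H G\<^sub>0 G / 4))) * esqrt (emeasure prior (A i G) / ?d))
      \<le> ?K * (emeasure prior R / ennreal b + (\<Sum>\<^sub>\<infinity>j\<in>{M..}. ?t j))"
    unfolding distrib_left by (meson add_mono order.trans)
  then have "emeasure (Pn {1..n}) Z \<le> ennreal (1 / (C\<^sup>2 * (real n * e\<^sup>2))) + ennreal (1 / \<delta>) *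
      (?K * (emeasure prior R / ennreal b + (\<Sum>\<^sub>\<infinity>j\<in>{M..}. ?t j)))"
    by (intro order.trans[OF Z(2)] add_left_mono mult_left_mono) auto
  then show ?thesis using Z(1,3) b(1) unfolding a_def by auto
qed

section \<open>Passage to the given sample and to the limit\<close>

text \<open>The law of the first \<open>n\<close> observations is the product measure, and the
  posterior depends on these coordinates only. Monotonicity of the measure asks measurability of the
  larger set alone, which is the preimage of \<open>Z\<close>.\<close>

lemma sample_probability_le:
  assumes \<Omega>: "prob_space \<Omega>" and indep: "prob_space.indep_vars \<Omega> (\<lambda>_. \<mu>) X {1..}"
    and dist: "\<And>i. i \<ge> 1 \<Longrightarrow> distributed \<Omega> \<mu> (X i) (\<lambda>x. ennreal (p G\<^sub>0 x))"
    and n: "n \<ge> 1" and Z: "Z \<in> sets (Pn {1..n})" "emeasure (Pn {1..n}) Z \<le> ennreal c" "0 \<le> c"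
    and post: "AE x in Pn {1..n}. x \<notin> Z \<longrightarrow> posterior prior f n x U \<le> ennreal \<delta>"
  shows "measure \<Omega> {\<omega> \<in> space \<Omega>. ennreal \<delta> < posterior prior f n (\<lambda>i. X i \<omega>) U} \<le> c"
proof -
  interpret \<Omega>: prob_space \<Omega> by (rule \<Omega>)
  let ?I = "{1..n}"
  define XI where "XI \<omega> = (\<lambda>i\<in>?I. X i \<omega>)" for \<omega>
  have rv: "X i \<in> measurable \<Omega> \<mu>" "distr \<Omega> \<mu> (X i) = P\<^sub>0" if "i \<in> ?I" for i
    using dist[of i] that by (auto simp: distributed_def mixture_measure_def)
  have "\<Omega>.indep_vars (\<lambda>_. \<mu>) X ?I"
    by (rule \<Omega>.indep_vars_subset[OF indep]) auto
  then have "distr \<Omega> (Pi\<^sub>M ?I (\<lambda>_. \<mu>)) XI = Pi\<^sub>M ?I (\<lambda>i. distr \<Omega> \<mu> (X i))"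
    unfolding XI_def using n rv(1) by (subst (asm) \<Omega>.indep_vars_iff_distr_eq_PiM') auto
  also have "\<dots> = Pn ?I"
    by (rule PiM_cong) (use rv(2) in auto)
  finally have distr: "distr \<Omega> (Pi\<^sub>M ?I (\<lambda>_. \<mu>)) XI = Pn ?I" .
  have XI [measurable]: "XI \<in> measurable \<Omega> (Pi\<^sub>M ?I (\<lambda>_. \<mu>))"
    unfolding XI_def using rv(1) by (intro measurable_restrict) auto
  have Z': "Z \<in> sets (Pi\<^sub>M ?I (\<lambda>_. \<mu>))"
    using Z(1) sets_PiM_cong[OF refl, of ?I "\<lambda>_. P\<^sub>0" "\<lambda>_. \<mu>"] by (simp add: sets_P0)
  have same: "posterior prior f n (XI \<omega>) U = posterior prior f n (\<lambda>i. X i \<omega>) U" for \<omega>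
    by (simp add: posterior_def XI_def)
  have "AE \<omega> in \<Omega>. XI \<omega> \<notin> Z \<longrightarrow> posterior prior f n (XI \<omega>) U \<le> ennreal \<delta>"
    using post unfolding distr[symmetric] by (rule AE_distrD[OF XI])
  then have "AE \<omega> in \<Omega>. \<omega> \<in> {\<omega> \<in> space \<Omega>. ennreal \<delta> < posterior prior f n (\<lambda>i. X i \<omega>) U} \<longrightarrow> \<omega> \<in> XI -` Z \<inter> space \<Omega>"
    unfolding same by eventually_elim (auto simp: not_le[symmetric])
  then have "measure \<Omega> {\<omega> \<in> space \<Omega>. ennreal \<delta> < posterior prior f n (\<lambda>i. X i \<omega>) U} \<le> measure \<Omega> (XI -` Z \<inter> space \<Omega>)"
    by (rule \<Omega>.finite_measure_mono_AE) (rule measurable_sets[OF XI Z'])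
  also have "\<dots> = measure (Pn ?I) Z"
    unfolding distr[symmetric] by (rule measure_distr[OF XI Z', symmetric])
  also have "\<dots> \<le> c"
    using Z(2,3) by (simp add: Pn.emeasure_eq_measure)
  finally show ?thesis .
qed

text \<open>
  With \<open>M n = 0\<close> the summability condition would force \<open>\<Psi>(0) > 32 \<epsilon>\<^sub>n\<^sup>2\<close>, so that no element of the
  Kullback--Leibler neighbourhood could lie in the sieve, against the sieve mass condition.
\<close>

lemma zero_shell_impossible:
  assumes n: "n \<ge> 1" and KL: "KL e \<in> sets prior" "0 < prior.prob (KL e)" and e: "e > 0"
    and \<G>: "\<G> \<in> sets prior"
    and mass: "prior.prob (discrete_measures T - \<G>) / prior.prob (KL e) < 1"
    and sum: "ennreal (exp (2 * real n * e\<^sup>2)) * exp_ereal (- (ereal (real n) * \<Psi> \<G> 0 / 16)) < 1"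
  shows False
proof -
  have "KL e \<inter> \<G> \<noteq> {}"
  proof
    assume "KL e \<inter> \<G> = {}"
    then have "KL e \<subseteq> discrete_measures T - \<G>" using KL_D(1) by blast
    moreover have "discrete_measures T - \<G> \<in> sets prior"
      using \<G> by (auto simp: space_prior[symmetric])
    ultimately have "prior.prob (KL e) \<le> prior.prob (discrete_measures T - \<G>)"
      by (rule prior.finite_measure_mono)
    then show False using mass KL(2) by (simp add: field_simps)
  qed
  then obtain G where G: "G \<in> KL e" "G \<in> \<G>" by blast
  have "\<Psi> \<G> 0 \<le> ereal (H G\<^sub>0 G)"
    using G(2) W2_nonneg by (intro hellinger_information_le) auto
  also have "\<dots> \<le> ereal (e\<^sup>2 / 2)" using KL_hellinger_le[OF G(1)] by simp
  finally obtain \<psi> where \<psi>: "\<Psi> \<G> 0 = ereal \<psi>" "\<psi> \<le> e\<^sup>2 / 2"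
    using hellinger_information_nonneg[of \<G> 0] by (cases "\<Psi> \<G> 0") auto
  have "ennreal (exp (2 * real n * e\<^sup>2)) * exp_ereal (- (ereal (real n) * \<Psi> \<G> 0 / 16))
      = ennreal (exp (2 * real n * e\<^sup>2) * exp (- (real n * \<psi> / 16)))"
    by (simp add: \<psi> ennreal_mult)
  then have "exp (2 * real n * e\<^sup>2) * exp (- (real n * \<psi> / 16)) < 1"
    using sum by (simp add: ennreal_less_one_iff)
  then have "exp (2 * real n * e\<^sup>2 + - (real n * \<psi> / 16)) < 1"
    by (simp only: exp_add)
  then have "2 * (real n * e\<^sup>2) < real n * \<psi> / 16"
    by simp
  moreover have "real n * \<psi> \<le> real n * (e\<^sup>2 / 2)"
    using \<psi>(2) by (intro mult_left_mono) auto
  moreover have "0 < real n * e\<^sup>2" using n e by simp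
  ultimately show False by simp
qed

text \<open>The sets \<open>U n\<close> and \<open>R n\<close> are left free so that the open and
  the closed form of the conclusion both arise, according to whether the sphere is put into
  \<open>R n\<close>.\<close>

lemma contraction:
  fixes \<epsilon> :: "nat \<Rightarrow> real" and M :: "nat \<Rightarrow> nat"
  assumes \<Omega>: "prob_space \<Omega>" "prob_space.indep_vars \<Omega> (\<lambda>_. \<mu>) X {1..}"
      "\<And>i. i \<ge> 1 \<Longrightarrow> distributed \<Omega> \<mu> (X i) (\<lambda>x. ennreal (p G\<^sub>0 x))"
    and C1: "C\<^sub>1 > 0" and \<alpha>: "\<alpha> \<ge> 1"
    and hellinger: "\<And>\<theta> \<theta>'. \<theta> \<in> T \<Longrightarrow> \<theta>' \<in> T \<Longrightarrow>
      hellinger_sq \<mu> (f \<theta>) (f \<theta>') \<le> C\<^sub>1 * dist \<theta> \<theta>' powr (2 * \<alpha>)"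
    and sets: "\<And>n. n \<ge> 1 \<Longrightarrow> \<G> n \<in> sets prior" "\<And>n. n \<ge> 1 \<Longrightarrow> R n \<in> sets prior" "\<And>n. n \<ge> 1 \<Longrightarrow> U n \<in> sets prior"
    and eps: "\<And>n. n \<ge> 1 \<Longrightarrow> \<epsilon> n > 0"
    and KL_pos: "\<And>n. n \<ge> 1 \<Longrightarrow> emeasure prior (KL (\<epsilon> n)) > 0"
    and entropy: "\<And>n e. n \<ge> 1 \<Longrightarrow> e \<ge> \<epsilon> n \<Longrightarrow>
      log_enat (packing_number (ereal (e / 2)) (\<G> n \<inter> W_ball T G\<^sub>0 (2 * e) - W_ball T G\<^sub>0 e))
        + (SUP G\<^sub>1\<in>\<G> n. log_enat (local_packing \<mu> T f G\<^sub>0 C\<^sub>1 \<alpha> (\<G> n) G\<^sub>1 e))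
      \<le> ereal (real n * (\<epsilon> n)\<^sup>2)"
    and shell_mass: "\<And>n j. n \<ge> 1 \<Longrightarrow> j \<ge> M n \<Longrightarrow>
      emeasure prior (W_ball T G\<^sub>0 (2 * real j * \<epsilon> n) - W_ball T G\<^sub>0 (real j * \<epsilon> n)) / emeasure prior (KL (\<epsilon> n))
      \<le> exp_ereal (ereal (real n) * \<Psi> (\<G> n) (real j * \<epsilon> n) / 16)"
    and sum_cond: "(\<lambda>n. ennreal (exp (2 * real n * (\<epsilon> n)\<^sup>2)) *
        (\<Sum>\<^sub>\<infinity>j\<in>{M n..}. exp_ereal (- (ereal (real n) * \<Psi> (\<G> n) (real j * \<epsilon> n) / 16)))) \<longlonglongrightarrow> 0"
    and U: "\<And>n. n \<ge> 1 \<Longrightarrow> U n \<subseteq> R n \<union> {G \<in> discrete_measures T. real (M n) * \<epsilon> n < W2 G\<^sub>0 G}"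
    and R: "\<And>n. n \<ge> 1 \<Longrightarrow> discrete_measures T - \<G> n \<subseteq> R n"
    and R_mass: "(\<lambda>n. measure prior (R n) / measure prior (KL (\<epsilon> n))) \<in> o(\<lambda>n. exp (- 2 * real n * (\<epsilon> n)\<^sup>2))"
  shows "vanishes_in_probability \<Omega> (\<lambda>n \<omega>. posterior prior f n (\<lambda>i. X i \<omega>) (U n))"
  unfolding vanishes_in_probability_def
proof (intro allI impI)
  fix \<delta> :: real assume \<delta>: "\<delta> > 0"
  define tail where "tail n = (\<Sum>\<^sub>\<infinity>j\<in>{M n..}. exp_ereal (- (ereal (real n) * \<Psi> (\<G> n) (real j * \<epsilon> n) / 16)))" for n
  have KL: "KL (\<epsilon> n) \<in> sets prior" "0 < prior.prob (KL (\<epsilon> n))" if "n \<ge> 1" for n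
    using KL_pos[OF that] emeasure_notin_sets[of "KL (\<epsilon> n)" prior]
    by (auto simp: prior.emeasure_eq_measure)
  have R_small: "eventually (\<lambda>n. measure prior (R n) / measure prior (KL (\<epsilon> n)) \<le> c * exp (- 2 * real n * (\<epsilon> n)\<^sup>2)) sequentially"
    if "c > 0" for c
    using landau_o.smallD[OF R_mass that] by eventually_elim simp
  have tail_small: "eventually (\<lambda>n. ennreal (exp (2 * real n * (\<epsilon> n)\<^sup>2)) * tail n < ennreal c) sequentially"
    if "c > 0" for c
    using order_tendstoD(2)[OF sum_cond, of "ennreal c"] that by (simp add: tail_def)
  \<comment> \<open>Indices at least 1 are needed to apply the entropy bound and to cover by
    doubling shells. If \<open>M n\<close> were 0, the tail would contain the term of index 0, which
    is too large.\<close>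
  have M_pos: "eventually (\<lambda>n. M n \<ge> 1) sequentially"
    using R_small[OF half_gt_zero[OF zero_less_one]] tail_small[OF zero_less_one]
      eventually_ge_at_top[of 1]
  proof eventually_elim
    case (elim n)
    note n = elim(3)
    show ?case
    proof (rule ccontr)
      assume "\<not> 1 \<le> M n"
      then have M: "M n = 0" by simp
      have "prior.prob (discrete_measures T - \<G> n) \<le> prior.prob (R n)"
        by (rule prior.finite_measure_mono[OF R[OF n] sets(2)[OF n]])
      then have "prior.prob (discrete_measures T - \<G> n) / prior.prob (KL (\<epsilon> n)) \<le> prior.prob (R n) / prior.prob (KL (\<epsilon> n))"
        by (rule divide_right_mono) simp
      also have "\<dots> \<le> exp (- (2 * real n * (\<epsilon> n)\<^sup>2)) / 2" using elim by simp
      also have "\<dots> < 1"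
      proof -
        have "exp (- (2 * real n * (\<epsilon> n)\<^sup>2)) \<le> 1" by simp
        then show ?thesis by linarith
      qed
      finally have mass: "prior.prob (discrete_measures T - \<G> n) / prior.prob (KL (\<epsilon> n)) < 1" .
      have "exp_ereal (- (ereal (real n) * \<Psi> (\<G> n) 0 / 16)) \<le> tail n"
        using sum_le_infsum_ennreal[of "{0}" "{M n..}" "\<lambda>j. exp_ereal (- (ereal (real n) * \<Psi> (\<G> n) (real j * \<epsilon> n) / 16))"]
        by (simp add: tail_def M)
      then have "ennreal (exp (2 * real n * (\<epsilon> n)\<^sup>2)) * exp_ereal (- (ereal (real n) * \<Psi> (\<G> n) 0 / 16))
          \<le> ennreal (exp (2 * real n * (\<epsilon> n)\<^sup>2)) * tail n"
        by (rule mult_left_mono) simp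
      also have "\<dots> < 1" using elim by simp
      finally show False
        using zero_shell_impossible[OF n KL[OF n] eps[OF n] sets(1)[OF n] mass] by simp
    qed
  qed
  show "(\<lambda>n. measure \<Omega> {\<omega> \<in> space \<Omega>. ennreal \<delta> < posterior prior f n (\<lambda>i. X i \<omega>) (U n)}) \<longlonglongrightarrow> 0"
  proof (rule order_tendstoI)
    fix z :: real assume "z < 0"
    then show "eventually (\<lambda>n. z < measure \<Omega> {\<omega> \<in> space \<Omega>. ennreal \<delta> < posterior prior f n (\<lambda>i. X i \<omega>) (U n)}) sequentially"
      by (intro always_eventually) (auto intro: less_le_trans)
  next
    fix z :: real assume z: "0 < z"
    \<comment> \<open>Chebyshev's bound, the remainder and the tail contribute at most
      \<open>\<eta>\<close> each, so the total \<open>3 * \<eta>\<close> is below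
      \<open>z\<close>.\<close>
    define \<eta> where "\<eta> = z / 4"
    have \<eta>: "\<eta> > 0" using z by (simp add: \<eta>_def)
    define \<kappa> where "\<kappa> = 1 / \<eta>"
    have \<kappa>: "\<kappa> \<ge> 0" using \<eta> by (simp add: \<kappa>_def)
    \<comment> \<open>Offsets the factor 1/\<delta> of Markov's inequality and the constant
      exp(\<kappa>) of the evidence bound.\<close>
    define c where "c = \<eta> * \<delta> / exp \<kappa>"
    have c: "c > 0" using \<eta> \<delta> by (simp add: c_def)
    show "eventually (\<lambda>n. measure \<Omega> {\<omega> \<in> space \<Omega>. ennreal \<delta> < posterior prior f n (\<lambda>i. X i \<omega>) (U n)} < z) sequentially"
      using R_small[OF c] tail_small[OF c] M_pos eventually_ge_at_top[of 1]
    proof eventually_elim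
      case (elim n)
      note n = elim(4)
      define a where "a = real n * (\<epsilon> n)\<^sup>2"
      have a: "a > 0" using n eps[OF n] by (simp add: a_def)
      \<comment> \<open>Large enough for Chebyshev's bound 1/(C^2 a) to be at most
        \<open>\<eta>\<close>, yet cheap: either C = 1, or a < 1/\<eta> and then C a = sqrt(\<eta>
        a)/\<eta> \<le> \<kappa>.\<close>
      define C where "C = max 1 (1 / sqrt (\<eta> * a))"
      have C: "C > 0" by (simp add: C_def)
      have C_upper: "(1 + C) * a \<le> 2 * a + \<kappa>"
      proof (cases "1 / sqrt (\<eta> * a) \<le> 1")
        case True
        then show ?thesis using \<kappa> by (simp add: C_def max_def)
      next
        case False
        then have "sqrt (\<eta> * a) < 1" using \<eta> a by (simp add: field_simps)
        then have "\<eta> * a < 1" by simp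
        have "C * a = (1 / sqrt (\<eta> * a)) * a" using False by (simp add: C_def)
        also have "\<dots> = sqrt (\<eta> * a) / \<eta>"
        proof -
          have "s * s = \<eta> * a \<Longrightarrow> 0 < s \<Longrightarrow> (1 / s) * a = s / \<eta>" for s
            using \<eta> by (simp add: field_simps)
          then show ?thesis using \<eta> a by simp
        qed
        also have "\<dots> \<le> \<kappa>"
          unfolding \<kappa>_def using \<open>sqrt (\<eta> * a) < 1\<close> \<eta> by (intro divide_right_mono) auto
        finally show ?thesis using a by (simp add: distrib_right)
      qed
      have C_lower: "1 / (C\<^sup>2 * a) \<le> \<eta>"
      proof -
        have "(1 / sqrt (\<eta> * a))\<^sup>2 \<le> C\<^sup>2"
          using \<eta> a by (intro power_mono) (auto simp: C_def)
        then have "1 / (\<eta> * a) \<le> C\<^sup>2" using \<eta> a by (simp add: power_divide)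
        then show ?thesis using \<eta> a C by (simp add: field_simps)
      qed
      obtain Z where Z: "Z \<in> sets (Pn {1..n})"
        "emeasure (Pn {1..n}) Z \<le> ennreal (1 / (C\<^sup>2 * a)) + ennreal (1 / \<delta>) *
          (ennreal (exp \<kappa> * exp (2 * a)) * (emeasure prior (R n) / emeasure prior (KL (\<epsilon> n)) + tail n))"
        "AE x in Pn {1..n}. x \<notin> Z \<longrightarrow> posterior prior f n x (U n) \<le> ennreal \<delta>"
        using contraction_step[OF n elim(3) eps[OF n] C1 \<alpha> hellinger sets(1)[OF n] sets(2)[OF n] sets(3)[OF n]
            U[OF n] R[OF n] KL_pos[OF n] entropy[OF n] shell_mass[OF n] C _ \<kappa> \<delta>] C_upper
        unfolding a_def tail_def by blast
      have two_a: "2 * real n * (\<epsilon> n)\<^sup>2 = 2 * a" by (simp add: a_def)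
      have tail_le: "ennreal (exp \<kappa> * exp (2 * a)) * tail n \<le> ennreal (\<eta> * \<delta>)"
      proof -
        have "ennreal (exp \<kappa> * exp (2 * a)) * tail n = ennreal (exp \<kappa>) * (ennreal (exp (2 * a)) * tail n)"
          by (simp add: ennreal_mult mult.assoc)
        also have "\<dots> \<le> ennreal (exp \<kappa>) * ennreal c"
          using elim(2) unfolding two_a by (intro mult_left_mono) auto
        also have "\<dots> = ennreal (\<eta> * \<delta>)"
          using \<eta> \<delta> by (simp add: c_def ennreal_mult[symmetric])
        finally show ?thesis .
      qed
      have R_le: "ennreal (exp \<kappa> * exp (2 * a)) * (emeasure prior (R n) / emeasure prior (KL (\<epsilon> n))) \<le> ennreal (\<eta> * \<delta>)"
      proof -
        define q where "q = prior.prob (R n) / prior.prob (KL (\<epsilon> n))"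
        have q: "q \<le> c * exp (- (2 * a))" "0 \<le> q"
          using elim(1) by (auto simp: q_def a_def mult.assoc)
        have "exp \<kappa> * exp (2 * a) * q \<le> exp \<kappa> * exp (2 * a) * (c * exp (- (2 * a)))"
          by (rule mult_left_mono[OF q(1)]) simp
        also have "\<dots> = \<eta> * \<delta>" by (simp add: c_def exp_minus)
        finally have "ennreal (exp \<kappa> * exp (2 * a) * q) \<le> ennreal (\<eta> * \<delta>)" by (rule ennreal_leI)
        moreover have "emeasure prior (R n) / emeasure prior (KL (\<epsilon> n)) = ennreal q"
          unfolding prior.emeasure_eq_measure q_def by (rule divide_ennreal) (use KL(2)[OF n] in auto)
        ultimately show ?thesis using q(2) by (simp add: ennreal_mult)
      qed
      have "emeasure (Pn {1..n}) Z \<le> ennreal \<eta> + ennreal (1 / \<delta>) * (ennreal (\<eta> * \<delta>) + ennreal (\<eta> * \<delta>))"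
        unfolding distrib_left[of "ennreal (exp \<kappa> * exp (2 * a))"]
        by (intro order.trans[OF Z(2)[unfolded distrib_left[of "ennreal (exp \<kappa> * exp (2 * a))"]]]
            add_mono mult_left_mono ennreal_leI C_lower R_le tail_le) simp
      also have "\<dots> = ennreal (3 * \<eta>)"
      proof -
        have "ennreal (1 / \<delta>) * (ennreal (\<eta> * \<delta>) + ennreal (\<eta> * \<delta>)) = ennreal (2 * \<eta>)"
          using \<eta> \<delta> by (simp add: ennreal_plus[symmetric] ennreal_mult[symmetric] del: ennreal_plus)
        then show ?thesis using \<eta> by (simp add: ennreal_plus[symmetric] del: ennreal_plus)
      qed
      finally have Z_le: "emeasure (Pn {1..n}) Z \<le> ennreal (3 * \<eta>)" .
      have "measure \<Omega> {\<omega> \<in> space \<Omega>. ennreal \<delta> < posterior prior f n (\<lambda>i. X i \<omega>) (U n)} \<le> 3 * \<eta>"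
        by (rule sample_probability_le[OF \<Omega>(1,2) _ n Z(1) Z_le _ Z(3)]) (use \<Omega>(3) \<eta> in auto)
      then show ?case using z by (simp add: \<eta>_def)
    qed
  qed
qed

end

text \<open>The shells of index at least \<open>M n\<close> \<ge> 1 together cover exactly the
  region beyond radius \<open>M n * \<epsilon> n\<close>, without the sphere itself. This gives the
  open form of the conclusion; the closed form follows when the prior mass of the sphere satisfies
  the same little-o condition as the complement of the sieve.\<close>

theorem theorem4:
  fixes T :: "'t::metric_space set"
    and \<mu> :: "'x measure"
    and f :: "'t \<Rightarrow> 'x \<Rightarrow> real"
    and prior :: "'t pmf measure"
    and G\<^sub>0 :: "'t pmf"
    and \<Omega> :: "'w measure"
    and X :: "nat \<Rightarrow> 'w \<Rightarrow> 'x"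
    and C\<^sub>1 \<alpha> :: real
    and \<G> :: "nat \<Rightarrow> 't pmf set"
    and \<epsilon> :: "nat \<Rightarrow> real"
    and M :: "nat \<Rightarrow> nat"
  defines "\<Psi> \<equiv> \<lambda>n. hellinger_information \<mu> f G\<^sub>0 (\<G> n)"
    and "B\<^sub>K \<equiv> KL_neighbourhood \<mu> T f G\<^sub>0"
  assumes T: "totally_bounded T" "bounded T"
    and f: "density_family \<mu> T f"
    and prior: "prob_space prior" "sets prior = sets (W2_borel T)"
    and G0: "G\<^sub>0 \<in> discrete_measures T"
    and sample: "prob_space \<Omega>"
      "prob_space.indep_vars \<Omega> (\<lambda>_. \<mu>) X {1..}"
      "\<And>i. i \<ge> 1 \<Longrightarrow> distributed \<Omega> \<mu> (X i) (\<lambda>x. ennreal (mixture_density f G\<^sub>0 x))"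
    and ident: "finitely_identifiable \<mu> T f"
    and C1: "C\<^sub>1 > 0" and alpha: "\<alpha> \<ge> 1"
    and hellinger: "\<And>\<theta> \<theta>'. \<theta> \<in> T \<Longrightarrow> \<theta>' \<in> T \<Longrightarrow>
      hellinger_sq \<mu> (f \<theta>) (f \<theta>') \<le> C\<^sub>1 * dist \<theta> \<theta>' powr (2 * \<alpha>)"
    and sieve: "\<And>n. n \<ge> 1 \<Longrightarrow> \<G> n \<in> sets prior"
    and eps: "\<And>n. n \<ge> 1 \<Longrightarrow> \<epsilon> n > 0" "\<epsilon> \<longlonglongrightarrow> 0"
      "(\<exists>c>0. \<forall>n\<ge>1. c \<le> real n * (\<epsilon> n)\<^sup>2) \<or>
       filterlim (\<lambda>n. real n * (\<epsilon> n)\<^sup>2) at_top sequentially"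
    and KL_pos: "\<And>n. n \<ge> 1 \<Longrightarrow> emeasure prior (B\<^sub>K (\<epsilon> n)) > 0"
    and entropy: "\<And>n e. n \<ge> 1 \<Longrightarrow> e \<ge> \<epsilon> n \<Longrightarrow>
      log_enat (packing_number (ereal (e / 2)) (\<G> n \<inter> W_ball T G\<^sub>0 (2 * e) - W_ball T G\<^sub>0 e))
        + (SUP G\<^sub>1\<in>\<G> n. log_enat (local_packing \<mu> T f G\<^sub>0 C\<^sub>1 \<alpha> (\<G> n) G\<^sub>1 e))
      \<le> ereal (real n * (\<epsilon> n)\<^sup>2)"
    and sieve_mass:
      "(\<lambda>n. measure prior (discrete_measures T - \<G> n) / measure prior (B\<^sub>K (\<epsilon> n)))
         \<in> o(\<lambda>n. exp (- 2 * real n * (\<epsilon> n)\<^sup>2))"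
    and shell_mass: "\<And>n j. n \<ge> 1 \<Longrightarrow> j \<ge> M n \<Longrightarrow>
      emeasure prior (W_ball T G\<^sub>0 (2 * real j * \<epsilon> n) - W_ball T G\<^sub>0 (real j * \<epsilon> n))
        / emeasure prior (B\<^sub>K (\<epsilon> n))
      \<le> exp_ereal (ereal (real n) * \<Psi> n (real j * \<epsilon> n) / 16)"
    and sum_cond: "(\<lambda>n. ennreal (exp (2 * real n * (\<epsilon> n)\<^sup>2)) *
        (\<Sum>\<^sub>\<infinity>j\<in>{M n..}. exp_ereal (- (ereal (real n) * \<Psi> n (real j * \<epsilon> n) / 16))))
      \<longlonglongrightarrow> 0"
  shows "vanishes_in_probability \<Omega> (\<lambda>n \<omega>. posterior prior f n (\<lambda>i. X i \<omega>)
           {G \<in> discrete_measures T. real (M n) * \<epsilon> n < W2 G\<^sub>0 G})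
    \<and> ((\<lambda>n. measure prior {G \<in> discrete_measures T. W2 G\<^sub>0 G = real (M n) * \<epsilon> n}
              / measure prior (B\<^sub>K (\<epsilon> n)))
          \<in> o(\<lambda>n. exp (- 2 * real n * (\<epsilon> n)\<^sup>2)) \<longrightarrow>
        vanishes_in_probability \<Omega> (\<lambda>n \<omega>. posterior prior f n (\<lambda>i. X i \<omega>)
           {G \<in> discrete_measures T. real (M n) * \<epsilon> n \<le> W2 G\<^sub>0 G}))"
proof -
  interpret bayes: mixture_bayes T \<mu> f prior G\<^sub>0
    unfolding mixture_bayes_def mixture_family_def mixture_bayes_axioms_def
    using T f prior G0 by auto
  note sp = bayes.space_prior
  have W2_meas [measurable]: "W2 G\<^sub>0 \<in> borel_measurable prior"
    using borel_measurable_W2[OF T(2) G0] by (simp add: prior(2) cong: measurable_cong_sets)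
  have compl: "discrete_measures T - \<G> n \<in> sets prior" if "n \<ge> 1" for n
    unfolding sp[symmetric] using sieve[OF that] by auto
  have level_sets: "{G \<in> discrete_measures T. real (M n) * \<epsilon> n < W2 G\<^sub>0 G} \<in> sets prior"
    "{G \<in> discrete_measures T. real (M n) * \<epsilon> n \<le> W2 G\<^sub>0 G} \<in> sets prior"
    "{G \<in> discrete_measures T. W2 G\<^sub>0 G = real (M n) * \<epsilon> n} \<in> sets prior" for n
    unfolding sp[symmetric] by measurable
  note common = sample(1,2) sample(3) C1 alpha hellinger sieve
  show ?thesis
  proof (intro conjI impI)
    show "vanishes_in_probability \<Omega> (\<lambda>n \<omega>. posterior prior f n (\<lambda>i. X i \<omega>)
        {G \<in> discrete_measures T. real (M n) * \<epsilon> n < W2 G\<^sub>0 G})"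
      by (rule bayes.contraction[OF common compl level_sets(1) eps(1) KL_pos[unfolded B\<^sub>K_def] entropy
            shell_mass[unfolded \<Psi>_def B\<^sub>K_def] sum_cond[unfolded \<Psi>_def] _ _ sieve_mass[unfolded B\<^sub>K_def]]) auto
  next
    let ?s = "\<lambda>n. {G \<in> discrete_measures T. W2 G\<^sub>0 G = real (M n) * \<epsilon> n}"
    \<comment> \<open>The sphere joins the part without separation from \<open>G\<^sub>0\<close>; a
      sum of two little-o terms keeps the required rate.\<close>
    let ?R = "\<lambda>n. (discrete_measures T - \<G> n) \<union> ?s n"
    assume sphere: "(\<lambda>n. measure prior (?s n) / measure prior (B\<^sub>K (\<epsilon> n))) \<in> o(\<lambda>n. exp (- 2 * real n * (\<epsilon> n)\<^sup>2))"
    have "(\<lambda>n. measure prior (?R n) / measure prior (B\<^sub>K (\<epsilon> n))) \<in> o(\<lambda>n. exp (- 2 * real n * (\<epsilon> n)\<^sup>2))"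
    proof (rule landau_o.big_small_trans[OF _ sum_in_smallo(1)[OF sieve_mass sphere]], rule bigoI[where c = 1])
      show "eventually (\<lambda>n. norm (measure prior (?R n) / measure prior (B\<^sub>K (\<epsilon> n)))
          \<le> 1 * norm (measure prior (discrete_measures T - \<G> n) / measure prior (B\<^sub>K (\<epsilon> n))
            + measure prior (?s n) / measure prior (B\<^sub>K (\<epsilon> n)))) sequentially"
        using eventually_ge_at_top[of 1]
      proof eventually_elim
        case (elim n)
        have "measure prior (?R n) \<le> measure prior (discrete_measures T - \<G> n) + measure prior (?s n)"
          by (rule measure_Un_le[OF compl[OF elim] level_sets(3)])
        then show ?case
          by (simp add: add_divide_distrib[symmetric] divide_right_mono)
      qed
    qed
    then show "vanishes_in_probability \<Omega> (\<lambda>n \<omega>. posterior prior f n (\<lambda>i. X i \<omega>)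
        {G \<in> discrete_measures T. real (M n) * \<epsilon> n \<le> W2 G\<^sub>0 G})"
      by (intro bayes.contraction[where R = ?R, OF common sets.Un[OF compl level_sets(3)] level_sets(2) eps(1)
            KL_pos[unfolded B\<^sub>K_def] entropy shell_mass[unfolded \<Psi>_def B\<^sub>K_def] sum_cond[unfolded \<Psi>_def]])
        (auto simp: B\<^sub>K_def)
  qed
qed

end
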